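(* Let $\gamma\in\mathbb{R}\setminus\{0\}$, $\eta\in(0,1)$, and $0\le s_0<s<1<q<q_0<\infty$ with $s=(1-\eta)s_0+\eta$ and $\frac1q=\frac{1-\eta}{q_0}+\eta$. Let $X$ be a ball Banach function space on $\mathbb{R}^n$. Assume there is a sequence $\{\theta_m\}\subset(0,1)$ with $\lim_m\theta_m=1$ such that, for every $m$, $X^{1/\theta_m}$ is a ball Banach function space, $\mathcal{M}$ is bounded on $(X^{1/\theta_m})'$, and $\lim_{m\to\infty}\|\mathcal{M}\|_{(X^{1/\theta_m})'\to(X^{1/\theta_m})'}<\infty$. If $\gamma\in(-\infty,0)$, assume further that $\mathcal{M}$ is bounded on $X$, or that both $n=1$ and $\gamma\in(-\infty,-1)$. Then there exists $C>0$ such that for every $f\in C^1(\mathbb{R}^n)$ with $|\nabla f|\in C_{\mathrm c}(\mathbb{R}^n)$, $$\sup_{\lambda>0}\lambda\left\|\int_{\mathbb{R}^n}\mathbf{1}_{D_{\lambda,\gamma/q,s}[f]}(\cdot,y)|\cdot-y|^{\gamma-n}dy\right\|_X^{1/q}\le C\left[\sup_{\lambda>0}\lambda\left\|\int_{\mathbb{R}^n}\mathbf{1}_{D_{\lambda,\gamma/q_0,s_0}[f]}(\cdot,y)|\cdot-y|^{\gamma-n}dy\right\|_X^{1/q_0}\right]^{1-\eta}\|\,|\nabla f|\,\|_X^{\eta}.\qquad(\ast)$$ If moreover $X$ has an absolutely continuous norm and the centered ball average operators $\{\mathcal{B}_r\}_{r>0}$ are uniformly bounded on $X$, then $(\ast)$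 holds for every $f\in\dot W^{1,X}(\mathbb{R}^n)$.
   Context: A quasi-Banach space $X$ of measurable functions on $\mathbb{R}^n$ with quasi-norm defined on all measurable functions is a ball quasi-Banach function space if: $\|f\|_X=0$ implies $f=0$ a.e.; $|g|\le|f|$ a.e. implies $\|g\|_X\le\|f\|_X$; $0\le f_m\uparrow f$ a.e. implies $\|f_m\|_X\uparrow\|f\|_X$; $\mathbf{1}_B\in X$ for every ball $B$. It is a ball Banach function space if moreover the triangle inequality holds and for every ball $B$ there is $C_B$ with $\int_B|f|\le C_B\|f\|_X$. For $t>0$, $X^t:=\{f:|f|^t\in X\}$, $\|f\|_{X^t}:=\|\,|f|^t\|_X^{1/t}$. Associate space: $Y':=\{f:\|f\|_{Y'}:=\sup_{\|g\|_Y=1}\|fg\|_{L^1}<\infty\}$. Absolutely continuous norm: $\|f\mathbf{1}_{E_j}\|_X\to0$ whenever $f\in X$ and $\mathbf{1}_{E_j}\to0$ a.e. $\mathcal{B}_rf(x):=|B(x,r)|^{-1}\int_{B(x,r)}|f|$; uniformly bounded means $\sup_r\|\mathcal{B}_r\|_{X\to X}<\infty$. $\mathcal{M}$ is the Hardy--Littlewood maximal operator, bounded on $Y$ with least constant $\|\mathcal{M}\|_{Y\to Y}$. $\dot W^{1,X}$: distributions $f$ with $|\nabla f|\in X$. $D_{\lambda,\beta,\sigma}[f]:=\{(x,y):x\ne y,\ |f(x)-f(y)|/|x-y|^{\sigma+\beta}>\lambda\}$. *)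

theory Defs
  imports "HOL-Analysis.Analysis"
begin

text \<open>A (quasi-)norm X is modelled as a functional on real-valued functions on the
Euclidean space 'a (= R^n, n = DIM('a)) with values in [0,\<infinity>]; only its values on
Lebesgue measurable functions are constrained. f belongs to X iff X f < \<infinity>.\<close>

type_synonym 'a qnorm = "('a \<Rightarrow> real) \<Rightarrow> ennreal"

definition meas :: "('a::euclidean_space \<Rightarrow> real) set" where
  "meas = borel_measurable lebesgue"

definition Xext :: "'a::euclidean_space qnorm \<Rightarrow> ('a \<Rightarrow> ennreal) \<Rightarrow> ennreal" where
  "Xext X g = (if AE x in lebesgue. g x < \<infinity> then X (\<lambda>x. enn2real (g x)) else \<infinity>)"

definition enn_powr :: "ennreal \<Rightarrow> real \<Rightarrow> ennreal" where
  "enn_powr a p = (if a = \<infinity> then \<infinity> else ennreal (enn2real a powr p))"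

definition X_cauchy_complete :: "'a::euclidean_space qnorm \<Rightarrow> bool" where
  "X_cauchy_complete X \<longleftrightarrow>
    (\<forall>F::nat \<Rightarrow> 'a \<Rightarrow> real. (\<forall>m. F m \<in> meas \<and> X (F m) < \<infinity>) \<longrightarrow>
       (\<forall>e>0. \<exists>N. \<forall>m\<ge>N. \<forall>k\<ge>N. X (\<lambda>x. F m x - F k x) < ennreal e) \<longrightarrow>
       (\<exists>f\<in>meas. X f < \<infinity> \<and> (\<lambda>m. X (\<lambda>x. F m x - f x)) \<longlonglongrightarrow> 0))"

definition ball_quasi_Banach_fs :: "'a::euclidean_space qnorm \<Rightarrow> bool" where
  "ball_quasi_Banach_fs X \<longleftrightarrow>
    \<comment> \<open>quasi-norm\<close>
    (\<forall>f\<in>meas. \<forall>c::real. X (\<lambda>x. c * f x) = ennreal \<bar>c\<bar> * X f) \<and>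
    (\<exists>K::real\<ge>1. \<forall>f\<in>meas. \<forall>g\<in>meas. X (\<lambda>x. f x + g x) \<le> ennreal K * (X f + X g)) \<and>
    \<comment> \<open>completeness\<close>
    X_cauchy_complete X \<and>
    \<comment> \<open>ball quasi-Banach function space axioms\<close>
    (\<forall>f\<in>meas. X f = 0 \<longrightarrow> (AE x in lebesgue. f x = 0)) \<and>
    (\<forall>f\<in>meas. \<forall>g\<in>meas. (AE x in lebesgue. \<bar>g x\<bar> \<le> \<bar>f x\<bar>) \<longrightarrow> X g \<le> X f) \<and>
    (\<forall>F::nat \<Rightarrow> 'a \<Rightarrow> real. \<forall>f\<in>meas. (\<forall>m. F m \<in> meas) \<longrightarrow>
       (\<forall>m. AE x in lebesgue. 0 \<le> F m x \<and> F m x \<le> F (Suc m) x) \<longrightarrow>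
       (AE x in lebesgue. (\<lambda>m. F m x) \<longlonglongrightarrow> f x) \<longrightarrow>
       incseq (\<lambda>m. X (F m)) \<and> (\<lambda>m. X (F m)) \<longlonglongrightarrow> X f) \<and>
    (\<forall>c r. X (indicator (ball c r)) < \<infinity>)"

definition ball_Banach_fs :: "'a::euclidean_space qnorm \<Rightarrow> bool" where
  "ball_Banach_fs X \<longleftrightarrow> ball_quasi_Banach_fs X \<and>
    (\<forall>f\<in>meas. \<forall>g\<in>meas. X (\<lambda>x. f x + g x) \<le> X f + X g) \<and>
    (\<forall>c r. \<exists>C::real. \<forall>f\<in>meas.
        (\<integral>\<^sup>+ x\<in>ball c r. ennreal \<bar>f x\<bar> \<partial>lebesgue) \<le> ennreal C * X f)"

definition Xpow :: "'a::euclidean_space qnorm \<Rightarrow> real \<Rightarrow> 'a qnorm" where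
  "Xpow X t f = enn_powr (X (\<lambda>x. \<bar>f x\<bar> powr t)) (1 / t)"

definition assoc :: "'a::euclidean_space qnorm \<Rightarrow> 'a qnorm" where
  "assoc Y f = (SUP g\<in>{g\<in>meas. Y g = 1}. \<integral>\<^sup>+ x. ennreal \<bar>f x * g x\<bar> \<partial>lebesgue)"

definition ball_avg :: "('a::euclidean_space \<Rightarrow> real) \<Rightarrow> real \<Rightarrow> 'a \<Rightarrow> ennreal" where
  "ball_avg f r x = (\<integral>\<^sup>+ y\<in>ball x r. ennreal \<bar>f y\<bar> \<partial>lebesgue) / emeasure lebesgue (ball x r)"

definition maxop :: "('a::euclidean_space \<Rightarrow> real) \<Rightarrow> 'a \<Rightarrow> ennreal" where
  "maxop f x = (SUP r\<in>{0<..}. ball_avg f r x)"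

definition M_bound_const :: "'a::euclidean_space qnorm \<Rightarrow> ennreal \<Rightarrow> bool" where
  "M_bound_const Y C \<longleftrightarrow> (\<forall>f\<in>meas. Y f < \<infinity> \<longrightarrow> Xext Y (maxop f) \<le> C * Y f)"

definition M_opnorm :: "'a::euclidean_space qnorm \<Rightarrow> ennreal" where
  "M_opnorm Y = Inf {C. M_bound_const Y C}"

definition M_bounded :: "'a::euclidean_space qnorm \<Rightarrow> bool" where
  "M_bounded Y \<longleftrightarrow> M_opnorm Y < \<infinity>"

definition abs_cont_norm :: "'a::euclidean_space qnorm \<Rightarrow> bool" where
  "abs_cont_norm X \<longleftrightarrow> (\<forall>f\<in>meas. X f < \<infinity> \<longrightarrow>
     (\<forall>E::nat \<Rightarrow> 'a set. (\<forall>j. E j \<in> sets lebesgue) \<longrightarrow>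
        (AE x in lebesgue. (\<lambda>j. indicator (E j) x :: real) \<longlonglongrightarrow> 0) \<longrightarrow>
        (\<lambda>j. X (\<lambda>x. f x * indicator (E j) x)) \<longlonglongrightarrow> 0))"

definition ball_avg_unif_bounded :: "'a::euclidean_space qnorm \<Rightarrow> bool" where
  "ball_avg_unif_bounded X \<longleftrightarrow> (\<exists>C::real. \<forall>r>0. \<forall>f\<in>meas. X f < \<infinity> \<longrightarrow>
      Xext X (ball_avg f r) \<le> ennreal C * X f)"

definition Dset :: "real \<Rightarrow> real \<Rightarrow> real \<Rightarrow> ('a::euclidean_space \<Rightarrow> real) \<Rightarrow> ('a \<times> 'a) set" where
  "Dset lam \<beta> \<sigma> f = {(x, y). x \<noteq> y \<and> \<bar>f x - f y\<bar> / dist x y powr (\<sigma> + \<beta>) > lam}"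

definition BBM_quant :: "'a::euclidean_space qnorm \<Rightarrow> real \<Rightarrow> real \<Rightarrow> real \<Rightarrow> ('a \<Rightarrow> real) \<Rightarrow> ennreal" where
  "BBM_quant X \<gamma> p \<sigma> f = (SUP lam\<in>{0<..}. ennreal lam * enn_powr
     (Xext X (\<lambda>x. \<integral>\<^sup>+ y. indicator (Dset lam (\<gamma> / p) \<sigma> f) (x, y)
                     * ennreal (dist x y powr (\<gamma> - real DIM('a))) \<partial>lebesgue)) (1 / p))"

coinductive smooth_fn :: "('a::euclidean_space \<Rightarrow> real) \<Rightarrow> bool" where
  "(\<forall>x. (\<phi> has_derivative (\<lambda>h. G x \<bullet> h)) (at x)) \<Longrightarrow> (\<forall>i\<in>Basis. smooth_fn (\<lambda>x. G x \<bullet> i))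
     \<Longrightarrow> smooth_fn \<phi>"

definition test_fn :: "('a::euclidean_space \<Rightarrow> real) \<Rightarrow> bool" where
  "test_fn \<phi> \<longleftrightarrow> smooth_fn \<phi> \<and> bounded {x. \<phi> x \<noteq> 0}"

definition locally_integrable :: "('a::euclidean_space \<Rightarrow> 'b::{banach,second_countable_topology}) \<Rightarrow> bool" where
  "locally_integrable f \<longleftrightarrow> (\<forall>K. compact K \<longrightarrow> set_integrable lebesgue K f)"

definition weak_gradient :: "('a::euclidean_space \<Rightarrow> real) \<Rightarrow> ('a \<Rightarrow> 'a) \<Rightarrow> bool" where
  "weak_gradient f G \<longleftrightarrow> locally_integrable f \<and> locally_integrable G \<and>
     (\<forall>\<phi> G\<phi>. test_fn \<phi> \<longrightarrow> (\<forall>x. (\<phi> has_derivative (\<lambda>h. G\<phi> x \<bullet> h)) (at x)) \<longrightarrow>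
        (\<integral>x. f x *\<^sub>R G\<phi> x \<partial>lebesgue) = - (\<integral>x. \<phi> x *\<^sub>R G x \<partial>lebesgue))"

definition in_hom_Sobolev :: "'a::euclidean_space qnorm \<Rightarrow> ('a \<Rightarrow> real) \<Rightarrow> ('a \<Rightarrow> 'a) \<Rightarrow> bool" where
  "in_hom_Sobolev X f G \<longleftrightarrow> weak_gradient f G \<and> X (\<lambda>x. norm (G x)) < \<infinity>"

end

theory Submission imports Defs begin

text \<open>Write |f(x)-f(y)| / |x-y|^(s+\<gamma>/q) as A^(1-\<eta>) B^\<eta>, where A and B are the difference quotients with
  the parameters (s0, q0) and (1, 1). If \<mu>1^(1-\<eta>) \<mu>2^\<eta> = \<lambda>, then A^(1-\<eta>) B^\<eta> > \<lambda> implies A > \<mu>1 or B > \<mu>2,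
  so optimising in \<mu>1 and \<mu>2 reduces the theorem to the endpoint estimate: the level sets of B
  have norm at most C / \<lambda> times the norm of |\<nabla>f|.

  The hypothesis on X^(1/\<theta>) gives, by Young's inequality and \<theta> \<rightarrow> 1, that the maximal operator M is
  bounded on the associate space X'. Since X = X'' (a projection argument in L^2 of a ball), the endpoint
  estimate may be tested against a weight w in X', where it reads: the integral of w times the level
  function is at most C / \<lambda> times the integral of |\<nabla>f| M(M w). For \<gamma> > 0 this follows from
  telescoping averages of f and a Vitali covering by large balls with much mass of |\<nabla>f|; for \<gamma> < -1 on the
  line from a covering that selects small balls first; and when M is bounded on X from the
  pointwise bound of |f(x)-f(y)| by C |x-y| (M|\<nabla>f|(x) + M|\<nabla>f|(y)).

  Only the bound of |f(z)-f(x)| by the integral of the gradient along the segment from x to z is used about f.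
  A Sobolev function is mollified; by duality the mollified gradient is again controlled in X, and Fatou's lemma
  passes to the limit.\<close>

section \<open>Duality for function norms on Borel functions\<close>

text \<open>For a single \<theta> the hypothesis bounds M on the associate of X^(1/\<theta>), not on
  that of X. Young's inequality compares the two at the cost of (1 - \<theta>) times the integral of
  the weight, and a test function bounded by k costs a factor k^(1 - \<theta>). Both errors vanish
  in the limit only for integrable weights and bounded test functions, so the bound is proved for
  truncations and extended by monotone convergence. For \<gamma> > 0 no maximal function of
  |\<nabla>f| may appear, since M is not assumed to be bounded on X; M has to fall on the weight.
  Coverings achieve this: the selected balls are disjoint and carry a known amount of mass of
  |\<nabla>f|, while the integral of the weight over an enlarged ball is at most its volume times M
  w at every point of the selected ball. The averages of |\<nabla>f| at the scales 2^(-j) |x-y| have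
  to be summed over j. Thresholds that grow like 2^(j/2) make both the telescoping series and the
  series of covering bounds geometric.\<close>

lemma ball_sets_borel [measurable]:
  "ball (c::'a::metric_space) r \<in> sets borel" "cball (c::'a::metric_space) r \<in> sets borel"
  by auto

text \<open>Cutting both the values and the support makes the function bounded and integrable, as
  the projection in L^2 and the limit \<theta> \<rightarrow> 1 require; with growing k the
  truncations increase to \<open>F\<close>.\<close>

definition trunc :: "nat \<Rightarrow> ('a::euclidean_space \<Rightarrow> ennreal) \<Rightarrow> 'a \<Rightarrow> real" where
  "trunc k F x = enn2real (min (F x) (of_nat k)) * indicator (ball 0 (real k)) x"

lemma ennreal_trunc: "ennreal (trunc k F x) = min (F x) (of_nat k) * indicator (ball 0 (real k)) x"
  unfolding trunc_def by (subst ennreal_mult) (auto simp: ennreal_indicator ennreal_enn2real_if min_def top_unique)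

lemma trunc_measurable [measurable]: "F \<in> borel_measurable borel \<Longrightarrow> trunc k F \<in> borel_measurable borel"
  unfolding trunc_def[abs_def] by (intro borel_measurable_times borel_measurable_indicator) auto

lemma trunc_bounds: "0 \<le> trunc k F x" "trunc k F x \<le> real k" "ennreal (trunc k F x) \<le> F x"
proof -
  show "0 \<le> trunc k F x" by (simp add: trunc_def)
  have "enn2real (min (F x) (of_nat k)) \<le> real k"
    using enn2real_mono[of "min (F x) (of_nat k)" "of_nat k"] by (simp add: of_nat_less_top)
  then show "trunc k F x \<le> real k" by (auto simp: trunc_def indicator_def)
  show "ennreal (trunc k F x) \<le> F x" unfolding ennreal_trunc by (auto simp: indicator_def)
qed

lemma trunc_incseq: "incseq (\<lambda>k x. ennreal (trunc k F x))"
proof (intro incseq_SucI le_funI)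
  fix k x
  have "min (F x) (of_nat k) \<le> min (F x) (of_nat (Suc k))" by (intro min.mono) (auto simp del: of_nat_Suc)
  then show "ennreal (trunc k F x) \<le> ennreal (trunc (Suc k) F x)"
    unfolding ennreal_trunc by (intro mult_mono) (auto simp: indicator_def simp del: of_nat_Suc)
qed

lemma trunc_SUP: "(SUP k. ennreal (trunc k F x)) = F x"
proof (rule antisym)
  show "(SUP k. ennreal (trunc k F x)) \<le> F x" by (intro SUP_least trunc_bounds)
  have "F x = min (F x) (SUP k::nat. of_nat k)" by (simp add: ennreal_SUP_of_nat_eq_top)
  also have "\<dots> = (SUP k::nat. min (F x) (of_nat k))" by (simp add: inf_SUP flip: inf_min)
  also have "\<dots> \<le> (SUP k. ennreal (trunc k F x))"
  proof (intro SUP_least)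
    fix k :: nat
    obtain m :: nat where m: "norm x < real m" using reals_Archimedean2 by blast
    have "min (F x) (of_nat k) \<le> min (F x) (of_nat (max k m))" by (intro min.mono) auto
    also have "\<dots> = ennreal (trunc (max k m) F x)" using m by (simp add: ennreal_trunc)
    also have "\<dots> \<le> (SUP k. ennreal (trunc k F x))" by (intro SUP_upper) auto
    finally show "min (F x) (of_nat k) \<le> (SUP k. ennreal (trunc k F x))" .
  qed
  finally show "F x \<le> (SUP k. ennreal (trunc k F x))" .
qed

text \<open>The estimates are carried out for Borel functions with values in [0,\<infinity>]; the norm N stands for
  the extension of a ball Banach function norm to such functions.\<close>

locale function_norm =
  fixes N :: "('a::euclidean_space \<Rightarrow> ennreal) \<Rightarrow> ennreal"
  assumes N_mono: "\<And>F H. \<lbrakk>F \<in> borel_measurable borel; H \<in> borel_measurable borel;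
      AE x in lborel. F x \<le> H x\<rbrakk> \<Longrightarrow> N F \<le> N H"
    and N_add: "\<And>F H. \<lbrakk>F \<in> borel_measurable borel; H \<in> borel_measurable borel\<rbrakk>
      \<Longrightarrow> N (\<lambda>x. F x + H x) \<le> N F + N H"
    and N_cmult: "\<And>F c. F \<in> borel_measurable borel \<Longrightarrow> N (\<lambda>x. ennreal c * F x) = ennreal c * N F"
    and N_SUP: "\<And>F. \<lbrakk>\<And>k::nat. F k \<in> borel_measurable borel; incseq F\<rbrakk>
      \<Longrightarrow> N (\<lambda>x. SUP k. F k x) \<le> (SUP k. N (F k))"
    and N_zero: "\<And>F. \<lbrakk>F \<in> borel_measurable borel; N F = 0\<rbrakk> \<Longrightarrow> AE x in lborel. F x = 0"
    and N_ball: "\<And>c r. N (indicator (ball c r)) < \<infinity>"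
begin

text \<open>The associate norm of \<open>u\<close> is at most \<open>A\<close>. Unlike in
  \<open>assoc\<close>, which takes a supremum over the unit sphere, the test functions range over
  the unit ball, so that a truncated test function stays admissible.\<close>

definition dual_le :: "('a \<Rightarrow> ennreal) \<Rightarrow> ennreal \<Rightarrow> bool" where
  "dual_le u A \<longleftrightarrow> (\<forall>h\<in>borel_measurable borel. N h \<le> 1 \<longrightarrow> (\<integral>\<^sup>+x. u x * h x \<partial>lborel) \<le> A)"

lemma N_cong_AE:
  assumes "F \<in> borel_measurable borel" "H \<in> borel_measurable borel" "AE x in lborel. F x = H x"
  shows "N F = N H"
  by (intro antisym N_mono assms) (use assms(3) in eventually_elim; simp)+

text \<open>Hoelder's inequality: dividing \<open>h\<close> by its norm reduces to the unit ball,
  and a function of norm zero vanishes almost everywhere by \<open>N_zero\<close>.\<close>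

lemma dual_le_D:
  assumes "dual_le u A" and [measurable]: "u \<in> borel_measurable borel" "h \<in> borel_measurable borel" 
    and fin: "N h < \<infinity>"
  shows "(\<integral>\<^sup>+x. u x * h x \<partial>lborel) \<le> A * N h"
proof (cases "N h = 0")
  case True
  then have "AE x in lborel. h x = 0" by (intro N_zero) auto
  then have "AE x in lborel. u x * h x = 0"
    by eventually_elim simp
  then have "(\<integral>\<^sup>+x. u x * h x \<partial>lborel) = (\<integral>\<^sup>+(x::'a). 0 \<partial>lborel)"
    by (rule nn_integral_cong_AE)
  then show ?thesis by simp
next
  case False
  obtain c where c: "N h = ennreal c" "c > 0"
    using fin False by (cases "N h") (auto simp: ennreal_zero_less_top less_le)
  have "N (\<lambda>x. ennreal (1/c) * h x) = ennreal (1/c) * ennreal c"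
    by (subst N_cmult) (auto simp: c)
  also have "\<dots> = 1" using c by (simp flip: ennreal_mult)
  finally have "(\<integral>\<^sup>+x. u x * (ennreal (1/c) * h x) \<partial>lborel) \<le> A"
    using assms(1)[unfolded dual_le_def, rule_format, of "\<lambda>x. ennreal (1/c) * h x"] by simp
  then have "ennreal c * (\<integral>\<^sup>+x. u x * (ennreal (1/c) * h x) \<partial>lborel) \<le> ennreal c * A"
    by (intro mult_left_mono) auto
  also have "ennreal c * (\<integral>\<^sup>+x. u x * (ennreal (1/c) * h x) \<partial>lborel) = (\<integral>\<^sup>+x. ennreal c * (u x * (ennreal (1/c) * h x)) \<partial>lborel)"
    by (simp add: nn_integral_cmult)
  also have "\<dots> = (\<integral>\<^sup>+x. u x * h x \<partial>lborel)"
  proof (intro nn_integral_cong)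
    fix x
    have "ennreal c * (u x * (ennreal (1/c) * h x)) = (ennreal c * ennreal (1/c)) * (u x * h x)"
      by (simp add: mult_ac)
    also have "ennreal c * ennreal (1/c) = 1" using c by (simp flip: ennreal_mult)
    finally show "ennreal c * (u x * (ennreal (1/c) * h x)) = u x * h x" by simp
  qed
  finally show ?thesis by (simp add: c mult.commute)
qed

section \<open>Projection onto the unit ball of the norm, in L^2 of a ball\<close>

context
  fixes F :: "'a \<Rightarrow> real" and b R :: real
  assumes F_meas [measurable]: "F \<in> borel_measurable borel"
    and F_bounds: "\<And>x. 0 \<le> F x" "\<And>x. F x \<le> b"
    and F_support: "\<And>x. x \<notin> ball 0 R \<Longrightarrow> F x = 0"
begin

text \<open>Boundedness and the common support make every product of two members integrable. The
  bound may vary with the function, so the set is convex but need not be closed in L^2;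
  \<open>unit_set_min\<close> makes up for this.\<close>

definition unit_set :: "('a \<Rightarrow> real) set" where
  "unit_set = {h \<in> borel_measurable borel. (\<exists>k. \<forall>x. 0 \<le> h x \<and> h x \<le> k) \<and>
     (\<forall>x. x \<notin> ball 0 R \<longrightarrow> h x = 0) \<and> N (\<lambda>x. ennreal (h x)) \<le> 1}"

definition sqdist :: "('a \<Rightarrow> real) \<Rightarrow> real" where
  "sqdist h = (\<integral>x. (F x - h x)\<^sup>2 \<partial>lborel)"

lemma bounded_support_integrable:
  fixes h :: "'a \<Rightarrow> real"
  assumes [measurable]: "h \<in> borel_measurable borel" and "\<And>x. \<bar>h x\<bar> \<le> k" "\<And>x. x \<notin> ball 0 R \<Longrightarrow> h x = 0"
  shows "integrable lborel h"
proof (rule Bochner_Integration.integrable_bound)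
  have "emeasure lborel (ball (0::'a) R) < \<infinity>" using emeasure_lborel_ball_finite by auto
  then show "integrable lborel (\<lambda>x::'a. k * indicator (ball 0 R) x)"
    by (intro integrable_mult_right integrable_real_indicator) auto
  show "AE x in lborel. norm (h x) \<le> norm (k * indicator (ball 0 R) x)"
  proof (intro AE_I2)
    fix x
    show "norm (h x) \<le> norm (k * indicator (ball 0 R) x)"
      using assms(2)[of x] assms(3)[of x] by (cases "x \<in> ball 0 R") auto
  qed
qed simp

lemma unit_setD:
  assumes "h \<in> unit_set"
  shows "h \<in> borel_measurable borel" "0 \<le> h x" "x \<notin> ball 0 R \<Longrightarrow> h x = 0" "N (\<lambda>x. ennreal (h x)) \<le> 1"
    "\<exists>k. \<forall>x. \<bar>h x\<bar> \<le> k"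
proof -
  show "\<exists>k. \<forall>x. \<bar>h x\<bar> \<le> k"
    using assms unfolding unit_set_def by (fastforce simp: abs_of_nonneg)
qed (use assms in \<open>auto simp: unit_set_def\<close>)

lemma prod_integrable:
  assumes "g \<in> unit_set \<union> {F}" "h \<in> unit_set \<union> {F}"
  shows "integrable lborel (\<lambda>x. g x * h x)"
proof -
  have *: "g \<in> borel_measurable borel \<and> (\<exists>k. \<forall>x. \<bar>g x\<bar> \<le> k) \<and> (\<forall>x. x \<notin> ball 0 R \<longrightarrow> g x = 0)" if "g \<in> unit_set \<union> {F}" for g
    using that
  proof
    assume "g \<in> unit_set" then show ?thesis using unit_setD[of g] by blast
  next
    assume "g \<in> {F}" then show ?thesis using F_meas F_bounds F_support
      by (auto intro!: exI[of _ b] simp: abs_of_nonneg)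
  qed
  obtain k l where "\<forall>x. \<bar>g x\<bar> \<le> k" "\<forall>x. \<bar>h x\<bar> \<le> l" using *[OF assms(1)] *[OF assms(2)] by blast
  then have "\<bar>g x * h x\<bar> \<le> k * l" for x
    unfolding abs_mult by (intro mult_mono') auto
  then show ?thesis
    using *[OF assms(1)] *[OF assms(2)] by (intro bounded_support_integrable[of _ "k*l"]) auto
qed

lemma unit_set_convex:
  assumes g: "g \<in> unit_set" and h: "h \<in> unit_set" and t: "0 \<le> t" "t \<le> 1"
  shows "(\<lambda>x. (1 - t) * g x + t * h x) \<in> unit_set"
proof -
  note [measurable] = unit_setD(1)[OF g] unit_setD(1)[OF h]
  obtain k l where kl: "\<forall>x. \<bar>g x\<bar> \<le> k" "\<forall>x. \<bar>h x\<bar> \<le> l" using unit_setD(5)[OF g] unit_setD(5)[OF h] by auto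
  have le: "(1 - t) * g x + t * h x \<le> (1 - t) * k + t * l" for x
    using kl t by (intro add_mono mult_left_mono) (auto intro: order_trans[OF abs_ge_self])
  have "(\<lambda>x. ennreal ((1 - t) * g x + t * h x)) = (\<lambda>x. ennreal (1 - t) * ennreal (g x) + ennreal t * ennreal (h x))"
    using t unit_setD(2)[OF g] unit_setD(2)[OF h] by (simp add: ennreal_mult' ennreal_plus)
  then have "N (\<lambda>x. ennreal ((1 - t) * g x + t * h x)) \<le> N (\<lambda>x. ennreal (1 - t) * ennreal (g x)) + N (\<lambda>x. ennreal t * ennreal (h x))"
    by (simp add: N_add)
  also have "\<dots> = ennreal (1-t) * N (\<lambda>x. ennreal (g x)) + ennreal t * N (\<lambda>x. ennreal (h x))"
    by (simp add: N_cmult)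
  also have "\<dots> \<le> ennreal (1-t) * 1 + ennreal t * 1"
    by (intro add_mono mult_left_mono unit_setD(4) g h) auto
  also have "\<dots> = 1" using t by (simp flip: ennreal_plus)
  finally have le1: "N (\<lambda>x. ennreal ((1 - t) * g x + t * h x)) \<le> 1" .
  have "0 \<le> (1 - t) * g x + t * h x" for x
    using unit_setD(2)[OF g, of x] unit_setD(2)[OF h, of x] t by simp
  moreover have "(1 - t) * g x + t * h x = 0" if "x \<notin> ball 0 R" for x
    using unit_setD(3)[OF g that] unit_setD(3)[OF h that] by simp
  ultimately show ?thesis
    unfolding unit_set_def using le le1 by (auto intro!: exI[of _ "(1 - t) * k + t * l"])
qed

text \<open>Cutting off the values of \<open>h\<close> above \<open>F\<close> increases neither the
  norm nor the distance to \<open>F\<close>. It makes a minimising sequence uniformly bounded, so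
  that dominated convergence applies to it.\<close>

lemma unit_set_min:
  assumes h: "h \<in> unit_set"
  shows "(\<lambda>x. min (h x) (F x)) \<in> unit_set" "sqdist (\<lambda>x. min (h x) (F x)) \<le> sqdist h"
proof -
  note [measurable] = unit_setD(1)[OF h]
  have "N (\<lambda>x. ennreal (min (h x) (F x))) \<le> N (\<lambda>x. ennreal (h x))"
    by (intro N_mono) (auto intro!: AE_I2 ennreal_leI)
  also note unit_setD(4)[OF h]
  finally show 1: "(\<lambda>x. min (h x) (F x)) \<in> unit_set"
    unfolding unit_set_def using unit_setD(2,3)[OF h] F_bounds F_support
    by (auto intro!: exI[of _ b] simp: min.coboundedI2)
  have i: "integrable lborel (\<lambda>x. (F x - g x)\<^sup>2)" if "g \<in> unit_set" for g
  proof -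
    have "(\<lambda>x. (F x - g x)\<^sup>2) = (\<lambda>x. F x * F x - 2 * (F x * g x) + g x * g x)"
      by (auto simp: power2_eq_square algebra_simps)
    then show ?thesis using prod_integrable[of F g] prod_integrable[of F F] prod_integrable[of g g] that
      by simp
  qed
  show "sqdist (\<lambda>x. min (h x) (F x)) \<le> sqdist h"
    unfolding sqdist_def
  proof (intro integral_mono i 1 h)
    show "(F x - min (h x) (F x))\<^sup>2 \<le> (F x - h x)\<^sup>2" for x
      by (auto simp: min_def)
  qed
qed

lemma sq_integrable:
  assumes "g \<in> unit_set \<union> {F}" "h \<in> unit_set \<union> {F}"
  shows "integrable lborel (\<lambda>x. (g x - h x)\<^sup>2)"
proof -
  have "(\<lambda>x. (g x - h x)\<^sup>2) = (\<lambda>x. g x * g x - 2 * (g x * h x) + h x * h x)"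
    by (auto simp: power2_eq_square algebra_simps)
  then show ?thesis using prod_integrable[of g h] prod_integrable[of g g] prod_integrable[of h h] assms
    by simp
qed

text \<open>The midpoint is written in the shape of \<open>unit_set_convex\<close> with t = 1/2, so
  that its membership in the unit set is an instance of that lemma.\<close>

lemma sqdist_parallelogram:
  assumes g: "g \<in> unit_set" and h: "h \<in> unit_set"
  shows "(\<integral>x. (g x - h x)\<^sup>2 \<partial>lborel) = 2 * sqdist g + 2 * sqdist h - 4 * sqdist (\<lambda>x. (1 - 1/2) * g x + 1/2 * h x)"
proof -
  have m: "(\<lambda>x. (1 - 1/2) * g x + 1/2 * h x) \<in> unit_set" using unit_set_convex[OF g h, of "1/2"] by simp
  have "2 * sqdist g + 2 * sqdist h - 4 * sqdist (\<lambda>x. (1 - 1/2) * g x + 1/2 * h x)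
     = (\<integral>x. 2 * (F x - g x)\<^sup>2 + 2 * (F x - h x)\<^sup>2 - 4 * (F x - ((1 - 1/2) * g x + 1/2 * h x))\<^sup>2 \<partial>lborel)"
    unfolding sqdist_def using sq_integrable[of F g] sq_integrable[of F h] sq_integrable[OF _ UnI1[OF m], of F] g h by simp
  also have "\<dots> = (\<integral>x. (g x - h x)\<^sup>2 \<partial>lborel)"
    by (intro Bochner_Integration.integral_cong) (auto simp: power2_eq_square field_simps)
  finally show ?thesis by simp
qed

lemma sqdist_nonneg: "0 \<le> sqdist h"
  unfolding sqdist_def by simp

text \<open>By the parallelogram identity a sequence that minimises the squared distance to F fast enough
  converges almost everywhere, and Fatou's lemma keeps its limit in the unit set. The residual of F at
  the minimiser is then, up to scaling, the separating function.\<close>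

lemma minimizer_exists:
  obtains h where "h \<in> unit_set" "\<And>x. h x \<le> F x" "\<And>g. g \<in> unit_set \<Longrightarrow> sqdist h \<le> sqdist g"
proof -
  define d where "d = Inf (sqdist ` unit_set)"
  have zero: "(\<lambda>_. 0) \<in> unit_set"
    unfolding unit_set_def using N_cmult[of "\<lambda>_. 0" 0] by auto
  have bdd: "bdd_below (sqdist ` unit_set)" by (auto intro!: bdd_belowI sqdist_nonneg)
  have d_le: "d \<le> sqdist h" if "h \<in> unit_set" for h
    unfolding d_def by (intro cInf_lower bdd imageI that)
  \<comment> \<open>The rate (1/4)^n makes the L^2 distance of successive terms at most a multiple
    of 2^(-n), which is summable.\<close>
  have "\<exists>h\<in>unit_set. (\<forall>x. h x \<le> F x) \<and> sqdist h < d + (1/4)^n" for n :: nat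
  proof -
    have "Inf (sqdist ` unit_set) < d + (1/4)^n" unfolding d_def by simp
    then obtain h where "h \<in> unit_set" "sqdist h < d + (1/4)^n"
      using cInf_lessD[of "sqdist ` unit_set"] zero by blast
    then show ?thesis using unit_set_min[of h]
      by (intro bexI[of _ "\<lambda>x. min (h x) (F x)"]) auto
  qed
  then obtain h where h: "\<And>n. h n \<in> unit_set" "\<And>n x. h n x \<le> F x" "\<And>n. sqdist (h n) < d + (1/4)^n"
    by metis
  have [measurable]: "h n \<in> borel_measurable borel" for n using unit_setD(1)[OF h(1)] .
  define V where "V = measure lborel (ball (0::'a) R)"
  have fin: "emeasure lborel (ball (0::'a) R) < \<infinity>" using emeasure_lborel_ball_finite by auto
  have diff_int: "integrable lborel (\<lambda>x. \<bar>h n x - h (Suc n) x\<bar>)" for n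
  proof (rule bounded_support_integrable)
    show "\<bar>\<bar>h n x - h (Suc n) x\<bar>\<bar> \<le> b" for x
      using h(2)[of n x] h(2)[of "Suc n" x] F_bounds[of x] unit_setD(2)[OF h(1), of n x] unit_setD(2)[OF h(1), of "Suc n" x]
      by simp
    show "\<bar>h n x - h (Suc n) x\<bar> = 0" if "x \<notin> ball 0 R" for x
      using unit_setD(3)[OF h(1) that] by simp
  qed measurable
  have step: "(\<integral>x. \<bar>h n x - h (Suc n) x\<bar> \<partial>lborel) \<le> (5 + V) * (1/2)^n" for n
  proof -
    have "(\<integral>x. (h n x - h (Suc n) x)\<^sup>2 \<partial>lborel) \<le> 2 * (d + (1/4)^n) + 2 * (d + (1/4)^(Suc n)) - 4 * d"
      unfolding sqdist_parallelogram[OF h(1) h(1)]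
      using h(3)[of n] h(3)[of "Suc n"] d_le[OF unit_set_convex[OF h(1)[of n] h(1)[of "Suc n"], of "1/2"]] by simp
    also have "\<dots> \<le> 5 * (1/4)^n" by simp
    finally have sq: "(\<integral>x. (h n x - h (Suc n) x)\<^sup>2 \<partial>lborel) \<le> 5 * (1/4)^n" .
    \<comment> \<open>The pointwise inequality a \<le> 2^n a^2 + 2^(-n) takes the place of
      Cauchy-Schwarz: integrated over the ball, it turns the bound of order 4^(-n) for the square
      into one of order 2^(-n) for the L^1 distance.\<close>
    have "(\<integral>x. \<bar>h n x - h (Suc n) x\<bar> \<partial>lborel)
        \<le> (\<integral>x. 2^n * (h n x - h (Suc n) x)\<^sup>2 + (1/2)^n * indicator (ball 0 R) x \<partial>lborel)"
    proof (rule integral_mono[OF diff_int])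
      have "integrable lborel (indicator (ball (0::'a) R) :: 'a \<Rightarrow> real)"
        using fin by (intro integrable_real_indicator) auto
      moreover have "integrable lborel (\<lambda>x. (h n x - h (Suc n) x)\<^sup>2)"
        using h by (intro sq_integrable) auto
      ultimately show "integrable lborel (\<lambda>x. 2^n * (h n x - h (Suc n) x)\<^sup>2 + (1/2)^n * indicator (ball 0 R) x)"
        by simp
      show "\<bar>h n x - h (Suc n) x\<bar> \<le> 2^n * (h n x - h (Suc n) x)\<^sup>2 + (1/2)^n * indicator (ball 0 R) x" for x
      proof (cases "x \<in> ball 0 R")
        case True
        define a where "a = \<bar>h n x - h (Suc n) x\<bar>"
        define e where "e = (1/2::real)^n"
        have e: "e > 0" "2^n = 1/e" by (auto simp: e_def power_one_over)
        have "a * e \<le> a\<^sup>2 + e\<^sup>2" 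
        proof -
          have "0 \<le> a * e" using e(1) by (simp add: a_def)
          then show ?thesis using sum_squares_bound[of a e] by linarith
        qed
        then have "a \<le> 1/e * a\<^sup>2 + e" using e(1) by (simp add: field_simps power2_eq_square)
        then show ?thesis using True e by (simp add: a_def flip: e_def)
      next
        case False
        then show ?thesis using unit_setD(3)[OF h(1) False] by simp
      qed
    qed
    also have "\<dots> = 2^n * (\<integral>x. (h n x - h (Suc n) x)\<^sup>2 \<partial>lborel) + (1/2)^n * V"
      using sq_integrable[of "h n" "h (Suc n)"] h(1) fin by (simp add: V_def)
    also have "\<dots> \<le> 2^n * (5 * (1/4)^n) + (1/2)^n * V"
      using sq by (intro add_mono mult_left_mono) auto
    also have "2^n * (5 * (1/4)^n) = 5 * (1/2::real)^n"
      by (simp add: power_one_over field_simps flip: power_mult_distrib)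
    finally show ?thesis by (simp add: algebra_simps)
  qed
  have "(\<integral>\<^sup>+x. (\<Sum>n. ennreal \<bar>h n x - h (Suc n) x\<bar>) \<partial>lborel) = (\<Sum>n. \<integral>\<^sup>+x. ennreal \<bar>h n x - h (Suc n) x\<bar> \<partial>lborel)"
    by (intro nn_integral_suminf) measurable
  also have "\<dots> \<le> (\<Sum>n. ennreal ((5 + V) * (1/2)^n))"
    using step by (intro suminf_le) (auto simp: nn_integral_eq_integral[OF diff_int] ennreal_leI)
  also have "\<dots> = ennreal (\<Sum>n. (5 + V) * (1/2)^n)"
    by (intro suminf_ennreal2 summable_mult summable_geometric) (auto simp: V_def)
  also have "\<dots> < \<infinity>" by simp
  finally have fin_sum: "(\<integral>\<^sup>+x. (\<Sum>n. ennreal \<bar>h n x - h (Suc n) x\<bar>) \<partial>lborel) \<noteq> \<infinity>" by simp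
  have "AE x in lborel. (\<Sum>n. ennreal \<bar>h n x - h (Suc n) x\<bar>) \<noteq> \<infinity>"
    by (rule nn_integral_PInf_AE[OF _ fin_sum]) measurable
  then have conv: "AE x in lborel. convergent (\<lambda>n. h n x)"
  proof eventually_elim
    case (elim x)
    then have "summable (\<lambda>n. \<bar>h n x - h (Suc n) x\<bar>)"
      by (intro summable_suminf_not_top) simp_all
    then have "summable (\<lambda>n. h n x - h (Suc n) x)"
      by (rule summable_rabs_cancel)
    then have "convergent (\<lambda>n. \<Sum>i<n. h i x - h (Suc i) x)"
      by (simp only: summable_iff_convergent)
    moreover have "(\<lambda>n. \<Sum>i<n. h i x - h (Suc i) x) = (\<lambda>n. h 0 x - h n x)"
      by (rule ext) (rule sum_lessThan_telescope')
    ultimately obtain l where "(\<lambda>n. h 0 x - h n x) \<longlonglongrightarrow> l"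
      unfolding convergent_def by auto
    then have "(\<lambda>n. h 0 x - (h 0 x - h n x)) \<longlonglongrightarrow> h 0 x - l"
      by (intro tendsto_intros)
    then show ?case unfolding convergent_def by auto
  qed
  \<comment> \<open>A lower limit instead of a limit: it exists at every point, is measurable, and
    is an increasing supremum of infima, which is the form that \<open>N_SUP\<close>
    accepts.\<close>
  define h0 where "h0 x = enn2real (liminf (\<lambda>n. ennreal (h n x)))" for x
  have liminf_le: "liminf (\<lambda>n. ennreal (h n x)) \<le> ennreal (F x)" for x
    using Liminf_mono[of "\<lambda>n. ennreal (h n x)" "\<lambda>_. ennreal (F x)" sequentially] h(2)
    by (simp add: ennreal_leI Liminf_const)
  have ennreal_h0: "ennreal (h0 x) = liminf (\<lambda>n. ennreal (h n x))" for x
    unfolding h0_def by (intro ennreal_enn2real) (use liminf_le[of x] in \<open>auto simp: le_less_trans\<close>)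
  have h0_le: "h0 x \<le> F x" for x
    using liminf_le[of x] F_bounds(1)[of x] by (simp flip: ennreal_h0 add: ennreal_le_iff)
  have h0_nonneg: "0 \<le> h0 x" for x by (simp add: h0_def)
  have [measurable]: "h0 \<in> borel_measurable borel" unfolding h0_def by measurable
  have "N (\<lambda>x. ennreal (h0 x)) = N (\<lambda>x. SUP n. INF k\<in>{n..}. ennreal (h k x))"
    unfolding ennreal_h0 liminf_SUP_INF ..
  also have "\<dots> \<le> (SUP n. N (\<lambda>x. INF k\<in>{n..}. ennreal (h k x)))"
    by (intro N_SUP incseq_SucI le_funI INF_superset_mono) auto
  also have "\<dots> \<le> 1"
  proof (intro SUP_least)
    fix n
    have "N (\<lambda>x. INF k\<in>{n..}. ennreal (h k x)) \<le> N (\<lambda>x. ennreal (h n x))"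
      by (intro N_mono AE_I2 INF_lower) auto
    also note unit_setD(4)[OF h(1)]
    finally show "N (\<lambda>x. INF k\<in>{n..}. ennreal (h k x)) \<le> 1" .
  qed
  finally have "N (\<lambda>x. ennreal (h0 x)) \<le> 1" .
  moreover have "h0 x = 0" if "x \<notin> ball 0 R" for x
    using h0_le[of x] h0_nonneg[of x] F_support[OF that] by simp
  ultimately have h0_mem: "h0 \<in> unit_set"
    unfolding unit_set_def using h0_nonneg order_trans[OF h0_le F_bounds(2)] by (auto intro!: exI[of _ b])
  have "(\<lambda>n. sqdist (h n)) \<longlonglongrightarrow> sqdist h0"
    unfolding sqdist_def
  proof (rule integral_dominated_convergence)
    show "integrable lborel (\<lambda>x. (F x)\<^sup>2)" using prod_integrable[of F F] by (simp add: power2_eq_square)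
    show "AE x in lborel. norm ((F x - h n x)\<^sup>2) \<le> (F x)\<^sup>2" for n
      using h(2) unit_setD(2)[OF h(1)] by (auto intro!: AE_I2 power_mono)
    show "AE x in lborel. (\<lambda>n. (F x - h n x)\<^sup>2) \<longlonglongrightarrow> (F x - h0 x)\<^sup>2"
      using conv
    proof eventually_elim
      case (elim x)
      then obtain l where l: "(\<lambda>n. h n x) \<longlonglongrightarrow> l" by (auto simp: convergent_def)
      then have "(\<lambda>n. ennreal (h n x)) \<longlonglongrightarrow> ennreal l" by (rule tendsto_ennrealI)
      then have "liminf (\<lambda>n. ennreal (h n x)) = ennreal l" by (intro lim_imp_Liminf) auto
      moreover have "0 \<le> l" using l unit_setD(2)[OF h(1)] by (intro LIMSEQ_le_const[OF l]) auto
      ultimately have "h0 x = l" unfolding h0_def by simp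
      with l show ?case by (intro tendsto_intros) auto
    qed
  qed measurable
  moreover have "(\<lambda>n. d + (1/4)^n) \<longlonglongrightarrow> d + 0"
    by (intro tendsto_intros LIMSEQ_realpow_zero) auto
  ultimately have "sqdist h0 \<le> d + 0"
    using h(3) by (intro LIMSEQ_le) (auto intro: less_imp_le)
  then have "sqdist h0 \<le> sqdist g" if "g \<in> unit_set" for g using d_le[OF that] by simp
  with h0_mem h0_le that show ?thesis by blast
qed

text \<open>Let v = F - h0 and let c be the integral of v h0. Minimality along the segment from
  \<open>h0\<close> to g says, to first order, that the integral of v g is at most c for every g in
  the unit set. Division by c gives the dual bound; and since v \<ge> 0 and h0 \<le> F, the integral
  of v F is at least c.\<close>

lemma separating_function:
  assumes big: "N (\<lambda>x. ennreal (F x)) > 1"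
  obtains u where "u \<in> borel_measurable borel" "dual_le u 1" "(\<integral>\<^sup>+x. u x * ennreal (F x) \<partial>lborel) \<ge> 1"
proof -
  obtain h0 where h0: "h0 \<in> unit_set" "\<And>x. h0 x \<le> F x" and min: "\<And>g. g \<in> unit_set \<Longrightarrow> sqdist h0 \<le> sqdist g"
    using minimizer_exists by blast
  note [measurable] = unit_setD(1)[OF h0(1)]
  define v where "v x = F x - h0 x" for x
  have v_nonneg: "0 \<le> v x" for x using h0(2)[of x] by (simp add: v_def)
  have [measurable]: "v \<in> borel_measurable borel" unfolding v_def by measurable
  have vg_int: "integrable lborel (\<lambda>x. v x * g x)" if "g \<in> unit_set \<union> {F}" for g
    unfolding v_def using prod_integrable[OF _ that, of F] prod_integrable[OF _ that, of h0] h0(1)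
    by (simp add: left_diff_distrib)
  define c where "c = (\<integral>x. v x * h0 x \<partial>lborel)"
  have var: "(\<integral>x. v x * g x \<partial>lborel) \<le> c" if g: "g \<in> unit_set" for g
  proof -
    define D where "D = (\<integral>x. (g x - h0 x)\<^sup>2 \<partial>lborel)"
    define S where "S = (\<integral>x. v x * g x \<partial>lborel) - c"
    have "2 * S \<le> t * D" if t: "0 < t" "t \<le> 1" for t
    proof -
      have vsq: "(\<lambda>x. v x * v x) = (\<lambda>x. (F x - h0 x)\<^sup>2)" by (simp add: v_def power2_eq_square)
      have "sqdist h0 \<le> sqdist (\<lambda>x. (1 - t) * h0 x + t * g x)"
        using t by (intro min unit_set_convex h0 g) auto
      also have "\<dots> = (\<integral>x. v x * v x - (2 * t) * (v x * g x - v x * h0 x) + t\<^sup>2 * (g x - h0 x)\<^sup>2 \<partial>lborel)"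
        unfolding sqdist_def by (intro Bochner_Integration.integral_cong) (auto simp: v_def power2_eq_square algebra_simps)
      also have "\<dots> = sqdist h0 - (2 * t) * S + t\<^sup>2 * D"
        using vg_int[of g] vg_int[of h0] g h0(1) sq_integrable[of F h0] sq_integrable[of g h0]
        by (simp add: vsq S_def c_def D_def sqdist_def)
      finally have "t * (2 * S) \<le> t * (t * D)" by (simp add: power2_eq_square algebra_simps)
      with t show ?thesis by simp
    qed
    then have ev: "\<forall>\<^sub>F t in at_right 0. 2 * S \<le> t * D"
      by (intro eventually_at_rightI[of 0 1]) auto
    have "((\<lambda>t. t * D) \<longlongrightarrow> 0 * D) (at_right 0)" by (intro tendsto_intros)
    then have "2 * S \<le> 0" using ev by (intro tendsto_lowerbound[of "\<lambda>t. t * D" _ "at_right 0"]) auto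
    then show ?thesis by (simp add: S_def)
  qed
  have "c > 0"
  proof (rule ccontr)
    assume c: "\<not> c > 0"
    obtain e where e: "N (indicator (ball 0 R)) = ennreal e" "0 \<le> e" using N_ball[of 0 R] by (cases "N (indicator (ball 0 R))") auto
    \<comment> \<open>A small multiple of the indicator of the ball lies in the unit set and is
      positive wherever \<open>v\<close> can be nonzero. So c \<le> 0 would force v = 0 almost
      everywhere, and \<open>F\<close> would have norm at most 1. The 1 in 1 + e covers e =
      0.\<close>
    define g where "g x = (1 / (1 + e)) * indicator (ball 0 R) x" for x :: 'a
    have "N (\<lambda>x. ennreal (g x)) = ennreal (1/(1+e)) * N (indicator (ball 0 R))"
    proof (subst N_cmult[symmetric])
      show "indicator (ball 0 R) \<in> borel_measurable (borel :: 'a measure)" by (intro borel_measurable_indicator) auto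
      show "N (\<lambda>x. ennreal (g x)) = N (\<lambda>x. ennreal (1 / (1 + e)) * indicator (ball 0 R) x)"
        unfolding g_def using e(2) by (intro arg_cong[of _ _ N] ext) (auto simp: indicator_def)
    qed
    also have "\<dots> \<le> 1" using e by (simp flip: ennreal_mult)
    finally have "N (\<lambda>x. ennreal (g x)) \<le> 1" .
    moreover have "g \<in> borel_measurable borel" unfolding g_def by measurable
    ultimately have g: "g \<in> unit_set" unfolding unit_set_def using e(2)
      by (auto simp: g_def indicator_def intro!: exI[of _ "1/(1+e)"])
    have "(\<integral>x. v x * g x \<partial>lborel) \<le> 0" using var[OF g] c by simp
    moreover have nn: "0 \<le> v x * g x" for x using v_nonneg[of x] unit_setD(2)[OF g] by simp
    ultimately have "(\<integral>x. v x * g x \<partial>lborel) = 0" by (meson antisym Bochner_Integration.integral_nonneg)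
    then have "AE x in lborel. v x * g x = 0"
      using integral_nonneg_eq_0_iff_AE[OF vg_int[of g]] g nn by auto
    then have "AE x in lborel. ennreal (F x) = ennreal (h0 x)"
    proof eventually_elim
      case (elim x)
      then show ?case using e(2) F_support[of x] unit_setD(3)[OF h0(1), of x] by (cases "x \<in> ball 0 R") (auto simp: g_def v_def)
    qed
    then have "N (\<lambda>x. ennreal (F x)) = N (\<lambda>x. ennreal (h0 x))" by (intro N_cong_AE) auto
    then show False using unit_setD(4)[OF h0(1)] big by simp
  qed
  show ?thesis
  proof
    show "(\<lambda>x. ennreal (v x / c)) \<in> borel_measurable borel" by measurable
    show "dual_le (\<lambda>x. ennreal (v x / c)) 1"
      unfolding dual_le_def
    proof (intro ballI impI)
      fix h :: "'a \<Rightarrow> ennreal" assume [measurable]: "h \<in> borel_measurable borel" and h1: "N h \<le> 1"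
      \<comment> \<open>The support is cut to the fixed ball of radius \<open>R\<close>:
        \<open>v\<close> vanishes outside it, so no part of the integral is lost.\<close>
      define hk where "hk k x = enn2real (min (h x) (of_nat k)) * indicator (ball 0 R) x" for k :: nat and x
      have [measurable]: "hk k \<in> borel_measurable borel" for k unfolding hk_def
        by (intro borel_measurable_times borel_measurable_indicator) auto
      have ehk: "ennreal (hk k x) = min (h x) (of_nat k) * indicator (ball 0 R) x" for k x
        unfolding hk_def by (subst ennreal_mult) (auto simp: ennreal_indicator ennreal_enn2real_if min_def top_unique)
      have "N (\<lambda>x. ennreal (hk k x)) \<le> N h" for k
        by (intro N_mono AE_I2) (auto simp: ehk indicator_def)
      with h1 have N1: "N (\<lambda>x. ennreal (hk k x)) \<le> 1" for k by (meson order_trans)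
      have bd: "0 \<le> hk k x \<and> hk k x \<le> real k" for k x
      proof -
        have "enn2real (min (h x) (of_nat k)) \<le> enn2real (of_nat k)"
          by (intro enn2real_mono) (auto simp: of_nat_less_top)
        then show ?thesis by (auto simp: hk_def indicator_def)
      qed
      then have mem: "hk k \<in> unit_set" for k
        unfolding unit_set_def using N1 by (auto simp: hk_def)
      have le: "(\<integral>\<^sup>+x. ennreal (v x / c) * ennreal (hk k x) \<partial>lborel) \<le> 1" for k
      proof -
        have "(\<integral>\<^sup>+x. ennreal (v x / c) * ennreal (hk k x) \<partial>lborel) = (\<integral>\<^sup>+x. ennreal (v x * hk k x / c) \<partial>lborel)"
          using v_nonneg \<open>c > 0\<close> bd by (intro nn_integral_cong) (simp flip: ennreal_mult)
        also have "\<dots> = ennreal (\<integral>x. v x * hk k x / c \<partial>lborel)"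
          using vg_int[of "hk k"] mem v_nonneg \<open>c > 0\<close> bd by (intro nn_integral_eq_integral) auto
        also have "\<dots> \<le> 1" using var[OF mem, of k] \<open>c > 0\<close> by simp
        finally show ?thesis .
      qed
      have supk: "ennreal (v x / c) * h x = (SUP k. ennreal (v x / c) * ennreal (hk k x))" for x
      proof (cases "x \<in> ball 0 R")
        case True
        have "(SUP k. ennreal (v x / c) * ennreal (hk k x)) = ennreal (v x / c) * (SUP k. min (h x) (of_nat k))"
          using True by (simp add: ehk SUP_mult_left_ennreal)
        also have "(SUP k::nat. min (h x) (of_nat k)) = min (h x) (SUP k::nat. of_nat k)"
          by (simp add: inf_SUP flip: inf_min)
        also have "\<dots> = h x" by (simp add: ennreal_SUP_of_nat_eq_top)
        finally show ?thesis by simp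
      next
        case False
        then show ?thesis using F_support[OF False] unit_setD(3)[OF h0(1) False] by (simp add: v_def)
      qed
      have inc: "incseq (\<lambda>k x. ennreal (v x / c) * ennreal (hk k x))"
        by (intro incseq_SucI le_funI mult_left_mono)
           (auto simp: ehk indicator_def min_def of_nat_Suc intro: order_trans[OF _ add_increasing[OF _ order_refl]])
      have "(\<integral>\<^sup>+x. ennreal (v x / c) * h x \<partial>lborel) = (SUP k. \<integral>\<^sup>+x. ennreal (v x / c) * ennreal (hk k x) \<partial>lborel)"
        unfolding supk by (intro nn_integral_monotone_convergence_SUP inc) measurable
      also have "\<dots> \<le> 1" using le by (intro SUP_least)
      finally show "(\<integral>\<^sup>+x. ennreal (v x / c) * h x \<partial>lborel) \<le> 1" .
    qed
    have "1 = ennreal (\<integral>x. v x * h0 x / c \<partial>lborel)" using \<open>c > 0\<close> by (simp add: c_def)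
    also have "\<dots> \<le> ennreal (\<integral>x. v x * F x / c \<partial>lborel)"
      using vg_int[of h0] vg_int[of F] h0 v_nonneg \<open>c > 0\<close>
      by (intro ennreal_leI integral_mono) (auto intro!: divide_right_mono mult_left_mono)
    also have "\<dots> = (\<integral>\<^sup>+x. ennreal (v x * F x / c) \<partial>lborel)"
      using vg_int[of F] v_nonneg F_bounds(1) \<open>c > 0\<close> by (intro nn_integral_eq_integral[symmetric]) auto
    also have "\<dots> = (\<integral>\<^sup>+x. ennreal (v x / c) * ennreal (F x) \<partial>lborel)"
      using v_nonneg \<open>c > 0\<close> F_bounds by (intro nn_integral_cong) (simp flip: ennreal_mult)
    finally show "1 \<le> (\<integral>\<^sup>+x. ennreal (v x / c) * ennreal (F x) \<partial>lborel)" .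
  qed
qed

end

text \<open>If A < B < N F, the Fatou property yields a truncation of norm above B. Separating this
  truncation, divided by B, from the unit ball gives an admissible \<open>u\<close> whose integral
  against \<open>F\<close> is at least B, contrary to the bound A.\<close>

theorem Lorentz_Luxemburg:
  assumes [measurable]: "F \<in> borel_measurable borel"
    and dual: "\<And>u. u \<in> borel_measurable borel \<Longrightarrow> dual_le u 1 \<Longrightarrow> (\<integral>\<^sup>+x. u x * F x \<partial>lborel) \<le> A"
  shows "N F \<le> A"
proof (rule ccontr)
  assume "\<not> N F \<le> A"
  then have "A < N F" by simp
  then obtain B where B: "A < B" "B < N F" using dense by blast
  then obtain a where a: "B = ennreal a" "0 \<le> a" by (cases B) auto
  have "a > 0" using B a by (cases "a = 0") auto
  have "B < N F" by fact
  also have "N F = N (\<lambda>x. SUP k. ennreal (trunc k F x))" by (simp add: trunc_SUP)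
  also have "\<dots> \<le> (SUP k. N (\<lambda>x. ennreal (trunc k F x)))"
    by (intro N_SUP trunc_incseq) measurable
  finally obtain k where k: "B < N (\<lambda>x. ennreal (trunc k F x))" by (auto simp: less_SUP_iff)
  define H where "H x = trunc k F x / a" for x
  have [measurable]: "H \<in> borel_measurable borel" unfolding H_def by measurable
  have eH: "ennreal (H x) = ennreal (1/a) * ennreal (trunc k F x)" for x
    using \<open>a > 0\<close> trunc_bounds(1)[of k F x] by (simp add: H_def flip: ennreal_mult)
  have "ennreal a * N (\<lambda>x. ennreal (H x)) = N (\<lambda>x. ennreal (trunc k F x))"
    unfolding eH using \<open>a > 0\<close> by (subst N_cmult) (auto simp flip: mult.assoc ennreal_mult)
  then have gt1: "N (\<lambda>x. ennreal (H x)) > 1"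
  proof -
    have "\<not> N (\<lambda>x. ennreal (H x)) \<le> 1"
    proof
      assume "N (\<lambda>x. ennreal (H x)) \<le> 1"
      then have "ennreal a * N (\<lambda>x. ennreal (H x)) \<le> ennreal a * 1" by (intro mult_left_mono) auto
      then show False using k a \<open>ennreal a * N (\<lambda>x. ennreal (H x)) = N (\<lambda>x. ennreal (trunc k F x))\<close> by simp
    qed
    then show ?thesis by simp
  qed
  have bound: "H x \<le> real k / a" for x
    using \<open>a > 0\<close> trunc_bounds(2)[of k F x] by (simp add: H_def divide_right_mono)
  obtain u where u: "u \<in> borel_measurable borel" "dual_le u 1" "(\<integral>\<^sup>+x. u x * ennreal (H x) \<partial>lborel) \<ge> 1"
    by (rule separating_function[of H "real k / a" "real k", OF _ _ bound _ gt1])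
       (use \<open>a > 0\<close> in \<open>auto simp: H_def trunc_def\<close>)
  note [measurable] = u(1)
  have "B \<le> B * (\<integral>\<^sup>+x. u x * ennreal (H x) \<partial>lborel)" using mult_left_mono[OF u(3), of B] by simp
  also have "\<dots> = (\<integral>\<^sup>+x. u x * ennreal (trunc k F x) \<partial>lborel)"
  proof (subst nn_integral_cmult[symmetric])
    show "(\<integral>\<^sup>+x. B * (u x * ennreal (H x)) \<partial>lborel) = (\<integral>\<^sup>+x. u x * ennreal (trunc k F x) \<partial>lborel)"
    proof (intro nn_integral_cong)
      fix x
      have "B * (u x * ennreal (H x)) = u x * (ennreal a * ennreal (H x))" by (simp add: a mult_ac)
      also have "ennreal a * ennreal (H x) = ennreal (trunc k F x)" using \<open>a > 0\<close> by (simp add: H_def flip: ennreal_mult')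
      finally show "B * (u x * ennreal (H x)) = u x * ennreal (trunc k F x)" .
    qed
  qed measurable
  also have "\<dots> \<le> (\<integral>\<^sup>+x. u x * F x \<partial>lborel)"
    by (intro nn_integral_mono mult_left_mono trunc_bounds(3)) simp
  also have "\<dots> \<le> A" by (intro dual u)
  finally show False using B by simp
qed

end

section \<open>The centered maximal function\<close>

definition avg :: "'a::euclidean_space \<Rightarrow> real \<Rightarrow> ('a \<Rightarrow> ennreal) \<Rightarrow> ennreal" where
  "avg x r u = (\<integral>\<^sup>+ y\<in>ball x r. u y \<partial>lborel) / emeasure lborel (ball x r)"

text \<open>\<open>maxop\<close> takes real functions to functions with values in [0,\<infinity>].
  Here arguments and results are of the same kind, so that the operator can be iterated as in
  \<open>Mx (Mx u)\<close>.\<close>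

definition Mx :: "('a::euclidean_space \<Rightarrow> ennreal) \<Rightarrow> 'a \<Rightarrow> ennreal" where
  "Mx u x = (SUP r\<in>{0<..}. avg x r u)"

abbreviation omega :: "'a::euclidean_space itself \<Rightarrow> real" where
  "omega _ \<equiv> unit_ball_vol (real DIM('a))"

lemma emeasure_ball':
  "0 \<le> r \<Longrightarrow> emeasure lborel (ball (c::'a::euclidean_space) r) = ennreal (omega TYPE('a) * r ^ DIM('a))"
  by (rule emeasure_ball)

lemma omega_pos: "omega TYPE('a::euclidean_space) > 0"
  by simp

lemma emeasure_ball_pos:
  fixes c :: "'a::euclidean_space"
  assumes "0 < r"
  shows "emeasure lborel (ball c r) \<noteq> 0" "emeasure lborel (ball c r) \<noteq> \<infinity>"
  using assms emeasure_ball'[of r c] omega_pos[where 'a='a] by (auto simp del: unit_ball_vol_pos)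

lemma avg_mono: "(\<And>y. u y \<le> v y) \<Longrightarrow> avg x r u \<le> avg x r v"
  unfolding avg_def by (intro divide_right_mono_ennreal nn_integral_mono mult_right_mono) auto

lemma Mx_mono: "(\<And>y. u y \<le> v y) \<Longrightarrow> Mx u x \<le> Mx v x"
  unfolding Mx_def by (intro SUP_mono' avg_mono)

lemma avg_cong_AE:
  assumes "AE y in lborel. u y = v y"
  shows "avg x r u = avg x r v"
  unfolding avg_def using assms by (intro arg_cong2[of _ _ _ _ "(/)"] nn_integral_cong_AE refl) auto

lemma Mx_cong_AE: "AE y in lborel. u y = v y \<Longrightarrow> Mx u x = Mx v x"
  unfolding Mx_def by (auto cong: avg_cong_AE)

lemma ball_integral_eq:
  fixes u :: "'a::euclidean_space \<Rightarrow> ennreal"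
  assumes "0 < r"
  shows "(\<integral>\<^sup>+ y\<in>ball x r. u y \<partial>lborel) = ennreal (omega TYPE('a) * r ^ DIM('a)) * avg x r u"
proof -
  define m where "m = emeasure lborel (ball x r)"
  define I where "I = (\<integral>\<^sup>+ y\<in>ball x r. u y \<partial>lborel)"
  have m: "m \<noteq> 0" "m \<noteq> \<infinity>" using emeasure_ball_pos[OF assms] by (auto simp: m_def)
  have "m * (I / m) = I * m / m" by (simp only: ennreal_times_divide mult.commute)
  also have "\<dots> = I" using m by (intro mult_divide_eq_ennreal) auto
  finally have "I = m * (I / m)" by (rule sym)
  moreover have "m = ennreal (omega TYPE('a) * r ^ DIM('a))"
    unfolding m_def using assms by (intro emeasure_ball') auto
  ultimately show ?thesis by (simp add: avg_def m_def I_def)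
qed

lemma avg_le_Mx: "0 < r \<Longrightarrow> avg x r u \<le> Mx u x"
  unfolding Mx_def by (intro SUP_upper) auto

lemma ball_integral_le_Mx:
  fixes u :: "'a::euclidean_space \<Rightarrow> ennreal"
  assumes "0 < m" "ball c r \<subseteq> ball z m"
  shows "(\<integral>\<^sup>+ y\<in>ball c r. u y \<partial>lborel) \<le> ennreal (omega TYPE('a) * m ^ DIM('a)) * Mx u z"
proof -
  have "(\<integral>\<^sup>+ y\<in>ball c r. u y \<partial>lborel) \<le> (\<integral>\<^sup>+ y\<in>ball z m. u y \<partial>lborel)"
    using assms(2) by (intro nn_integral_mono mult_left_mono) (auto simp: indicator_def)
  also have "\<dots> \<le> ennreal (omega TYPE('a) * m ^ DIM('a)) * Mx u z"
    unfolding ball_integral_eq[OF assms(1)] by (intro mult_left_mono avg_le_Mx assms) auto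
  finally show ?thesis .
qed

lemma SUP_shrinking_balls:
  fixes u :: "'a::euclidean_space \<Rightarrow> ennreal"
  assumes [measurable]: "u \<in> borel_measurable borel"
  shows "(\<integral>\<^sup>+ y\<in>ball x r. u y \<partial>lborel) = (SUP k::nat. \<integral>\<^sup>+ y\<in>ball x (r - 1/Suc k). u y \<partial>lborel)"
proof -
  have "indicator (ball x r) y = (SUP k::nat. indicator (ball x (r - 1/Suc k)) y :: ennreal)" for y
  proof (cases "y \<in> ball x r")
    case True
    then obtain k :: nat where "inverse (Suc k) < r - dist x y" using reals_Archimedean[of "r - dist x y"] by auto
    then have "y \<in> ball x (r - 1/Suc k)" by (simp add: inverse_eq_divide)
    then have "1 \<le> (SUP k::nat. indicator (ball x (r - 1/Suc k)) y :: ennreal)"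
      by (intro SUP_upper2[of k]) auto
    then show ?thesis using True by (intro antisym SUP_least) (auto simp: indicator_def)
  next
    case False
    have "y \<notin> ball x (r - 1/Suc k)" for k :: nat
    proof -
      have "0 < 1 / real (Suc k)" by simp
      then have "ball x (r - 1/Suc k) \<subseteq> ball x r" by (intro subset_ball) linarith
      with False show ?thesis by blast
    qed
    then show ?thesis using False by simp
  qed
  then have "(\<integral>\<^sup>+ y\<in>ball x r. u y \<partial>lborel) = (\<integral>\<^sup>+ y. (SUP k::nat. u y * indicator (ball x (r - 1/Suc k)) y) \<partial>lborel)"
    by (simp add: SUP_mult_left_ennreal)
  also have "\<dots> = (SUP k::nat. \<integral>\<^sup>+ y\<in>ball x (r - 1/Suc k). u y \<partial>lborel)"
  proof (intro nn_integral_monotone_convergence_SUP incseq_SucI le_funI mult_left_mono)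
    fix k :: nat and y
    have "ball x (r - 1/Suc k) \<subseteq> ball x (r - 1/Suc (Suc k))"
      by (intro subset_ball diff_left_mono divide_left_mono) auto
    then show "indicator (ball x (r - 1/Suc k)) y \<le> (indicator (ball x (r - 1/Suc (Suc k))) y :: ennreal)"
      by (auto simp: indicator_def)
  qed auto
  finally show ?thesis .
qed

text \<open>Some slightly smaller ball still has mass above \<open>c\<close>, and it lies in every
  ball of radius \<open>r\<close> with a nearby centre. This lower semicontinuity makes
  \<open>Mx\<close> measurable although its supremum runs over uncountably many radii.\<close>

lemma open_ball_integral_gt:
  fixes u :: "'a::euclidean_space \<Rightarrow> ennreal"
  assumes [measurable]: "u \<in> borel_measurable borel"
  shows "open {x. c < (\<integral>\<^sup>+ y\<in>ball x r. u y \<partial>lborel)}"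
  unfolding open_dist
proof (intro ballI)
  fix x assume "x \<in> {x. c < (\<integral>\<^sup>+ y\<in>ball x r. u y \<partial>lborel)}"
  then have "c < (\<integral>\<^sup>+ y\<in>ball x r. u y \<partial>lborel)" by simp
  then obtain k :: nat where k: "c < (\<integral>\<^sup>+ y\<in>ball x (r - 1/Suc k). u y \<partial>lborel)"
    unfolding SUP_shrinking_balls[OF assms, of x r] less_SUP_iff by blast
  show "\<exists>e>0. \<forall>y. dist y x < e \<longrightarrow> y \<in> {x. c < (\<integral>\<^sup>+ y\<in>ball x r. u y \<partial>lborel)}"
  proof (intro exI[of _ "1/Suc k"] conjI allI impI CollectI)
    fix z assume z: "dist z x < 1/Suc k"
    have "ball x (r - 1/Suc k) \<subseteq> ball z r"
    proof
      fix y assume "y \<in> ball x (r - 1/Suc k)"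
      then show "y \<in> ball z r" using z dist_triangle[of z y x] by simp
    qed
    then have "(\<integral>\<^sup>+ y\<in>ball x (r - 1/Suc k). u y \<partial>lborel) \<le> (\<integral>\<^sup>+ y\<in>ball z r. u y \<partial>lborel)"
      by (intro nn_integral_mono mult_left_mono) (auto simp: indicator_def)
    with k show "c < (\<integral>\<^sup>+ y\<in>ball z r. u y \<partial>lborel)" by (rule less_le_trans)
  qed simp
qed

lemma open_avg_gt:
  fixes u :: "'a::euclidean_space \<Rightarrow> ennreal"
  assumes "u \<in> borel_measurable borel" "0 < r"
  shows "open {x. c < avg x r u}"
proof -
  define m where "m = ennreal (omega TYPE('a) * r ^ DIM('a))"
  have m: "m \<noteq> 0" "m \<noteq> \<infinity>" using assms omega_pos[where 'a='a] by (auto simp: m_def simp del: unit_ball_vol_pos)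
  have "c < avg x r u \<longleftrightarrow> m * c < (\<integral>\<^sup>+ y\<in>ball x r. u y \<partial>lborel)" for x
  proof -
    have "m * c < m * avg x r u \<longleftrightarrow> c < avg x r u"
      using m ennreal_mult_strict_left_mono[of c "avg x r u" m] mult_left_mono[of "avg x r u" c m]
      by (auto simp: not_less zero_less_iff_neq_zero less_top intro: ccontr)
    then show ?thesis using ball_integral_eq[OF assms(2), where x=x and u=u] by (simp add: m_def)
  qed
  then show ?thesis using open_ball_integral_gt[OF assms(1)] by simp
qed

lemma Mx_measurable [measurable]:
  fixes u :: "'a::euclidean_space \<Rightarrow> ennreal"
  assumes "u \<in> borel_measurable borel"
  shows "Mx u \<in> borel_measurable borel"
proof (rule borel_measurableI_greater)
  fix c
  have "{x. c < Mx u x} = (\<Union>r\<in>{0<..}. {x. c < avg x r u})"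
    by (auto simp: Mx_def less_SUP_iff)
  then have "open {x. c < Mx u x}" using open_avg_gt[OF assms] by (auto intro!: open_UN)
  then show "{x \<in> space borel. c < Mx u x} \<in> sets borel" by simp
qed

lemma Mx_const_1: "Mx (\<lambda>_. 1) x = 1"
proof -
  have "avg x r (\<lambda>_. 1) = 1" if "0 < r" for r
    using emeasure_ball_pos[OF that, of x] by (simp add: avg_def less_top ennreal_divide_self)
  then show ?thesis unfolding Mx_def by (auto intro!: antisym SUP_least SUP_upper2[of 1])
qed

section \<open>Integrals of the radial kernel against the maximal function\<close>

lemma powr_suminf_ennreal:
  fixes a :: real assumes "0 < a" "a < 1" "0 \<le> K"
  shows "(\<Sum>k. ennreal (K * a ^ k)) = ennreal (K / (1 - a))"
proof -
  have "(\<Sum>k. ennreal (K * a ^ k)) = ennreal (\<Sum>k. K * a ^ k)"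
    using assms by (intro suminf_ennreal2 summable_mult summable_geometric) auto
  also have "(\<Sum>k. K * a ^ k) = K / (1 - a)"
    using assms by (subst suminf_mult) (auto simp: suminf_geometric intro: summable_geometric)
  finally show ?thesis .
qed

text \<open>On the k-th dyadic annulus distances lie between R/2^(k+1) and R/2^k, so the kernel
  times the volume of the outer ball is of order (R/2^k)^\<gamma>, and \<gamma> > 0 makes the series
  geometric. The factor 2^n is the ratio of the volumes for the outer and the inner radius.\<close>

lemma kernel_near:
  fixes x :: "'a::euclidean_space" and u :: "'a \<Rightarrow> ennreal" and \<gamma> R :: real
  assumes [measurable]: "u \<in> borel_measurable borel" and \<gamma>: "0 < \<gamma>" and R: "0 < R"
  shows "(\<integral>\<^sup>+ y. indicator (ball x R) y * ennreal (dist x y powr (\<gamma> - DIM('a))) * u y \<partial>lborel)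
     \<le> ennreal (2 ^ DIM('a) * omega TYPE('a) / (1 - 2 powr -\<gamma>) * R powr \<gamma>) * Mx u x"
proof -
  let ?n = "DIM('a)"
  define c where "c k = (R / 2^k) powr \<gamma> * (R / 2^Suc k) powr - real ?n" for k :: nat
  have "(\<integral>\<^sup>+ y. indicator (ball x R) y * ennreal (dist x y powr (\<gamma> - ?n)) * u y \<partial>lborel)
      \<le> (\<integral>\<^sup>+ y. (\<Sum>k. ennreal (c k) * (u y * indicator (ball x (R / 2^k)) y)) \<partial>lborel)"
  proof (intro nn_integral_mono)
    fix y
    show "indicator (ball x R) y * ennreal (dist x y powr (\<gamma> - ?n)) * u y
       \<le> (\<Sum>k. ennreal (c k) * (u y * indicator (ball x (R / 2^k)) y))"
    proof (cases "y \<in> ball x R \<and> y \<noteq> x")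
      case True
      define d where "d = dist x y"
      have d: "0 < d" "d < R" using True by (auto simp: d_def)
      obtain m where "(1/2)^m < d / R" using real_arch_pow_inv[of "d/R" "1/2"] d R by auto
      then have m: "R / 2 ^ m < d" using R by (simp add: field_simps power_one_over)
      define k where "k = (LEAST k. R / 2 ^ Suc k \<le> d)"
      have ex: "R / 2 ^ Suc m \<le> d" using m R d by (simp add: field_simps)
      then have k1: "R / 2 ^ Suc k \<le> d" unfolding k_def by (rule LeastI)
      have k2: "d < R / 2 ^ k"
      proof (cases k)
        case (Suc j)
        then have "\<not> R / 2 ^ Suc j \<le> d" unfolding k_def by (intro not_less_Least) auto
        then show ?thesis using Suc by simp
      qed (use d in simp)
      have "d powr (\<gamma> - ?n) = d powr \<gamma> * d powr - real ?n" by (simp flip: powr_add)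
      also have "\<dots> \<le> c k" unfolding c_def
        using d k1 k2 \<gamma> R by (intro mult_mono powr_mono2 powr_mono2') auto
      finally have "ennreal (d powr (\<gamma> - ?n)) \<le> ennreal (c k)" by (rule ennreal_leI)
      then have "indicator (ball x R) y * ennreal (dist x y powr (\<gamma> - ?n)) * u y
          \<le> ennreal (c k) * (u y * indicator (ball x (R / 2^k)) y)"
        using True k2 by (simp add: d_def mult.assoc[symmetric] mult_right_mono)
      also have "\<dots> \<le> (\<Sum>k. ennreal (c k) * (u y * indicator (ball x (R / 2^k)) y))"
        using sum_le_suminf[of "\<lambda>k. ennreal (c k) * (u y * indicator (ball x (R / 2^k)) y)" "{k}"] by simp
      finally show ?thesis .
    next
      case False
      \<comment> \<open>At y = x the kernel is 0 because of the convention
        \<open>0 powr a = 0\<close>.\<close>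
      then have "indicator (ball x R) y * ennreal (dist x y powr (\<gamma> - ?n)) * u y = 0" by auto
      then show ?thesis by (metis zero_le)
    qed
  qed
  also have "\<dots> = (\<Sum>k. ennreal (c k) * (\<integral>\<^sup>+ y\<in>ball x (R / 2^k). u y \<partial>lborel))"
    by (simp add: nn_integral_suminf nn_integral_cmult)
  also have "\<dots> \<le> (\<Sum>k. ennreal (2 ^ ?n * omega TYPE('a) * R powr \<gamma> * (2 powr - \<gamma>) ^ k) * Mx u x)"
  proof (intro suminf_le)
    fix k
    have "c k = R powr \<gamma> * (2 powr - \<gamma>) ^ k * (2 ^ Suc k / R) ^ ?n"
    proof -
      have "(R / 2^k) powr \<gamma> = R powr \<gamma> * (2 powr - \<gamma>) ^ k"
        using R by (simp add: powr_divide powr_minus power_inverse inverse_eq_divide powr_realpow[symmetric] powr_powr mult.commute)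
      moreover have "(R / 2^Suc k) powr - real ?n = (2 ^ Suc k / R) ^ ?n"
        using R by (simp add: powr_minus powr_realpow power_divide)
      ultimately show ?thesis by (simp add: c_def)
    qed
    then have eq: "c k * (omega TYPE('a) * (R / 2^k) ^ ?n) = 2 ^ ?n * omega TYPE('a) * R powr \<gamma> * (2 powr - \<gamma>) ^ k"
      using R by (simp add: power_divide power_mult_distrib)
    have "ennreal (c k) * (\<integral>\<^sup>+ y\<in>ball x (R / 2^k). u y \<partial>lborel)
        \<le> ennreal (c k) * (ennreal (omega TYPE('a) * (R / 2^k) ^ ?n) * Mx u x)"
      using R by (intro mult_left_mono ball_integral_le_Mx) auto
    also have "\<dots> = ennreal (c k * (omega TYPE('a) * (R / 2^k) ^ ?n)) * Mx u x"
      using R by (subst ennreal_mult) (auto simp: c_def mult.assoc)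
    finally show "ennreal (c k) * (\<integral>\<^sup>+ y\<in>ball x (R / 2^k). u y \<partial>lborel)
        \<le> ennreal (2 ^ ?n * omega TYPE('a) * R powr \<gamma> * (2 powr - \<gamma>) ^ k) * Mx u x" unfolding eq .
  qed auto
  also have "\<dots> = ennreal (2 ^ ?n * omega TYPE('a) * R powr \<gamma> / (1 - 2 powr - \<gamma>)) * Mx u x"
    using \<gamma> R powr_less_mono[of "-\<gamma>" 0 2] by (subst ennreal_suminf_multc, subst powr_suminf_ennreal) auto
  finally show ?thesis by (simp add: mult_ac)
qed

text \<open>For \<gamma> < 0 the annuli are summed outwards. The maximal function is taken at a
  point \<open>z\<close> other than the centre, because a covering argument needs the bound at all
  points of a selected ball. Passing from balls about \<open>c\<close> to balls about
  \<open>z\<close> doubles the radii, whence 4^n instead of 2^n.\<close>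

lemma kernel_far:
  fixes c z :: "'a::euclidean_space" and u :: "'a \<Rightarrow> ennreal" and \<gamma> R :: real
  assumes [measurable]: "u \<in> borel_measurable borel" and \<gamma>: "\<gamma> < 0" and R: "0 < R" and z: "dist c z \<le> R"
  shows "(\<integral>\<^sup>+ y. indicator (- ball c R) y * ennreal (dist c y powr (\<gamma> - DIM('a))) * u y \<partial>lborel)
     \<le> ennreal (4 ^ DIM('a) * omega TYPE('a) / (1 - 2 powr \<gamma>) * R powr \<gamma>) * Mx u z"
proof -
  let ?n = "DIM('a)"
  define a where "a k = (R * 2^k) powr \<gamma> * (R * 2^k) powr - real ?n" for k :: nat
  have "(\<integral>\<^sup>+ y. indicator (- ball c R) y * ennreal (dist c y powr (\<gamma> - ?n)) * u y \<partial>lborel)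
      \<le> (\<integral>\<^sup>+ y. (\<Sum>k. ennreal (a k) * (u y * indicator (ball c (R * 2^Suc k)) y)) \<partial>lborel)"
  proof (intro nn_integral_mono)
    fix y
    show "indicator (- ball c R) y * ennreal (dist c y powr (\<gamma> - ?n)) * u y
       \<le> (\<Sum>k. ennreal (a k) * (u y * indicator (ball c (R * 2^Suc k)) y))"
    proof (cases "y \<in> ball c R")
      case False
      define d where "d = dist c y"
      have d: "R \<le> d" using False by (auto simp: d_def)
      obtain m where "d / R < 2 ^ m" using real_arch_pow[of 2 "d/R"] by auto
      then have m: "d < R * 2 ^ m" using R by (simp add: field_simps)
      define k where "k = (LEAST k. d < R * 2 ^ Suc k)"
      have ex: "d < R * 2 ^ Suc m"
      proof -
        have "R * 2 ^ m \<le> R * 2 ^ Suc m" using R by (intro mult_left_mono power_increasing) auto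
        with m show ?thesis by simp
      qed
      then have k1: "d < R * 2 ^ Suc k" unfolding k_def by (rule LeastI)
      have k2: "R * 2 ^ k \<le> d"
      proof (cases k)
        case (Suc j)
        then have "\<not> d < R * 2 ^ Suc j" unfolding k_def by (intro not_less_Least) auto
        then show ?thesis using Suc by simp
      qed (use d in simp)
      have "d powr (\<gamma> - ?n) = d powr \<gamma> * d powr - real ?n" by (simp flip: powr_add)
      also have "\<dots> \<le> a k" unfolding a_def
        using d k2 \<gamma> R by (intro mult_mono powr_mono2') auto
      finally have "ennreal (d powr (\<gamma> - ?n)) \<le> ennreal (a k)" by (rule ennreal_leI)
      then have "indicator (- ball c R) y * ennreal (dist c y powr (\<gamma> - ?n)) * u y
          \<le> ennreal (a k) * (u y * indicator (ball c (R * 2^Suc k)) y)"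
        using False k1 by (simp add: d_def mult.assoc[symmetric] mult_right_mono)
      also have "\<dots> \<le> (\<Sum>k. ennreal (a k) * (u y * indicator (ball c (R * 2^Suc k)) y))"
        using sum_le_suminf[of "\<lambda>k. ennreal (a k) * (u y * indicator (ball c (R * 2^Suc k)) y)" "{k}"] by simp
      finally show ?thesis .
    qed simp
  qed
  also have "\<dots> = (\<Sum>k. ennreal (a k) * (\<integral>\<^sup>+ y\<in>ball c (R * 2^Suc k). u y \<partial>lborel))"
    by (simp add: nn_integral_suminf nn_integral_cmult)
  also have "\<dots> \<le> (\<Sum>k. ennreal (4 ^ ?n * omega TYPE('a) * R powr \<gamma> * (2 powr \<gamma>) ^ k) * Mx u z)"
  proof (intro suminf_le)
    fix k
    have "a k = R powr \<gamma> * (2 powr \<gamma>) ^ k * (1 / (R * 2^k)) ^ ?n"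
    proof -
      have "(R * 2^k) powr \<gamma> = R powr \<gamma> * (2 powr \<gamma>) ^ k"
        using R by (simp add: powr_mult powr_realpow[symmetric] powr_powr mult.commute)
      moreover have "(R * 2^k) powr - real ?n = (1 / (R * 2^k)) ^ ?n"
        using R by (simp add: powr_minus powr_realpow power_one_over inverse_eq_divide)
      ultimately show ?thesis by (simp add: a_def)
    qed
    then have eq: "a k * (omega TYPE('a) * (R * 2^Suc (Suc k)) ^ ?n) = 4 ^ ?n * omega TYPE('a) * R powr \<gamma> * (2 powr \<gamma>) ^ k"
      using R by (simp add: power_divide power_mult_distrib field_simps)
    have "ball c (R * 2^Suc k) \<subseteq> ball z (R * 2^Suc (Suc k))"
    proof
      fix y assume "y \<in> ball c (R * 2^Suc k)"
      then have "dist z y < R + R * 2^Suc k" using z dist_triangle[of z y c] by (simp add: dist_commute)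
      also have "\<dots> \<le> R * 2^Suc (Suc k)" using R one_le_power[of "2::real" "Suc k"] by (simp add: algebra_simps)
      finally show "y \<in> ball z (R * 2^Suc (Suc k))" by simp
    qed
    then have "ennreal (a k) * (\<integral>\<^sup>+ y\<in>ball c (R * 2^Suc k). u y \<partial>lborel)
        \<le> ennreal (a k) * (ennreal (omega TYPE('a) * (R * 2^Suc (Suc k)) ^ ?n) * Mx u z)"
      using R by (intro mult_left_mono ball_integral_le_Mx) auto
    also have "\<dots> = ennreal (a k * (omega TYPE('a) * (R * 2^Suc (Suc k)) ^ ?n)) * Mx u z"
      using R by (subst ennreal_mult) (auto simp: a_def mult.assoc)
    finally show "ennreal (a k) * (\<integral>\<^sup>+ y\<in>ball c (R * 2^Suc k). u y \<partial>lborel)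
        \<le> ennreal (4 ^ ?n * omega TYPE('a) * R powr \<gamma> * (2 powr \<gamma>) ^ k) * Mx u z" unfolding eq .
  qed auto
  also have "\<dots> = ennreal (4 ^ ?n * omega TYPE('a) * R powr \<gamma> / (1 - 2 powr \<gamma>)) * Mx u z"
    using \<gamma> R powr_less_mono[of "\<gamma>" 0 2] by (subst ennreal_suminf_multc, subst powr_suminf_ennreal) auto
  finally show ?thesis by (simp add: mult_ac)
qed

section \<open>Oscillation and covering lemmas\<close>

text \<open>Values of \<open>g\<close> in [0,\<infinity>] let a mollified gradient enter without a
  proof of finiteness. The point t = 0 is left out so that the dilation by t about \<open>x\<close>
  is invertible for every t in the range.\<close>

definition seg_bound :: "('a::euclidean_space \<Rightarrow> real) \<Rightarrow> ('a \<Rightarrow> ennreal) \<Rightarrow> bool" where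
  "seg_bound f g \<longleftrightarrow> (\<forall>x z. ennreal \<bar>f z - f x\<bar>
     \<le> ennreal (dist x z) * (\<integral>\<^sup>+ t\<in>{0<..1}. g (x + t *\<^sub>R (z - x)) \<partial>lborel))"

text \<open>The function whose norm enters \<open>BBM_quant\<close>. The exponents are kept
  independent, so that the endpoint, with \<beta> = \<gamma> and \<sigma> = 1, and the parameters of
  both sides of the inequality are instances.\<close>

definition level_int :: "real \<Rightarrow> real \<Rightarrow> real \<Rightarrow> real \<Rightarrow> ('a::euclidean_space \<Rightarrow> real) \<Rightarrow> 'a \<Rightarrow> ennreal" where
  "level_int lam \<beta> \<sigma> \<gamma> f x = (\<integral>\<^sup>+ y. indicator (Dset lam \<beta> \<sigma> f) (x, y)
      * ennreal (dist x y powr (\<gamma> - real DIM('a))) \<partial>lborel)"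

lemma nn_integral_ball_dilate:
  fixes g :: "'a::euclidean_space \<Rightarrow> ennreal"
  assumes [measurable]: "g \<in> borel_measurable borel" and t: "0 < t" and r: "0 < r"
  shows "(\<integral>\<^sup>+ z\<in>ball x r. g (x + t *\<^sub>R (z - x)) \<partial>lborel) = ennreal (omega TYPE('a) * r ^ DIM('a)) * avg x (t * r) g"
proof -
  define J where "J = (\<integral>\<^sup>+ z\<in>ball x r. g (x + t *\<^sub>R (z - x)) \<partial>lborel)"
  have "(\<integral>\<^sup>+ w\<in>ball x (t * r). g w \<partial>lborel)
      = (\<integral>\<^sup>+ w. g w * indicator (ball x (t * r)) w \<partial>density (distr lborel borel (\<lambda>z. (x - t *\<^sub>R x) + t *\<^sub>R z)) (\<lambda>_. \<bar>t\<bar> ^ DIM('a)))"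
    using t by (subst lborel_affine[of t "x - t *\<^sub>R x"]) auto
  also have "\<dots> = (\<integral>\<^sup>+ z. ennreal (t ^ DIM('a)) * (g ((x - t *\<^sub>R x) + t *\<^sub>R z) * indicator (ball x (t * r)) ((x - t *\<^sub>R x) + t *\<^sub>R z)) \<partial>lborel)"
    using t by (subst nn_integral_density) (auto simp: nn_integral_distr)
  also have "\<dots> = (\<integral>\<^sup>+ z. ennreal (t ^ DIM('a)) * (g (x + t *\<^sub>R (z - x)) * indicator (ball x r) z) \<partial>lborel)"
  proof (intro nn_integral_cong)
    fix z
    have eq: "(x - t *\<^sub>R x) + t *\<^sub>R z = x + t *\<^sub>R (z - x)" by (simp add: algebra_simps)
    have "dist x (x + t *\<^sub>R (z - x)) = t * dist x z" using t by (simp add: dist_norm norm_minus_commute)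
    then have "x + t *\<^sub>R (z - x) \<in> ball x (t * r) \<longleftrightarrow> z \<in> ball x r" using t by simp
    then show "ennreal (t ^ DIM('a)) * (g ((x - t *\<^sub>R x) + t *\<^sub>R z) * indicator (ball x (t * r)) ((x - t *\<^sub>R x) + t *\<^sub>R z))
      = ennreal (t ^ DIM('a)) * (g (x + t *\<^sub>R (z - x)) * indicator (ball x r) z)"
      unfolding eq by (simp add: indicator_def)
  qed
  also have "\<dots> = ennreal (t ^ DIM('a)) * J"
    unfolding J_def by (intro nn_integral_cmult) measurable
  finally have "ennreal (t ^ DIM('a)) * J = ennreal (omega TYPE('a) * (t * r) ^ DIM('a)) * avg x (t * r) g"
    using t r by (simp add: ball_integral_eq)
  also have "\<dots> = ennreal (t ^ DIM('a)) * (ennreal (omega TYPE('a) * r ^ DIM('a)) * avg x (t * r) g)"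
    using t r by (simp add: power_mult_distrib ennreal_mult mult_ac)
  finally show ?thesis using t by (simp add: ennreal_mult_cancel_left J_def)
qed

lemma avg_le_double:
  fixes g :: "'a::euclidean_space \<Rightarrow> ennreal"
  assumes "0 < a" "a \<le> b" "b \<le> 2 * a"
  shows "avg x a g \<le> ennreal (2 ^ DIM('a)) * avg x b g"
proof -
  define m where "m = ennreal (omega TYPE('a) * a ^ DIM('a))"
  have m: "m \<noteq> 0" "m \<noteq> \<infinity>" "0 < m" "m < \<infinity>" using assms omega_pos[where 'a='a]
    by (auto simp: m_def simp del: unit_ball_vol_pos)
  have "m * avg x a g = (\<integral>\<^sup>+ y\<in>ball x a. g y \<partial>lborel)"
    using ball_integral_eq[OF assms(1), where x=x and u=g] by (simp add: m_def)
  also have "\<dots> \<le> (\<integral>\<^sup>+ y\<in>ball x b. g y \<partial>lborel)"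
    using assms(2) by (intro nn_integral_mono mult_left_mono) (auto simp: indicator_def)
  also have "\<dots> = ennreal (omega TYPE('a) * b ^ DIM('a)) * avg x b g"
    using assms by (intro ball_integral_eq) auto
  also have "\<dots> \<le> ennreal (omega TYPE('a) * (2 * a) ^ DIM('a)) * avg x b g"
    using assms by (intro mult_right_mono ennreal_leI mult_left_mono power_mono) auto
  also have "ennreal (omega TYPE('a) * (2 * a) ^ DIM('a)) = m * ennreal (2 ^ DIM('a))"
    using assms by (simp add: m_def power_mult_distrib mult_ac flip: ennreal_mult)
  finally have "m * avg x a g \<le> m * (ennreal (2 ^ DIM('a)) * avg x b g)" by (simp add: mult_ac)
  then show ?thesis using m ennreal_mult_strict_left_mono[of "ennreal (2 ^ DIM('a)) * avg x b g" "avg x a g" m]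
    by (auto simp: not_le[symmetric])
qed

lemma le_suminf_ennreal: "f k \<le> (\<Sum>j. f j :: ennreal)"
  using sum_le_suminf[of f "{k}"] by simp

text \<open>For t between 2^(-j-1) and 2^(-j) the average at radius t r is at most 2^n times the one
  at radius r/2^j, and the weight is the length of this interval of t. Having only countably many
  scales allows one of them to be singled out in \<open>Dset_threshold\<close>.\<close>

lemma radial_average_dyadic:
  fixes g :: "'a::euclidean_space \<Rightarrow> ennreal"
  assumes r: "0 < r"
  shows "(\<integral>\<^sup>+ t\<in>{0<..1}. avg x (t * r) g \<partial>lborel)
     \<le> ennreal (2 ^ DIM('a)) * (\<Sum>j. ennreal ((1/2) ^ Suc j) * avg x (r / 2 ^ j) g)"
proof -
  let ?I = "\<lambda>j::nat. {(1/2)^Suc j<..(1/2::real)^j}"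
  have "(\<integral>\<^sup>+ t\<in>{0<..1}. avg x (t * r) g \<partial>lborel)
      \<le> (\<integral>\<^sup>+ t. (\<Sum>j. ennreal (2 ^ DIM('a)) * avg x (r / 2 ^ j) g * indicator (?I j) t) \<partial>lborel)"
  proof (intro nn_integral_mono)
    fix t :: real
    show "avg x (t * r) g * indicator {0<..1} t
      \<le> (\<Sum>j. ennreal (2 ^ DIM('a)) * avg x (r / 2 ^ j) g * indicator (?I j) t)"
    proof (cases "t \<in> {0<..1}")
      case True
      obtain m where m: "(1/2)^m < t" using real_arch_pow_inv[of t "1/2"] True by auto
      define k where "k = (LEAST k. (1/2)^Suc k < t)"
      have ex: "(1/2)^Suc m < t"
      proof -
        have "(1/2::real)^Suc m \<le> (1/2)^m" by (intro power_decreasing) auto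
        with m show ?thesis by linarith
      qed
      then have k1: "(1/2)^Suc k < t" unfolding k_def by (rule LeastI)
      have k2: "t \<le> (1/2)^k"
      proof (cases k)
        case (Suc j)
        then have "\<not> (1/2)^Suc j < t" unfolding k_def by (intro not_less_Least) auto
        then show ?thesis using Suc by simp
      qed (use True in simp)
      have "avg x (t * r) g \<le> ennreal (2 ^ DIM('a)) * avg x (r / 2 ^ k) g"
        using True r k1 k2 by (intro avg_le_double) (auto simp: field_simps)
      then have "avg x (t * r) g * indicator {0<..1} t \<le> ennreal (2 ^ DIM('a)) * avg x (r / 2 ^ k) g * indicator (?I k) t"
        using True k1 k2 by simp
      also have "\<dots> \<le> (\<Sum>j. ennreal (2 ^ DIM('a)) * avg x (r / 2 ^ j) g * indicator (?I j) t)"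
        by (rule le_suminf_ennreal[of "\<lambda>j. ennreal (2 ^ DIM('a)) * avg x (r / 2 ^ j) g * indicator (?I j) t" k])
      finally show ?thesis .
    qed simp
  qed
  also have "\<dots> = (\<Sum>j. ennreal (2 ^ DIM('a)) * avg x (r / 2 ^ j) g * emeasure lborel (?I j))"
  proof (subst nn_integral_suminf)
    show "(\<Sum>j. \<integral>\<^sup>+ t. ennreal (2 ^ DIM('a)) * avg x (r / 2 ^ j) g * indicator (?I j) t \<partial>lborel)
      = (\<Sum>j. ennreal (2 ^ DIM('a)) * avg x (r / 2 ^ j) g * emeasure lborel (?I j))"
      by (intro suminf_cong nn_integral_cmult_indicator) simp
  qed simp
  also have "\<dots> = (\<Sum>j. ennreal (2 ^ DIM('a)) * (ennreal ((1/2) ^ Suc j) * avg x (r / 2 ^ j) g))"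
  proof (intro suminf_cong)
    fix j :: nat
    have "emeasure lborel (?I j) = ennreal ((1/2)^j - (1/2)^Suc j)"
      by (intro emeasure_lborel_Ioc power_decreasing) auto
    also have "(1/2)^j - (1/2)^Suc j = (1/2::real)^Suc j" by simp
    finally show "ennreal (2 ^ DIM('a)) * avg x (r / 2 ^ j) g * emeasure lborel (?I j)
       = ennreal (2 ^ DIM('a)) * (ennreal ((1/2) ^ Suc j) * avg x (r / 2 ^ j) g)" by (simp only: mult_ac)
  qed
  finally show ?thesis by simp
qed

text \<open>The segment bound is integrated over z and the order of integration is exchanged: for
  fixed t the points x + t (z - x) fill the ball of radius t r, so that line integrals become
  averages over balls.\<close>

lemma oscillation_bound:
  fixes f :: "'a::euclidean_space \<Rightarrow> real" and g :: "'a \<Rightarrow> ennreal"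
  assumes [measurable]: "g \<in> borel_measurable borel" and sb: "seg_bound f g" and r: "0 < r"
  shows "(\<integral>\<^sup>+ z\<in>ball x r. ennreal \<bar>f z - f x\<bar> \<partial>lborel)
     \<le> ennreal (omega TYPE('a) * r ^ DIM('a)) * (ennreal (2 ^ DIM('a) * r) * (\<Sum>j. ennreal ((1/2) ^ Suc j) * avg x (r / 2 ^ j) g))"
proof -
  have "(\<integral>\<^sup>+ z\<in>ball x r. ennreal \<bar>f z - f x\<bar> \<partial>lborel)
      \<le> (\<integral>\<^sup>+ z. ennreal r * (\<integral>\<^sup>+ t. g (x + t *\<^sub>R (z - x)) * indicator (ball x r) z * indicator {0<..1} t \<partial>lborel) \<partial>lborel)"
  proof (intro nn_integral_mono)
    fix z
    show "ennreal \<bar>f z - f x\<bar> * indicator (ball x r) z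
      \<le> ennreal r * (\<integral>\<^sup>+ t. g (x + t *\<^sub>R (z - x)) * indicator (ball x r) z * indicator {0<..1} t \<partial>lborel)"
    proof (cases "z \<in> ball x r")
      case True
      have "ennreal \<bar>f z - f x\<bar> \<le> ennreal (dist x z) * (\<integral>\<^sup>+ t\<in>{0<..1}. g (x + t *\<^sub>R (z - x)) \<partial>lborel)"
        using sb by (simp add: seg_bound_def)
      also have "\<dots> \<le> ennreal r * (\<integral>\<^sup>+ t\<in>{0<..1}. g (x + t *\<^sub>R (z - x)) \<partial>lborel)"
        using True by (intro mult_right_mono ennreal_leI) auto
      finally show ?thesis using True by simp
    qed simp
  qed
  also have "\<dots> = ennreal r * (\<integral>\<^sup>+ z. \<integral>\<^sup>+ t. g (x + t *\<^sub>R (z - x)) * indicator (ball x r) z * indicator {0<..1} t \<partial>lborel \<partial>lborel)"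
    by (intro nn_integral_cmult) measurable
  finally have step: "(\<integral>\<^sup>+ z\<in>ball x r. ennreal \<bar>f z - f x\<bar> \<partial>lborel) \<le> \<dots>" .
  have "(\<integral>\<^sup>+ z. \<integral>\<^sup>+ t. g (x + t *\<^sub>R (z - x)) * indicator (ball x r) z * indicator {0<..1} t \<partial>lborel \<partial>lborel)
    = (\<integral>\<^sup>+ t. \<integral>\<^sup>+ z. g (x + t *\<^sub>R (z - x)) * indicator (ball x r) z * indicator {0<..1::real} t \<partial>lborel \<partial>lborel)"
    by (rule lborel_pair.Fubini'[symmetric]) measurable
  also have "\<dots> = (\<integral>\<^sup>+ t\<in>{0<..1}. ennreal (omega TYPE('a) * r ^ DIM('a)) * avg x (t * r) g \<partial>lborel)"
  proof (intro nn_integral_cong)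
    fix t :: real
    show "(\<integral>\<^sup>+ z. g (x + t *\<^sub>R (z - x)) * indicator (ball x r) z * indicator {0<..1::real} t \<partial>lborel)
      = ennreal (omega TYPE('a) * r ^ DIM('a)) * avg x (t * r) g * indicator {0<..1} t"
      using r by (cases "t \<in> {0<..1}") (auto simp: nn_integral_ball_dilate)
  qed
  also have "\<dots> \<le> ennreal (omega TYPE('a) * r ^ DIM('a)) * (\<integral>\<^sup>+ t\<in>{0<..1}. avg x (t * r) g \<partial>lborel)"
  proof -
    \<comment> \<open>Measurability in t of an average with variable radius is read off from its
      dilated form, in which t occurs only inside an integral over a fixed ball.\<close>
    have "(\<lambda>t. avg x (t * r) g * indicator {0<..1} t) = (\<lambda>t. (\<integral>\<^sup>+ z\<in>ball x r. g (x + t *\<^sub>R (z - x)) \<partial>lborel) / ennreal (omega TYPE('a) * r ^ DIM('a)) * indicator {0<..1} t)"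
      (is "?l = ?r")
    proof
      fix t
      have "ennreal (omega TYPE('a) * r ^ DIM('a)) \<noteq> 0" using r omega_pos[where 'a='a] by (simp del: unit_ball_vol_pos add: mult_pos_pos)
      then show "?l t = ?r t"
        using r by (cases "t \<in> {0<..1}") (auto simp: nn_integral_ball_dilate mult.commute[of _ "avg _ _ _"] mult_divide_eq_ennreal)
    qed
    moreover have "?r \<in> borel_measurable borel" by measurable
    ultimately have [measurable]: "?l \<in> borel_measurable lborel" by simp
    show ?thesis by (subst nn_integral_cmult[symmetric]) (auto simp: mult.assoc)
  qed
  also have "\<dots> \<le> ennreal (omega TYPE('a) * r ^ DIM('a)) * (ennreal (2 ^ DIM('a)) * (\<Sum>j. ennreal ((1/2) ^ Suc j) * avg x (r / 2 ^ j) g))"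
    by (intro mult_left_mono radial_average_dyadic r) auto
  finally have "ennreal r * (\<integral>\<^sup>+ z. \<integral>\<^sup>+ t. g (x + t *\<^sub>R (z - x)) * indicator (ball x r) z * indicator {0<..1} t \<partial>lborel \<partial>lborel)
    \<le> ennreal r * (ennreal (omega TYPE('a) * r ^ DIM('a)) * (ennreal (2 ^ DIM('a)) * (\<Sum>j. ennreal ((1/2) ^ Suc j) * avg x (r / 2 ^ j) g)))"
    by (rule mult_left_mono) simp
  with step have "(\<integral>\<^sup>+ z\<in>ball x r. ennreal \<bar>f z - f x\<bar> \<partial>lborel) \<le> \<dots>" by (rule order_trans)
  also have "\<dots> = ennreal (omega TYPE('a) * r ^ DIM('a)) * (ennreal (2 ^ DIM('a) * r) * (\<Sum>j. ennreal ((1/2) ^ Suc j) * avg x (r / 2 ^ j) g))"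
    using r by (simp only: ennreal_mult[of "2 ^ DIM('a)" r, OF _ less_imp_le] zero_le_power zero_le_numeral) (simp only: mult_ac)
  finally show ?thesis .
qed

text \<open>Both f(x) and f(y) are compared with f(z) for z in the ball of radius r/2 about the
  midpoint, which lies in both balls of radius r. One factor 2^n is the ratio of the volumes, the
  other comes from \<open>oscillation_bound\<close>.\<close>

lemma pair_bound:
  fixes f :: "'a::euclidean_space \<Rightarrow> real" and g :: "'a \<Rightarrow> ennreal"
  assumes [measurable]: "f \<in> borel_measurable borel" "g \<in> borel_measurable borel" and sb: "seg_bound f g" and r: "r = dist x y" "0 < r"
  shows "ennreal \<bar>f x - f y\<bar> \<le> ennreal (4 ^ DIM('a) * r) *
    ((\<Sum>j. ennreal ((1/2) ^ Suc j) * avg x (r / 2 ^ j) g) + (\<Sum>j. ennreal ((1/2) ^ Suc j) * avg y (r / 2 ^ j) g))"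
proof -
  define S where "S z = (\<Sum>j. ennreal ((1/2) ^ Suc j) * avg z (r / 2 ^ j) g)" for z
  define m where "m = midpoint x y"
  define c where "c = ennreal (omega TYPE('a) * (r/2) ^ DIM('a))"
  have c: "c \<noteq> 0" "c \<noteq> \<infinity>" "0 < c" using r omega_pos[where 'a='a] by (auto simp: c_def simp del: unit_ball_vol_pos)
  have c2: "ennreal (omega TYPE('a) * r ^ DIM('a)) = c * ennreal (2 ^ DIM('a))"
    using r by (simp add: c_def power_divide flip: ennreal_mult)
  have dm: "dist x m = r / 2" "dist y m = r / 2" using r by (auto simp: m_def dist_midpoint)
  have sub: "ball m (r/2) \<subseteq> ball x r" "ball m (r/2) \<subseteq> ball y r"
  proof -
    show "ball m (r/2) \<subseteq> ball x r" 
    proof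
      fix z assume "z \<in> ball m (r/2)" then show "z \<in> ball x r" using dm(1) dist_triangle[of x z m] by simp
    qed
    show "ball m (r/2) \<subseteq> ball y r" 
    proof
      fix z assume "z \<in> ball m (r/2)" then show "z \<in> ball y r" using dm(2) dist_triangle[of y z m] by simp
    qed
  qed
  have "c * ennreal \<bar>f x - f y\<bar> = (\<integral>\<^sup>+ z\<in>ball m (r/2). ennreal \<bar>f x - f y\<bar> \<partial>lborel)"
    using r by (simp add: nn_integral_cmult_indicator c_def emeasure_ball' mult.commute)
  also have "\<dots> \<le> (\<integral>\<^sup>+ z. ennreal \<bar>f z - f x\<bar> * indicator (ball x r) z + ennreal \<bar>f z - f y\<bar> * indicator (ball y r) z \<partial>lborel)"
  proof (intro nn_integral_mono)
    fix z
    show "ennreal \<bar>f x - f y\<bar> * indicator (ball m (r/2)) z \<le> ennreal \<bar>f z - f x\<bar> * indicator (ball x r) z + ennreal \<bar>f z - f y\<bar> * indicator (ball y r) z"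
    proof (cases "z \<in> ball m (r/2)")
      case True
      then have "z \<in> ball x r" "z \<in> ball y r" using sub by auto
      moreover have "ennreal \<bar>f x - f y\<bar> \<le> ennreal (\<bar>f z - f x\<bar> + \<bar>f z - f y\<bar>)" by (intro ennreal_leI) auto
      ultimately show ?thesis using True by simp
    qed simp
  qed
  also have "\<dots> = (\<integral>\<^sup>+ z\<in>ball x r. ennreal \<bar>f z - f x\<bar> \<partial>lborel) + (\<integral>\<^sup>+ z\<in>ball y r. ennreal \<bar>f z - f y\<bar> \<partial>lborel)"
    by (intro nn_integral_add) measurable
  also have "\<dots> \<le> ennreal (omega TYPE('a) * r ^ DIM('a)) * (ennreal (2 ^ DIM('a) * r) * S x)
      + ennreal (omega TYPE('a) * r ^ DIM('a)) * (ennreal (2 ^ DIM('a) * r) * S y)"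
    unfolding S_def by (intro add_mono oscillation_bound sb r) measurable
  also have "\<dots> = c * (ennreal (2 ^ DIM('a)) * ennreal (2 ^ DIM('a) * r) * (S x + S y))"
    unfolding c2 by (simp only: mult.assoc distrib_left)
  also have "ennreal (2 ^ DIM('a)) * ennreal (2 ^ DIM('a) * r) = ennreal (4 ^ DIM('a) * r)"
    using r by (simp add: power_mult_distrib[symmetric] flip: ennreal_mult mult.assoc)
  finally show ?thesis
    using c ennreal_mult_strict_left_mono[of "ennreal (4 ^ DIM('a) * r) * (S x + S y)" "ennreal \<bar>f x - f y\<bar>" c]
    unfolding S_def by (auto simp: not_le[symmetric] less_top)
qed

text \<open>In contrast to Vitali's lemma small balls are selected first, which is possible because the radii
  are bounded away from 0.\<close>

lemma reverse_Vitali: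
  fixes a :: "'i \<Rightarrow> 'b::euclidean_space"
  assumes r0: "0 < r0" and K: "\<And>i. i \<in> K \<Longrightarrow> r0 \<le> r i \<and> r i \<le> R"
  obtains C where "countable C" "C \<subseteq> K"
    "pairwise (\<lambda>i j. disjnt (cball (a i) (r i)) (cball (a j) (r j))) C"
    "\<And>i. i \<in> K \<Longrightarrow> \<exists>j\<in>C. \<not> disjnt (cball (a i) (r i)) (cball (a j) (r j)) \<and> r j \<le> 2 * r i"
proof -
  let ?D = "\<lambda>i j. disjnt (cball (a i) (r i)) (cball (a j) (r j))"
  have "\<exists>C. countable C \<and> C \<subseteq> {i\<in>K. r i < r0 * 2 ^ m} \<and> pairwise ?D C \<and>
     (\<forall>i\<in>K. r i < r0 * 2 ^ m \<longrightarrow> (\<exists>j\<in>C. \<not> ?D i j \<and> r j \<le> 2 * r i))" for m :: nat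
  proof (induction m)
    case 0
    show ?case using K by (intro exI[of _ "{}"]) force
  next
    case (Suc m)
    then obtain C where C: "countable C" "C \<subseteq> {i\<in>K. r i < r0 * 2 ^ m}" "pairwise ?D C"
      "\<And>i. i\<in>K \<Longrightarrow> r i < r0 * 2 ^ m \<Longrightarrow> \<exists>j\<in>C. \<not> ?D i j \<and> r j \<le> 2 * r i" by blast
    \<comment> \<open>A generation consists of balls whose radii agree up to a factor 2 and which
      miss all earlier choices. Within a generation the order of selection does not matter, so
      Vitali's lemma can be used there.\<close>
    define K' where "K' = {i\<in>K. r0 * 2 ^ m \<le> r i \<and> r i < r0 * 2 ^ Suc m \<and> (\<forall>j\<in>C. ?D i j)}"
    have K'r: "0 < r i \<and> r i \<le> R" if "i \<in> K'" for i using K[of i] that r0 by (auto simp: K'_def)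
    obtain C' where C': "countable C'" "C' \<subseteq> K'" "pairwise ?D C'"
      "\<And>i. i \<in> K' \<Longrightarrow> \<exists>j. j \<in> C' \<and> \<not> ?D i j \<and> cball (a i) (r i) \<subseteq> ball (a j) (5 * r j)"
      by (rule Vitali_covering_lemma_cballs_balls[of K' r R a, OF K'r]) blast+
    show ?case
    proof (intro exI[of _ "C \<union> C'"] conjI ballI impI)
      show "countable (C \<union> C')" using C C' by auto
      have "r0 * 2 ^ m \<le> r0 * 2 ^ Suc m" using r0 by (intro mult_left_mono power_increasing) auto
      then show "C \<union> C' \<subseteq> {i\<in>K. r i < r0 * 2 ^ Suc m}" using C(2) C'(2) by (auto simp: K'_def)
      show "pairwise ?D (C \<union> C')"
        using C(3) C'(2,3) unfolding pairwise_def by (auto simp: K'_def disjnt_sym)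
      fix i assume i: "i \<in> K" "r i < r0 * 2 ^ Suc m"
      show "\<exists>j\<in>C \<union> C'. \<not> ?D i j \<and> r j \<le> 2 * r i"
      proof (cases "r i < r0 * 2 ^ m")
        case True
        then show ?thesis using C(4)[OF i(1)] by blast
      next
        case False
        show ?thesis
        proof (cases "\<forall>j\<in>C. ?D i j")
          case True
          then have "i \<in> K'" using False i by (auto simp: K'_def)
          then obtain j where j: "j \<in> C'" "\<not> ?D i j" using C'(4) by blast
          then have "r j < r0 * 2 ^ Suc m" using C'(2) by (auto simp: K'_def)
          then show ?thesis using j False by (intro bexI[of _ j]) auto
        next
          case F: False
          then obtain j where j: "j \<in> C" "\<not> ?D i j" by blast
          then have "r j < r0 * 2 ^ m" using C(2) by auto
          moreover have "0 < r i" using K[OF i(1)] r0 by simp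
          ultimately show ?thesis using j False by (intro bexI[of _ j]) auto
        qed
      qed
    qed
  qed
  moreover obtain m where "R / r0 < 2 ^ m" using real_arch_pow[of 2 "R / r0"] by auto
  then have m: "R < r0 * 2 ^ m" using r0 by (simp add: field_simps)
  ultimately obtain C where C: "countable C" "C \<subseteq> {i\<in>K. r i < r0 * 2 ^ m}" "pairwise ?D C"
      "\<And>i. i\<in>K \<Longrightarrow> r i < r0 * 2 ^ m \<Longrightarrow> \<exists>j\<in>C. \<not> ?D i j \<and> r j \<le> 2 * r i" by meson
  show ?thesis
  proof (rule that)
    show "countable C" "C \<subseteq> K" "pairwise ?D C" using C by auto
    show "\<exists>j\<in>C. \<not> ?D i j \<and> r j \<le> 2 * r i" if "i \<in> K" for i
      using C(4)[OF that] K[OF that] m by simp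
  qed
qed

lemma sum_disjoint_integrals:
  fixes B :: "'i \<Rightarrow> 'a::euclidean_space set" and k :: "'a \<Rightarrow> ennreal"
  assumes "countable C" and [measurable]: "k \<in> borel_measurable borel" "\<And>j. B j \<in> sets borel"
    and disj: "\<And>i j. i \<in> C \<Longrightarrow> j \<in> C \<Longrightarrow> i \<noteq> j \<Longrightarrow> disjnt (B i) (B j)"
  shows "(\<integral>\<^sup>+ j. (\<integral>\<^sup>+ x\<in>B j. k x \<partial>lborel) \<partial>count_space C) \<le> (\<integral>\<^sup>+ x. k x \<partial>lborel)"
proof -
  have "(\<integral>\<^sup>+ j. (\<integral>\<^sup>+ x\<in>B j. k x \<partial>lborel) \<partial>count_space C) = (\<integral>\<^sup>+ x. (\<integral>\<^sup>+ j. k x * indicator (B j) x \<partial>count_space C) \<partial>lborel)"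
    by (rule nn_integral_count_space_nn_integral[symmetric]) (use assms in measurable)
  also have "\<dots> \<le> (\<integral>\<^sup>+ x. k x \<partial>lborel)"
  proof (intro nn_integral_mono)
    fix x
    show "(\<integral>\<^sup>+ j. k x * indicator (B j) x \<partial>count_space C) \<le> k x"
    proof (cases "\<exists>i\<in>C. x \<in> B i")
      case True
      then obtain i where i: "i \<in> C" "x \<in> B i" by blast
      have "(\<integral>\<^sup>+ j. k x * indicator (B j) x \<partial>count_space C) = (\<integral>\<^sup>+ j. k x * indicator {i} j \<partial>count_space C)"
        using disj[OF i(1)] i by (intro nn_integral_cong) (force simp: indicator_def disjnt_def)
      also have "\<dots> = k x" using i by (subst nn_integral_cmult_indicator) auto
      finally show ?thesis by simp
    next
      case False
      then have "(\<integral>\<^sup>+ j. k x * indicator (B j) x \<partial>count_space C) = (\<integral>\<^sup>+ j. 0 \<partial>count_space C)"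
        by (intro nn_integral_cong) auto
      then show ?thesis by simp
    qed
  qed
  finally show ?thesis .
qed

text \<open>The estimate I \<le> a v(z) is integrated over the set with respect to g dz. In this way
  a quantity attached to a selected ball is charged to the mass of \<open>g\<close> in that ball,
  after which disjoint balls can be summed.\<close>

lemma ball_mass_transfer:
  fixes g v :: "'a::euclidean_space \<Rightarrow> ennreal"
  assumes [measurable]: "g \<in> borel_measurable borel" "v \<in> borel_measurable borel" "B \<in> sets borel"
    and P: "ennreal p \<le> (\<integral>\<^sup>+ z\<in>B. g z \<partial>lborel)" and I: "\<And>z. z \<in> B \<Longrightarrow> I \<le> ennreal a * v z"
    and p: "0 < p" and a: "0 \<le> a"
  shows "I \<le> ennreal (a / p) * (\<integral>\<^sup>+ z\<in>B. g z * v z \<partial>lborel)"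
proof -
  have "I * ennreal p \<le> I * (\<integral>\<^sup>+ z\<in>B. g z \<partial>lborel)" by (intro mult_left_mono P) auto
  also have "\<dots> = (\<integral>\<^sup>+ z\<in>B. I * g z \<partial>lborel)" by (simp add: nn_integral_cmult mult.assoc)
  also have "\<dots> \<le> (\<integral>\<^sup>+ z. ennreal a * (g z * v z * indicator B z) \<partial>lborel)"
  proof (intro nn_integral_mono)
    fix z show "I * g z * indicator B z \<le> ennreal a * (g z * v z * indicator B z)"
      using mult_right_mono[OF I[of z], of "g z"] by (cases "z \<in> B") (auto simp: mult_ac)
  qed
  also have "\<dots> = ennreal a * (\<integral>\<^sup>+ z\<in>B. g z * v z \<partial>lborel)" by (intro nn_integral_cmult) measurable
  finally have "ennreal (1/p) * (I * ennreal p) \<le> ennreal (1/p) * (ennreal a * (\<integral>\<^sup>+ z\<in>B. g z * v z \<partial>lborel))"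
    by (intro mult_left_mono) auto
  also have "ennreal (1/p) * (I * ennreal p) = I * (ennreal (1/p) * ennreal p)" by (simp only: mult_ac)
  also have "ennreal (1/p) * ennreal p = 1" using p by (simp flip: ennreal_mult)
  also have "ennreal (1/p) * (ennreal a * (\<integral>\<^sup>+ z\<in>B. g z * v z \<partial>lborel)) = ennreal (a / p) * (\<integral>\<^sup>+ z\<in>B. g z * v z \<partial>lborel)"
    using p a by (simp add: mult.assoc[symmetric] flip: ennreal_mult)
  finally show ?thesis by simp
qed

section \<open>Weighted estimates of the level sets\<close>

text \<open>Serves the convention that \<infinity> times 0 is 0: in \<open>kernel_far_level\<close>
  the level \<open>H\<close> may be infinite while the maximal function is zero, and then the
  left-hand side has to vanish as well.\<close>

lemma Mx_eq_0_imp_AE: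
  fixes u :: "'a::euclidean_space \<Rightarrow> ennreal"
  assumes [measurable]: "u \<in> borel_measurable borel" and "Mx u x = 0"
  shows "AE y in lborel. u y = 0"
proof -
  have "AE y in lborel. u y * indicator (ball x (real (Suc k))) y = 0" for k
  proof -
    have "avg x (real (Suc k)) u \<le> 0" using avg_le_Mx[of "real (Suc k)" x u] assms(2) by simp
    then have "(\<integral>\<^sup>+ y\<in>ball x (real (Suc k)). u y \<partial>lborel) = 0"
      using ball_integral_eq[of "real (Suc k)" u x] by simp
    then show ?thesis by (subst (asm) nn_integral_0_iff_AE) auto
  qed
  then have "AE y in lborel. \<forall>k. u y * indicator (ball x (real (Suc k))) y = 0"
    by (subst AE_all_countable) blast
  then show ?thesis
  proof eventually_elim
    case (elim y)
    obtain k :: nat where "dist x y < real k" using reals_Archimedean2 by blast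
    then have "y \<in> ball x (real (Suc k))" by simp
    with elim[rule_format, of k] show ?case by simp
  qed
qed

lemma kernel_near_level:
  fixes x :: "'a::euclidean_space" and u :: "'a \<Rightarrow> ennreal" and \<gamma> :: real
  assumes [measurable]: "u \<in> borel_measurable borel" and \<gamma>: "0 < \<gamma>" and H: "H < \<infinity>"
  shows "(\<integral>\<^sup>+ y. indicator {y. ennreal (dist x y powr \<gamma>) \<le> H} y * ennreal (dist x y powr (\<gamma> - DIM('a))) * u y \<partial>lborel)
     \<le> ennreal (2 powr \<gamma> * (2 ^ DIM('a) * omega TYPE('a) / (1 - 2 powr -\<gamma>))) * (H * Mx u x)"
    (is "?L \<le> _")
proof -
  obtain h where h: "H = ennreal h" "0 \<le> h" using H by (cases H) auto
  show ?thesis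
  proof (cases "h = 0")
    case True
    have "?L = (\<integral>\<^sup>+ (y::'a). 0 \<partial>lborel)"
      by (intro nn_integral_cong) (auto simp: indicator_def h True)
    then show ?thesis by simp
  next
    case False
    \<comment> \<open>The level set is the closed ball of radius h^(1/\<gamma>). Doubling the radius
      puts it into an open ball and costs the factor 2^\<gamma>.\<close>
    define R where "R = 2 * h powr (1 / \<gamma>)"
    have R: "0 < R" "R powr \<gamma> = 2 powr \<gamma> * h"
      using False h \<gamma> by (auto simp: R_def powr_mult powr_powr)
    have "?L \<le> (\<integral>\<^sup>+ y. indicator (ball x R) y * ennreal (dist x y powr (\<gamma> - DIM('a))) * u y \<partial>lborel)"
    proof (intro nn_integral_mono mult_right_mono)
      fix y
      have "y \<in> ball x R" if "ennreal (dist x y powr \<gamma>) \<le> H"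
      proof -
        have "dist x y powr \<gamma> \<le> h" using that h by simp
        then have "(dist x y powr \<gamma>) powr (1 / \<gamma>) \<le> h powr (1 / \<gamma>)" using \<gamma> by (intro powr_mono2) auto
        then have "dist x y \<le> h powr (1 / \<gamma>)" using \<gamma> by (simp add: powr_powr)
        moreover have "0 < h powr (1 / \<gamma>)" using False h by simp
        ultimately have "dist x y < R" unfolding R_def by linarith
        then show ?thesis by simp
      qed
      then show "indicator {y. ennreal (dist x y powr \<gamma>) \<le> H} y \<le> (indicator (ball x R) y :: ennreal)"
        by (auto simp: indicator_def)
    qed auto
    also have "\<dots> \<le> ennreal (2 ^ DIM('a) * omega TYPE('a) / (1 - 2 powr -\<gamma>) * R powr \<gamma>) * Mx u x"
      using R by (intro kernel_near \<gamma>) auto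
    also have "2 ^ DIM('a) * omega TYPE('a) / (1 - 2 powr -\<gamma>) * R powr \<gamma>
       = 2 powr \<gamma> * (2 ^ DIM('a) * omega TYPE('a) / (1 - 2 powr -\<gamma>)) * h"
      by (simp add: R)
    also have "ennreal \<dots> = ennreal (2 powr \<gamma> * (2 ^ DIM('a) * omega TYPE('a) / (1 - 2 powr -\<gamma>))) * H"
      unfolding h(1) using h(2) \<gamma> powr_less_mono[of "-\<gamma>" 0 2] by (intro ennreal_mult) auto
    finally show ?thesis by (simp only: mult.assoc)
  qed
qed

lemma kernel_far_level:
  fixes x :: "'a::euclidean_space" and u :: "'a \<Rightarrow> ennreal" and \<gamma> :: real
  assumes [measurable]: "u \<in> borel_measurable borel" and \<gamma>: "\<gamma> < 0"
  shows "(\<integral>\<^sup>+ y. indicator {y. ennreal (dist x y powr \<gamma>) < H} y * ennreal (dist x y powr (\<gamma> - DIM('a))) * u y \<partial>lborel)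
     \<le> ennreal (4 ^ DIM('a) * omega TYPE('a) / (1 - 2 powr \<gamma>)) * (H * Mx u x)"
    (is "?L \<le> ennreal ?C * _")
proof -
  have C: "0 < ?C" using \<gamma> powr_less_mono[of "\<gamma>" 0 2] omega_pos[where 'a='a] by (simp del: unit_ball_vol_pos)
  consider "H = 0" | "H = \<infinity>" "Mx u x = 0" | "H = \<infinity>" "Mx u x \<noteq> 0" | h where "H = ennreal h" "0 < h"
    by (cases H) (auto simp: less_le)
  then show ?thesis
  proof cases
    case 1
    then have "?L = (\<integral>\<^sup>+ (y::'a). 0 \<partial>lborel)" by (intro nn_integral_cong) simp
    then show ?thesis by simp
  next
    case 2
    have "AE y in lborel. u y = 0" by (rule Mx_eq_0_imp_AE[OF _ 2(2)]) simp
    then have "AE y in lborel. indicator {y. ennreal (dist x y powr \<gamma>) < H} y * ennreal (dist x y powr (\<gamma> - DIM('a))) * u y = 0"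
      by eventually_elim simp
    then have "?L = (\<integral>\<^sup>+ (y::'a). 0 \<partial>lborel)" by (rule nn_integral_cong_AE)
    then show ?thesis by simp
  next
    case 3
    then have "ennreal c * (H * Mx u x) = \<infinity>" if "0 < c" for c :: real using that by (simp add: ennreal_mult_eq_top_iff)
    then show ?thesis using C by simp
  next
    case (4 h)
    define R where "R = h powr (1 / \<gamma>)"
    have R: "0 < R" "R powr \<gamma> = h" using 4 \<gamma> by (auto simp: R_def powr_powr)
    have "?L \<le> (\<integral>\<^sup>+ y. indicator (- ball x R) y * ennreal (dist x y powr (\<gamma> - DIM('a))) * u y \<partial>lborel)"
    proof (rule nn_integral_mono, rule mult_right_mono)
      fix y
      show "indicator {y. ennreal (dist x y powr \<gamma>) < H} y * ennreal (dist x y powr (\<gamma> - DIM('a)))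
        \<le> indicator (- ball x R) y * ennreal (dist x y powr (\<gamma> - DIM('a)))"
      \<comment> \<open>The point y = x belongs to the level set, since
        \<open>0 powr \<gamma> = 0\<close> also for negative \<gamma>, but the kernel is 0 there
        too.\<close>
      proof (cases "dist x y = 0 \<or> y \<notin> ball x R")
        case False
        then have "R powr \<gamma> \<le> dist x y powr \<gamma>" using \<gamma> by (intro powr_mono2') auto
        then have "\<not> ennreal (dist x y powr \<gamma>) < H" using 4 R by (simp add: not_less ennreal_leI)
        then show ?thesis by simp
      next
        case True
        then show ?thesis by (cases "dist x y = 0") (auto simp: indicator_def)
      qed
    qed auto
    also have "\<dots> \<le> ennreal (?C * R powr \<gamma>) * Mx u x"
      using R by (intro kernel_far \<gamma>) auto
    also have "ennreal (?C * R powr \<gamma>) = ennreal ?C * H"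
      unfolding R 4(1) using 4 C by (intro ennreal_mult) auto
    finally show ?thesis by (simp only: mult.assoc)
  qed
qed

lemma Dset_pred [measurable]:
  fixes f :: "'a::euclidean_space \<Rightarrow> real"
  assumes [measurable]: "f \<in> borel_measurable borel"
  shows "Measurable.pred (lborel \<Otimes>\<^sub>M lborel) (\<lambda>(x, y). (x, y) \<in> Dset lam \<beta> \<sigma> f)"
  unfolding Dset_def by measurable

lemma Dset_sets [measurable]:
  fixes f :: "'a::euclidean_space \<Rightarrow> real"
  assumes [measurable]: "f \<in> borel_measurable borel"
  shows "Dset lam \<beta> \<sigma> f \<in> sets (lborel \<Otimes>\<^sub>M lborel)"
  using Dset_pred[OF assms, of lam \<beta> \<sigma>] by (simp add: pred_def space_pair_measure)

lemma level_int_measurable [measurable]: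
  fixes f :: "'a::euclidean_space \<Rightarrow> real"
  assumes [measurable]: "f \<in> borel_measurable borel"
  shows "level_int lam \<beta> \<sigma> \<gamma> f \<in> borel_measurable borel"
  unfolding level_int_def by measurable

text \<open>Distances bounded from above and from below give bounded radii for Vitali's lemma and
  radii away from 0 for \<open>reverse_Vitali\<close>; monotone convergence removes the
  restriction.\<close>

lemma level_int_truncate:
  fixes f :: "'a::euclidean_space \<Rightarrow> real" and u :: "'a \<Rightarrow> ennreal"
  assumes [measurable]: "f \<in> borel_measurable borel" "u \<in> borel_measurable borel"
    and le: "\<And>N::nat. (\<integral>\<^sup>+ x. \<integral>\<^sup>+ y. u x * (indicator (Dset lam \<beta> \<sigma> f) (x, y)
       * indicator {y. 1 / real (Suc N) \<le> dist x y \<and> dist x y \<le> real (Suc N)} y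
       * ennreal (dist x y powr (\<gamma> - real DIM('a)))) \<partial>lborel \<partial>lborel) \<le> B"
  shows "(\<integral>\<^sup>+ x. u x * level_int lam \<beta> \<sigma> \<gamma> f x \<partial>lborel) \<le> B"
proof -
  let ?T = "\<lambda>N x y. u x * (indicator (Dset lam \<beta> \<sigma> f) (x, y)
       * indicator {y. 1 / real (Suc N) \<le> dist x y \<and> dist x y \<le> real (Suc N)} y
       * ennreal (dist x y powr (\<gamma> - real DIM('a))))"
  have inc: "incseq (\<lambda>N. ?T N x y)" for x y
  proof (intro incseq_SucI mult_left_mono mult_right_mono)
    fix N
    have "1 / real (Suc (Suc N)) \<le> 1 / real (Suc N)" by (intro divide_left_mono) auto
    then show "indicator {y. 1 / real (Suc N) \<le> dist x y \<and> dist x y \<le> real (Suc N)} y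
      \<le> (indicator {y. 1 / real (Suc (Suc N)) \<le> dist x y \<and> dist x y \<le> real (Suc (Suc N))} y :: ennreal)"
      by (auto simp: indicator_def simp del: of_nat_Suc)
  qed auto
  have sup: "(SUP N. ?T N x y) = u x * (indicator (Dset lam \<beta> \<sigma> f) (x, y) * ennreal (dist x y powr (\<gamma> - real DIM('a))))" for x y
  proof (cases "(x, y) \<in> Dset lam \<beta> \<sigma> f")
    case True
    then have "0 < dist x y" by (auto simp: Dset_def)
    then obtain n :: nat where n: "inverse (real (Suc n)) < dist x y" using reals_Archimedean by blast
    obtain m :: nat where m: "dist x y < real m" using reals_Archimedean2 by blast
    define N where "N = max n m"
    have "1 / real (Suc N) \<le> inverse (real (Suc n))"
      by (simp add: N_def inverse_eq_divide divide_left_mono)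
    moreover have "real m \<le> real (Suc N)" by (simp add: N_def)
    ultimately have "?T N x y = u x * (indicator (Dset lam \<beta> \<sigma> f) (x, y) * ennreal (dist x y powr (\<gamma> - real DIM('a))))"
      using n m by (simp del: of_nat_Suc)
    moreover have "?T N x y \<le> (SUP N. ?T N x y)" by (rule SUP_upper) simp
    ultimately have "u x * (indicator (Dset lam \<beta> \<sigma> f) (x, y) * ennreal (dist x y powr (\<gamma> - real DIM('a)))) \<le> (SUP N. ?T N x y)" by simp
    then show ?thesis by (intro antisym SUP_least mult_left_mono mult_right_mono) (auto simp: indicator_def)
  qed simp
  have "(\<integral>\<^sup>+ x. u x * level_int lam \<beta> \<sigma> \<gamma> f x \<partial>lborel) = (\<integral>\<^sup>+ x. \<integral>\<^sup>+ y. (SUP N. ?T N x y) \<partial>lborel \<partial>lborel)"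
    unfolding sup level_int_def by (intro nn_integral_cong nn_integral_cmult[symmetric]) measurable
  also have "\<dots> = (\<integral>\<^sup>+ x. (SUP N. \<integral>\<^sup>+ y. ?T N x y \<partial>lborel) \<partial>lborel)"
  proof (intro nn_integral_cong nn_integral_monotone_convergence_SUP)
    fix x show "incseq (\<lambda>N. ?T N x)" using inc by (simp add: incseq_def le_fun_def)
  qed measurable
  also have "\<dots> = (SUP N. \<integral>\<^sup>+ x. \<integral>\<^sup>+ y. ?T N x y \<partial>lborel \<partial>lborel)"
  proof (rule nn_integral_monotone_convergence_SUP)
    show "incseq (\<lambda>N x. \<integral>\<^sup>+ y. ?T N x y \<partial>lborel)"
      using inc by (auto simp: incseq_def le_fun_def intro!: nn_integral_mono)
  qed measurable
  also have "\<dots> \<le> B" by (intro SUP_least le)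
  finally show ?thesis .
qed

section \<open>Positive exponents: stopping scales\<close>

text \<open>If a pair at distance r \<le> N is charged to \<open>x\<close> because the average of
  \<open>g\<close> over the ball of radius \<delta> r about \<open>x\<close> exceeds its threshold,
  then r^\<gamma> is at most this function at \<open>x\<close>; so all partners of \<open>x\<close>
  lie in one ball. The cap \<open>N\<close> bounds the radii for Vitali's lemma.\<close>

definition stop_fun :: "real \<Rightarrow> real \<Rightarrow> real \<Rightarrow> real \<Rightarrow> ('a::euclidean_space \<Rightarrow> ennreal) \<Rightarrow> 'a \<Rightarrow> ennreal" where
  "stop_fun \<gamma> \<kappa> \<delta> N g x = (SUP r\<in>{0<..N}. if ennreal (\<kappa> * r powr \<gamma>) < avg x (\<delta> * r) g then ennreal (r powr \<gamma>) else 0)"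

lemma stop_fun_measurable [measurable]:
  fixes g :: "'a::euclidean_space \<Rightarrow> ennreal"
  assumes g: "g \<in> borel_measurable borel" and \<delta>: "0 < \<delta>"
  shows "stop_fun \<gamma> \<kappa> \<delta> N g \<in> borel_measurable borel"
proof (rule borel_measurableI_greater)
  fix c
  have "{x. c < stop_fun \<gamma> \<kappa> \<delta> N g x} = (\<Union>r\<in>{r. 0 < r \<and> r \<le> N \<and> c < ennreal (r powr \<gamma>)}. {x. ennreal (\<kappa> * r powr \<gamma>) < avg x (\<delta> * r) g})"
    unfolding stop_fun_def less_SUP_iff by (auto split: if_splits)
  also have "open \<dots>" using \<delta> by (intro open_UN ballI open_avg_gt g) auto
  finally show "{x \<in> space borel. c < stop_fun \<gamma> \<kappa> \<delta> N g x} \<in> sets borel" by simp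
qed

lemma stop_fun_bounded: "0 < \<gamma> \<Longrightarrow> stop_fun \<gamma> \<kappa> \<delta> N g x \<le> ennreal (N powr \<gamma>)"
  unfolding stop_fun_def by (intro SUP_least) (auto intro!: ennreal_leI powr_mono2)

text \<open>Vitali's lemma is applied to the balls of radius \<delta> r, which carry the mass, while
  r itself enters only through r^\<gamma>. The integral of \<open>v\<close> over a ball enlarged
  five times is at most the volume for radius 6 \<delta> r times M v at any point of the selected
  ball. The volumes cancel up to 6^n, so the constant does not depend on \<delta>; the summation
  over dyadic scales relies on this.\<close>

lemma stop_fun_integral:
  fixes g v :: "'a::euclidean_space \<Rightarrow> ennreal"
  assumes [measurable]: "g \<in> borel_measurable borel" "v \<in> borel_measurable borel"
    and \<gamma>: "0 < \<gamma>" and \<kappa>: "0 < \<kappa>" and \<delta>: "0 < \<delta>"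
  shows "(\<integral>\<^sup>+ x. stop_fun \<gamma> \<kappa> \<delta> N g x * v x \<partial>lborel) \<le> ennreal (5 powr \<gamma> * 6 ^ DIM('a) / \<kappa>) * (\<integral>\<^sup>+ x. g x * Mx v x \<partial>lborel)"
proof -
  let ?n = "DIM('a)"
  define K where "K = {(x, r). 0 < r \<and> r \<le> N \<and> ennreal (\<kappa> * r powr \<gamma>) < avg x (\<delta> * r) g}"
  define rad where "rad i = \<delta> * snd i" for i :: "'a \<times> real"
  have K: "0 < rad i \<and> rad i \<le> \<delta> * N" if "i \<in> K" for i using that \<delta> by (auto simp: K_def rad_def)
  obtain C where C: "countable C" "C \<subseteq> K" "pairwise (\<lambda>i j. disjnt (cball (fst i) (rad i)) (cball (fst j) (rad j))) C"
    "\<And>i. i \<in> K \<Longrightarrow> \<exists>j. j \<in> C \<and> \<not> disjnt (cball (fst i) (rad i)) (cball (fst j) (rad j)) \<and> cball (fst i) (rad i) \<subseteq> ball (fst j) (5 * rad j)"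
    by (rule Vitali_covering_lemma_cballs_balls[of K rad "\<delta> * N" fst, OF K]) blast+
  let ?t = "\<lambda>j x. ennreal ((5 * snd j) powr \<gamma>) * indicator (ball (fst j) (5 * rad j)) x"
  have pw: "stop_fun \<gamma> \<kappa> \<delta> N g x \<le> (\<integral>\<^sup>+ j. ?t j x \<partial>count_space C)" for x
    unfolding stop_fun_def
  proof (intro SUP_least)
    fix r assume r: "r \<in> {0<..N}"
    show "(if ennreal (\<kappa> * r powr \<gamma>) < avg x (\<delta> * r) g then ennreal (r powr \<gamma>) else 0) \<le> (\<integral>\<^sup>+ j. ?t j x \<partial>count_space C)"
    proof (cases "ennreal (\<kappa> * r powr \<gamma>) < avg x (\<delta> * r) g")
      case True
      then have i: "(x, r) \<in> K" using r by (simp add: K_def)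
      obtain j where j: "j \<in> C" "cball x (rad (x, r)) \<subseteq> ball (fst j) (5 * rad j)" using C(4)[OF i] by auto
      \<comment> \<open>Besides covering \<open>x\<close>, the inclusion of the balls compares their
        sizes: \<open>r\<close> is at most five times the scale of the selected pair.\<close>
      have "dist x (fst j) + rad (x, r) < 5 * rad j" using j(2) K[OF i] by (simp add: cball_subset_ball_iff)
      then have "rad (x, r) < 5 * rad j" using zero_le_dist[of x "fst j"] by linarith
      then have "r \<le> 5 * snd j" using \<delta> by (simp add: rad_def)
      then have "ennreal (r powr \<gamma>) \<le> ennreal ((5 * snd j) powr \<gamma>)" using r \<gamma> by (intro ennreal_leI powr_mono2) auto
      moreover have "x \<in> ball (fst j) (5 * rad j)" using j(2) K[OF i] by (auto simp: subset_iff)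
      ultimately have "ennreal (r powr \<gamma>) \<le> ?t j x" by simp
      also have "\<dots> \<le> (\<integral>\<^sup>+ j. ?t j x \<partial>count_space C)" using j(1) by (rule nn_integral_ge_point)
      finally show ?thesis using True by simp
    qed simp
  qed
  have "(\<integral>\<^sup>+ x. stop_fun \<gamma> \<kappa> \<delta> N g x * v x \<partial>lborel) \<le> (\<integral>\<^sup>+ x. (\<integral>\<^sup>+ j. ?t j x * v x \<partial>count_space C) \<partial>lborel)"
    by (intro nn_integral_mono, subst nn_integral_multc) (auto intro: mult_right_mono pw)
  also have "\<dots> = (\<integral>\<^sup>+ j. (\<integral>\<^sup>+ x. ?t j x * v x \<partial>lborel) \<partial>count_space C)"
    by (rule nn_integral_count_space_nn_integral) (use C in measurable)
  also have "\<dots> \<le> (\<integral>\<^sup>+ j. ennreal (5 powr \<gamma> * 6 ^ ?n / \<kappa>) * (\<integral>\<^sup>+ x\<in>ball (fst j) (rad j). g x * Mx v x \<partial>lborel) \<partial>count_space C)"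
  proof (intro nn_integral_mono)
    fix j assume "j \<in> space (count_space C)"
    then have jK: "j \<in> K" using C(2) by auto
    define \<rho> where "\<rho> = rad j"
    define r where "r = snd j"
    have \<rho>: "0 < \<rho>" "0 < r" "\<rho> = \<delta> * r" using K[OF jK] jK by (auto simp: \<rho>_def r_def rad_def K_def)
    define p where "p = omega TYPE('a) * \<rho> ^ ?n * (\<kappa> * r powr \<gamma>)"
    define a where "a = (5 * r) powr \<gamma> * (omega TYPE('a) * (6 * \<rho>) ^ ?n)"
    have mass: "ennreal p \<le> (\<integral>\<^sup>+ z\<in>ball (fst j) \<rho>. g z \<partial>lborel)"
    proof -
      have "ennreal p = ennreal (omega TYPE('a) * \<rho> ^ ?n) * ennreal (\<kappa> * r powr \<gamma>)"
        unfolding p_def using \<rho> \<kappa> by (intro ennreal_mult) auto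
      also have "\<dots> \<le> ennreal (omega TYPE('a) * \<rho> ^ ?n) * avg (fst j) \<rho> g"
        using jK \<rho> by (intro mult_left_mono) (auto simp: K_def r_def split: prod.splits)
      also have "\<dots> = (\<integral>\<^sup>+ z\<in>ball (fst j) \<rho>. g z \<partial>lborel)" using \<rho> by (simp add: ball_integral_eq)
      finally show ?thesis .
    qed
    have "(\<integral>\<^sup>+ x. ?t j x * v x \<partial>lborel) \<le> ennreal (a / p) * (\<integral>\<^sup>+ z\<in>ball (fst j) \<rho>. g z * Mx v z \<partial>lborel)"
    proof (rule ball_mass_transfer[OF _ _ _ mass])
      fix z assume z: "z \<in> ball (fst j) \<rho>"
      have "ball (fst j) (5 * \<rho>) \<subseteq> ball z (6 * \<rho>)"
      proof
        fix y assume "y \<in> ball (fst j) (5 * \<rho>)"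
        then show "y \<in> ball z (6 * \<rho>)" using z dist_triangle[of z y "fst j"] by (simp add: dist_commute)
      qed
      then have *: "(\<integral>\<^sup>+ x\<in>ball (fst j) (5 * \<rho>). v x \<partial>lborel) \<le> ennreal (omega TYPE('a) * (6 * \<rho>) ^ ?n) * Mx v z"
        using \<rho> by (intro ball_integral_le_Mx) auto
      have "(\<integral>\<^sup>+ x. ?t j x * v x \<partial>lborel) = (\<integral>\<^sup>+ x. ennreal ((5 * r) powr \<gamma>) * (v x * indicator (ball (fst j) (5 * \<rho>)) x) \<partial>lborel)"
        by (intro nn_integral_cong) (simp add: r_def \<rho>_def mult_ac)
      also have "\<dots> = ennreal ((5 * r) powr \<gamma>) * (\<integral>\<^sup>+ x\<in>ball (fst j) (5 * \<rho>). v x \<partial>lborel)"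
        by (intro nn_integral_cmult) measurable
      also have "\<dots> \<le> ennreal ((5 * r) powr \<gamma>) * (ennreal (omega TYPE('a) * (6 * \<rho>) ^ ?n) * Mx v z)"
        using * by (intro mult_left_mono) auto
      also have "\<dots> = ennreal a * Mx v z"
        unfolding a_def using \<rho> by (subst ennreal_mult) (auto simp: mult.assoc)
      finally show "(\<integral>\<^sup>+ x. ?t j x * v x \<partial>lborel) \<le> ennreal a * Mx v z" .
    next
      show "0 < p" "0 \<le> a" using \<rho> \<kappa> omega_pos[where 'a='a] by (auto simp: p_def a_def simp del: unit_ball_vol_pos)
    qed measurable
    also have "a / p = 5 powr \<gamma> * 6 ^ ?n / \<kappa>"
      using \<rho> \<kappa> omega_pos[where 'a='a] unfolding a_def p_def
      using \<delta> by (simp add: powr_mult power_mult_distrib field_simps del: unit_ball_vol_pos)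
    finally show "(\<integral>\<^sup>+ x. ?t j x * v x \<partial>lborel) \<le> ennreal (5 powr \<gamma> * 6 ^ ?n / \<kappa>) * (\<integral>\<^sup>+ x\<in>ball (fst j) (rad j). g x * Mx v x \<partial>lborel)"
      by (simp only: \<rho>_def)
  qed
  also have "\<dots> = ennreal (5 powr \<gamma> * 6 ^ ?n / \<kappa>) * (\<integral>\<^sup>+ j. (\<integral>\<^sup>+ x\<in>ball (fst j) (rad j). g x * Mx v x \<partial>lborel) \<partial>count_space C)"
    by (intro nn_integral_cmult) auto
  also have "\<dots> \<le> ennreal (5 powr \<gamma> * 6 ^ ?n / \<kappa>) * (\<integral>\<^sup>+ x. g x * Mx v x \<partial>lborel)"
  proof (intro mult_left_mono sum_disjoint_integrals C(1))
    fix i j assume "i \<in> C" "j \<in> C" "i \<noteq> j"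
    then have "disjnt (cball (fst i) (rad i)) (cball (fst j) (rad j))" using C(3) by (auto simp: pairwise_def)
    then show "disjnt (ball (fst i) (rad i)) (ball (fst j) (rad j))"
      by (meson ball_subset_cball disjnt_subset1 disjnt_subset2)
  qed auto
  finally show ?thesis .
qed

text \<open>Otherwise all averages in \<open>pair_bound\<close> stay below their thresholds, and the
  two series, geometric with ratio sqrt 2 / 2, give at most lam r^(1+\<gamma>); \<kappa> is the
  constant for which this comes out exactly. The growth factor sqrt 2 lies strictly between 1 and 2:
  below 2 so that this series converges, above 1 so that the bounds 1 / (\<kappa> sqrt 2 ^ j) from
  \<open>stop_fun_integral\<close> can be summed.\<close>

lemma Dset_threshold:
  fixes f :: "'a::euclidean_space \<Rightarrow> real" and g :: "'a \<Rightarrow> ennreal"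
  assumes [measurable]: "f \<in> borel_measurable borel" "g \<in> borel_measurable borel" and sb: "seg_bound f g"
    and D: "(x, y) \<in> Dset lam \<gamma> 1 f" and lam: "0 < lam"
  defines "\<kappa> \<equiv> lam * (1 - sqrt 2 / 2) / 4 ^ DIM('a)" and "r \<equiv> dist x y"
  shows "\<exists>j. ennreal (\<kappa> * sqrt 2 ^ j * r powr \<gamma>) < avg x (r / 2 ^ j) g \<or> ennreal (\<kappa> * sqrt 2 ^ j * r powr \<gamma>) < avg y (r / 2 ^ j) g"
proof (rule ccontr)
  assume "\<not> ?thesis"
  then have le: "avg x (r / 2 ^ j) g \<le> ennreal (\<kappa> * sqrt 2 ^ j * r powr \<gamma>)" "avg y (r / 2 ^ j) g \<le> ennreal (\<kappa> * sqrt 2 ^ j * r powr \<gamma>)" for j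
    by (auto simp: not_less)
  have r: "0 < r" and gt: "\<bar>f x - f y\<bar> / r powr (1 + \<gamma>) > lam" using D by (auto simp: Dset_def r_def)
  have s2: "sqrt 2 < 2" using real_sqrt_less_mono[of 2 4] by simp
  have \<kappa>: "0 < \<kappa>" using s2 lam by (simp add: \<kappa>_def)
  have S: "(\<Sum>j. ennreal ((1/2) ^ Suc j) * avg z (r / 2 ^ j) g) \<le> ennreal (\<kappa> * r powr \<gamma> / 2 / (1 - sqrt 2 / 2))"
    if "z = x \<or> z = y" for z
  proof -
    have "(\<Sum>j. ennreal ((1/2) ^ Suc j) * avg z (r / 2 ^ j) g) \<le> (\<Sum>j. ennreal (\<kappa> * r powr \<gamma> / 2 * (sqrt 2 / 2) ^ j))"
    proof (intro suminf_le)
      fix j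
      have "ennreal ((1/2) ^ Suc j) * avg z (r / 2 ^ j) g \<le> ennreal ((1/2) ^ Suc j) * ennreal (\<kappa> * sqrt 2 ^ j * r powr \<gamma>)"
        using that le[of j] by (intro mult_left_mono) auto
      also have "\<dots> = ennreal (\<kappa> * r powr \<gamma> / 2 * (sqrt 2 / 2) ^ j)"
        using \<kappa> by (simp add: power_divide field_simps flip: ennreal_mult)
      finally show "ennreal ((1/2) ^ Suc j) * avg z (r / 2 ^ j) g \<le> \<dots>" .
    qed auto
    also have "\<dots> = ennreal (\<kappa> * r powr \<gamma> / 2 / (1 - sqrt 2 / 2))"
      using s2 \<kappa> by (intro powr_suminf_ennreal) auto
    finally show ?thesis .
  qed
  have "ennreal \<bar>f x - f y\<bar> \<le> ennreal (4 ^ DIM('a) * r) *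
    ((\<Sum>j. ennreal ((1/2) ^ Suc j) * avg x (r / 2 ^ j) g) + (\<Sum>j. ennreal ((1/2) ^ Suc j) * avg y (r / 2 ^ j) g))"
    using r by (intro pair_bound sb) (auto simp: r_def)
  also have "\<dots> \<le> ennreal (4 ^ DIM('a) * r) * (ennreal (\<kappa> * r powr \<gamma> / 2 / (1 - sqrt 2 / 2)) + ennreal (\<kappa> * r powr \<gamma> / 2 / (1 - sqrt 2 / 2)))"
    by (intro mult_left_mono add_mono S) auto
  also have "\<dots> = ennreal (4 ^ DIM('a) * r * (\<kappa> * r powr \<gamma> / 2 / (1 - sqrt 2 / 2) + \<kappa> * r powr \<gamma> / 2 / (1 - sqrt 2 / 2)))"
    using s2 \<kappa> r by (simp flip: ennreal_plus ennreal_mult)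
  also have "4 ^ DIM('a) * r * (\<kappa> * r powr \<gamma> / 2 / (1 - sqrt 2 / 2) + \<kappa> * r powr \<gamma> / 2 / (1 - sqrt 2 / 2)) = lam * r powr (1 + \<gamma>)"
  proof -
    have "\<kappa> * r powr \<gamma> / 2 / (1 - sqrt 2 / 2) + \<kappa> * r powr \<gamma> / 2 / (1 - sqrt 2 / 2) = \<kappa> / (1 - sqrt 2 / 2) * r powr \<gamma>"
    proof -
      have "a / 2 / w + a / 2 / w = a / w" for a w :: real by (simp flip: add_divide_distrib)
      then show ?thesis by (simp only: times_divide_eq_left)
    qed
    also have "\<kappa> / (1 - sqrt 2 / 2) = lam / 4 ^ DIM('a)" using s2 by (simp add: \<kappa>_def)
    finally show ?thesis using r by (simp add: powr_add)
  qed
  finally have "\<bar>f x - f y\<bar> \<le> lam * r powr (1 + \<gamma>)" using lam by (simp add: ennreal_le_iff)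
  then show False using gt r by (simp add: field_simps)
qed

text \<open>A pair is charged to \<open>x\<close> or to \<open>y\<close> at some dyadic scale. If it
  is charged to \<open>x\<close>, the kernel is integrated in y and the weight remains u(x); if to
  \<open>y\<close>, integration in x turns the weight into M u(y). The covering estimate then puts
  one more maximal function on either weight.\<close>

lemma level_int_bound_pos:
  fixes f :: "'a::euclidean_space \<Rightarrow> real" and g u :: "'a \<Rightarrow> ennreal"
  assumes [measurable]: "f \<in> borel_measurable borel" "g \<in> borel_measurable borel" "u \<in> borel_measurable borel"
    and sb: "seg_bound f g" and lam: "0 < lam" and \<gamma>: "0 < \<gamma>"
  defines "C \<equiv> 2 powr \<gamma> * (2 ^ DIM('a) * omega TYPE('a) / (1 - 2 powr -\<gamma>)) * (5 powr \<gamma> * 6 ^ DIM('a)) * 4 ^ DIM('a)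
    / (1 - sqrt 2 / 2) / (1 - 1 / sqrt 2)"
  shows "(\<integral>\<^sup>+ x. u x * level_int lam \<gamma> 1 \<gamma> f x \<partial>lborel)
    \<le> ennreal (C / lam) * ((\<integral>\<^sup>+ x. g x * Mx u x \<partial>lborel) + (\<integral>\<^sup>+ x. g x * Mx (Mx u) x \<partial>lborel))"
proof (rule level_int_truncate)
  fix N :: nat
  let ?n = "DIM('a)" and ?N = "real (Suc N)"
  define \<kappa> where "\<kappa> = lam * (1 - sqrt 2 / 2) / 4 ^ ?n"
  define C1 where "C1 = 2 powr \<gamma> * (2 ^ ?n * omega TYPE('a) / (1 - 2 powr -\<gamma>))"
  define C2 where "C2 = (5 powr \<gamma> * 6 ^ ?n :: real)"
  define h where "h j = stop_fun \<gamma> (\<kappa> * sqrt 2 ^ j) (1 / 2 ^ j) ?N g" for j :: nat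
  have s2: "1 < sqrt 2" "sqrt 2 < 2" using real_sqrt_less_mono[of 2 4] by auto
  have \<kappa>: "0 < \<kappa>" using s2 lam by (simp add: \<kappa>_def)
  have C1: "0 \<le> C1" using \<gamma> powr_less_mono[of "-\<gamma>" 0 2] by (simp add: C1_def)
  have [measurable]: "h j \<in> borel_measurable borel" for j unfolding h_def by measurable
  have h_fin: "h j x < \<infinity>" for j x
    using stop_fun_bounded[OF \<gamma>] unfolding h_def by (rule le_less_trans) simp
  let ?k = "\<lambda>x y. ennreal (dist x y powr (\<gamma> - real ?n))"
  let ?A = "\<lambda>j x y. indicator {y. ennreal (dist x y powr \<gamma>) \<le> h j x} y * ?k x y * u x"
  let ?B = "\<lambda>j x y. indicator {x. ennreal (dist y x powr \<gamma>) \<le> h j y} x * ?k y x * u x"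
  have meas_AB [measurable]: "(\<lambda>(x, y). ?A j x y) \<in> borel_measurable (lborel \<Otimes>\<^sub>M lborel)"
    "(\<lambda>(x, y). ?B j x y) \<in> borel_measurable (lborel \<Otimes>\<^sub>M lborel)" for j
    unfolding indicator_def by measurable
  have "(\<integral>\<^sup>+ x. \<integral>\<^sup>+ y. u x * (indicator (Dset lam \<gamma> 1 f) (x, y)
       * indicator {y. 1 / ?N \<le> dist x y \<and> dist x y \<le> ?N} y * ?k x y) \<partial>lborel \<partial>lborel)
     \<le> (\<integral>\<^sup>+ x. \<integral>\<^sup>+ y. (\<Sum>j. ?A j x y + ?B j x y) \<partial>lborel \<partial>lborel)"
  proof (intro nn_integral_mono)
    fix x y
    show "u x * (indicator (Dset lam \<gamma> 1 f) (x, y) * indicator {y. 1 / ?N \<le> dist x y \<and> dist x y \<le> ?N} y * ?k x y)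
      \<le> (\<Sum>j. ?A j x y + ?B j x y)"
    proof (cases "(x, y) \<in> Dset lam \<gamma> 1 f \<and> dist x y \<le> ?N")
      case True
      then have r: "0 < dist x y" "dist x y \<in> {0<..?N}" by (auto simp: Dset_def)
      obtain j where j: "ennreal (\<kappa> * sqrt 2 ^ j * dist x y powr \<gamma>) < avg x (dist x y / 2 ^ j) g \<or>
           ennreal (\<kappa> * sqrt 2 ^ j * dist x y powr \<gamma>) < avg y (dist x y / 2 ^ j) g"
        using Dset_threshold[OF _ _ sb conjunct1[OF True] lam] unfolding \<kappa>_def by auto
      have up: "ennreal (dist x y powr \<gamma>) \<le> h j z" if "ennreal (\<kappa> * sqrt 2 ^ j * dist x y powr \<gamma>) < avg z (dist x y / 2 ^ j) g" for z
        unfolding h_def stop_fun_def using that r(2) by (intro SUP_upper2[of "dist x y"]) auto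
      have "u x * ?k x y \<le> ?A j x y + ?B j x y"
        using j
      proof
        assume "ennreal (\<kappa> * sqrt 2 ^ j * dist x y powr \<gamma>) < avg x (dist x y / 2 ^ j) g"
        from up[OF this] show ?thesis by (simp add: mult.commute)
      next
        assume "ennreal (\<kappa> * sqrt 2 ^ j * dist x y powr \<gamma>) < avg y (dist x y / 2 ^ j) g"
        from up[OF this] show ?thesis by (simp add: mult.commute dist_commute)
      qed
      also have "\<dots> \<le> (\<Sum>j. ?A j x y + ?B j x y)" by (rule le_suminf_ennreal[of "\<lambda>j. ?A j x y + ?B j x y" j])
      finally show ?thesis using True by (auto simp: indicator_def simp del: of_nat_Suc)
    qed (auto simp: indicator_def)
  qed
  also have "\<dots> = (\<integral>\<^sup>+ x. (\<Sum>j. \<integral>\<^sup>+ y. ?A j x y + ?B j x y \<partial>lborel) \<partial>lborel)"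
    by (intro nn_integral_cong nn_integral_suminf) measurable
  also have "\<dots> = (\<Sum>j. \<integral>\<^sup>+ x. \<integral>\<^sup>+ y. ?A j x y + ?B j x y \<partial>lborel \<partial>lborel)"
    by (intro nn_integral_suminf) measurable
  also have "\<dots> \<le> (\<Sum>j. ennreal (C1 * C2 / \<kappa> * (1 / sqrt 2) ^ j) * ((\<integral>\<^sup>+ x. g x * Mx u x \<partial>lborel) + (\<integral>\<^sup>+ x. g x * Mx (Mx u) x \<partial>lborel)))"
  proof (intro suminf_le)
    fix j
    have "(\<integral>\<^sup>+ x. \<integral>\<^sup>+ y. ?A j x y + ?B j x y \<partial>lborel \<partial>lborel)
      = (\<integral>\<^sup>+ x. (\<integral>\<^sup>+ y. ?A j x y \<partial>lborel) + (\<integral>\<^sup>+ y. ?B j x y \<partial>lborel) \<partial>lborel)"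
      by (intro nn_integral_cong nn_integral_add) measurable
    also have "\<dots> = (\<integral>\<^sup>+ x. \<integral>\<^sup>+ y. ?A j x y \<partial>lborel \<partial>lborel) + (\<integral>\<^sup>+ x. \<integral>\<^sup>+ y. ?B j x y \<partial>lborel \<partial>lborel)"
      by (intro nn_integral_add) measurable
    also have "(\<integral>\<^sup>+ x. \<integral>\<^sup>+ y. ?B j x y \<partial>lborel \<partial>lborel) = (\<integral>\<^sup>+ y. \<integral>\<^sup>+ x. ?B j x y \<partial>lborel \<partial>lborel)"
      by (rule lborel_pair.Fubini'[symmetric]) measurable
    also have "\<dots> \<le> (\<integral>\<^sup>+ y. ennreal C1 * (h j y * Mx u y) \<partial>lborel)"
      unfolding C1_def by (intro nn_integral_mono kernel_near_level \<gamma> h_fin) measurable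
    also have "\<dots> = ennreal C1 * (\<integral>\<^sup>+ y. h j y * Mx u y \<partial>lborel)"
      by (intro nn_integral_cmult) measurable
    also have "(\<integral>\<^sup>+ x. \<integral>\<^sup>+ y. ?A j x y \<partial>lborel \<partial>lborel) \<le> (\<integral>\<^sup>+ x. ennreal C1 * (h j x * u x) \<partial>lborel)"
    proof (intro nn_integral_mono)
      fix x
      have "(\<integral>\<^sup>+ y. ?A j x y \<partial>lborel) = (\<integral>\<^sup>+ y. indicator {y. ennreal (dist x y powr \<gamma>) \<le> h j x} y * ?k x y * 1 \<partial>lborel) * u x"
        by (subst nn_integral_multc[symmetric]) (auto simp: indicator_def)
      also have "\<dots> \<le> (ennreal C1 * (h j x * Mx (\<lambda>_. 1) x)) * u x"
        unfolding C1_def by (intro mult_right_mono kernel_near_level \<gamma> h_fin) auto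
      finally show "(\<integral>\<^sup>+ y. ?A j x y \<partial>lborel) \<le> ennreal C1 * (h j x * u x)" by (simp add: Mx_const_1 mult.assoc)
    qed
    also have "\<dots> = ennreal C1 * (\<integral>\<^sup>+ x. h j x * u x \<partial>lborel)"
      by (intro nn_integral_cmult) measurable
    finally have "(\<integral>\<^sup>+ x. \<integral>\<^sup>+ y. ?A j x y + ?B j x y \<partial>lborel \<partial>lborel)
      \<le> ennreal C1 * (\<integral>\<^sup>+ x. h j x * u x \<partial>lborel) + ennreal C1 * (\<integral>\<^sup>+ y. h j y * Mx u y \<partial>lborel)"
      by (simp add: add_mono)
    also have "\<dots> \<le> ennreal C1 * (ennreal (C2 / (\<kappa> * sqrt 2 ^ j)) * (\<integral>\<^sup>+ x. g x * Mx u x \<partial>lborel))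
        + ennreal C1 * (ennreal (C2 / (\<kappa> * sqrt 2 ^ j)) * (\<integral>\<^sup>+ x. g x * Mx (Mx u) x \<partial>lborel))"
      unfolding h_def C2_def using \<kappa> \<gamma> by (intro add_mono mult_left_mono stop_fun_integral) auto
    also have "\<dots> = ennreal C1 * ennreal (C2 / (\<kappa> * sqrt 2 ^ j)) * ((\<integral>\<^sup>+ x. g x * Mx u x \<partial>lborel) + (\<integral>\<^sup>+ x. g x * Mx (Mx u) x \<partial>lborel))"
      by (simp only: distrib_left mult.assoc)
    also have "ennreal C1 * ennreal (C2 / (\<kappa> * sqrt 2 ^ j)) = ennreal (C1 * C2 / \<kappa> * (1 / sqrt 2) ^ j)"
      using C1 \<kappa> by (simp add: C2_def power_divide flip: ennreal_mult)
    finally show "(\<integral>\<^sup>+ x. \<integral>\<^sup>+ y. ?A j x y + ?B j x y \<partial>lborel \<partial>lborel)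
      \<le> ennreal (C1 * C2 / \<kappa> * (1 / sqrt 2) ^ j) * ((\<integral>\<^sup>+ x. g x * Mx u x \<partial>lborel) + (\<integral>\<^sup>+ x. g x * Mx (Mx u) x \<partial>lborel))" .
  qed auto
  also have "\<dots> = ennreal (C1 * C2 / \<kappa> / (1 - 1 / sqrt 2)) * ((\<integral>\<^sup>+ x. g x * Mx u x \<partial>lborel) + (\<integral>\<^sup>+ x. g x * Mx (Mx u) x \<partial>lborel))"
    using s2 \<kappa> C1 by (subst ennreal_suminf_multc, subst powr_suminf_ennreal) (auto simp: C2_def)
  also have "C1 * C2 / \<kappa> / (1 - 1 / sqrt 2) = C / lam"
    using lam s2 by (simp add: C_def C1_def C2_def \<kappa>_def)
  finally show "(\<integral>\<^sup>+ x. \<integral>\<^sup>+ y. u x * (indicator (Dset lam \<gamma> 1 f) (x, y)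
       * indicator {y. 1 / ?N \<le> dist x y \<and> dist x y \<le> ?N} y * ?k x y) \<partial>lborel \<partial>lborel)
     \<le> ennreal (C / lam) * ((\<integral>\<^sup>+ x. g x * Mx u x \<partial>lborel) + (\<integral>\<^sup>+ x. g x * Mx (Mx u) x \<partial>lborel))" .
qed measurable

section \<open>Negative exponents with the maximal operator bounded on the space\<close>

lemma half_series_Mx:
  assumes "0 < r"
  shows "(\<Sum>j. ennreal ((1/2) ^ Suc j) * avg x (r / 2 ^ j) g) \<le> Mx g x"
proof -
  have "(\<Sum>j. ennreal ((1/2) ^ Suc j) * avg x (r / 2 ^ j) g) \<le> (\<Sum>j. ennreal (1/2 * (1/2) ^ j) * Mx g x)"
    using assms by (intro suminf_le mult_mono avg_le_Mx) auto
  also have "\<dots> = Mx g x"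
    by (subst ennreal_suminf_multc, subst powr_suminf_ennreal) auto
  finally show ?thesis .
qed

text \<open>All averages in \<open>pair_bound\<close> are at most M g, and the weights 2^(-j-1) sum
  to 1. In \<kappa> the 2 accounts for the two points of the pair, and 4^n is the constant of
  \<open>pair_bound\<close>.\<close>

lemma Dset_threshold_Mx:
  fixes f :: "'a::euclidean_space \<Rightarrow> real" and g :: "'a \<Rightarrow> ennreal"
  assumes [measurable]: "f \<in> borel_measurable borel" "g \<in> borel_measurable borel" and sb: "seg_bound f g"
    and D: "(x, y) \<in> Dset lam \<gamma> 1 f" and lam: "0 < lam"
  defines "\<kappa> \<equiv> lam / (2 * 4 ^ DIM('a))"
  shows "ennreal (\<kappa> * dist x y powr \<gamma>) < Mx g x \<or> ennreal (\<kappa> * dist x y powr \<gamma>) < Mx g y"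
proof (rule ccontr)
  assume "\<not> ?thesis"
  then have le: "Mx g x \<le> ennreal (\<kappa> * dist x y powr \<gamma>)" "Mx g y \<le> ennreal (\<kappa> * dist x y powr \<gamma>)"
    by (auto simp: not_less)
  define r where "r = dist x y"
  have r: "0 < r" and gt: "\<bar>f x - f y\<bar> / r powr (1 + \<gamma>) > lam" using D by (auto simp: Dset_def r_def)
  have "ennreal \<bar>f x - f y\<bar> \<le> ennreal (4 ^ DIM('a) * r) *
    ((\<Sum>j. ennreal ((1/2) ^ Suc j) * avg x (r / 2 ^ j) g) + (\<Sum>j. ennreal ((1/2) ^ Suc j) * avg y (r / 2 ^ j) g))"
    using r by (intro pair_bound sb) (auto simp: r_def)
  also have "\<dots> \<le> ennreal (4 ^ DIM('a) * r) * (ennreal (\<kappa> * r powr \<gamma>) + ennreal (\<kappa> * r powr \<gamma>))"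
    using r le unfolding r_def
    by (intro mult_left_mono add_mono order_trans[OF half_series_Mx]) auto
  also have "\<dots> = ennreal (4 ^ DIM('a) * r * (\<kappa> * r powr \<gamma> + \<kappa> * r powr \<gamma>))"
    using lam r by (simp add: \<kappa>_def flip: ennreal_plus ennreal_mult)
  also have "4 ^ DIM('a) * r * (\<kappa> * r powr \<gamma> + \<kappa> * r powr \<gamma>) = lam * r powr (1 + \<gamma>)"
    using r by (simp add: \<kappa>_def powr_add field_simps)
  finally have "\<bar>f x - f y\<bar> \<le> lam * r powr (1 + \<gamma>)" using lam by (simp add: ennreal_le_iff)
  then show False using gt r by (simp add: field_simps)
qed

text \<open>The level sets are exteriors of balls, on which the kernel is integrable. No covering is
  made: M falls on \<open>g\<close> as well as on the weight, and
  \<open>level_int_dual_bound\<close> controls the norm of M g by the boundedness of M on X.\<close>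

lemma level_int_bound_neg:
  fixes f :: "'a::euclidean_space \<Rightarrow> real" and g u :: "'a \<Rightarrow> ennreal"
  assumes [measurable]: "f \<in> borel_measurable borel" "g \<in> borel_measurable borel" "u \<in> borel_measurable borel"
    and sb: "seg_bound f g" and lam: "0 < lam" and \<gamma>: "\<gamma> < 0"
  defines "C \<equiv> 4 ^ DIM('a) * omega TYPE('a) / (1 - 2 powr \<gamma>) * (2 * 4 ^ DIM('a))"
  shows "(\<integral>\<^sup>+ x. u x * level_int lam \<gamma> 1 \<gamma> f x \<partial>lborel)
    \<le> ennreal (C / lam) * ((\<integral>\<^sup>+ x. Mx g x * u x \<partial>lborel) + (\<integral>\<^sup>+ x. Mx g x * Mx u x \<partial>lborel))"
proof -
  let ?n = "DIM('a)"
  define \<kappa> where "\<kappa> = lam / (2 * 4 ^ ?n)"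
  have \<kappa>: "0 < \<kappa>" using lam by (simp add: \<kappa>_def)
  define C1 where "C1 = 4 ^ DIM('a) * omega TYPE('a) / (1 - 2 powr \<gamma>)"
  have C1: "0 \<le> C1" using \<gamma> powr_less_mono[of "\<gamma>" 0 2] by (simp add: C1_def)
  define h where "h x = ennreal (1 / \<kappa>) * Mx g x" for x
  have [measurable]: "h \<in> borel_measurable borel" unfolding h_def by measurable
  let ?k = "\<lambda>x y. ennreal (dist x y powr (\<gamma> - real ?n))"
  let ?A = "\<lambda>x y. indicator {y. ennreal (dist x y powr \<gamma>) < h x} y * ?k x y * u x"
  let ?B = "\<lambda>x y. indicator {x. ennreal (dist y x powr \<gamma>) < h y} x * ?k y x * u x"
  have meas_AB [measurable]: "(\<lambda>(x, y). ?A x y) \<in> borel_measurable (lborel \<Otimes>\<^sub>M lborel)"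
    "(\<lambda>(x, y). ?B x y) \<in> borel_measurable (lborel \<Otimes>\<^sub>M lborel)"
    unfolding indicator_def by measurable
  have up: "ennreal (d powr \<gamma>) < h z" if "ennreal (\<kappa> * d powr \<gamma>) < Mx g z" for d z
  proof -
    have "ennreal (1 / \<kappa>) * ennreal (\<kappa> * d powr \<gamma>) < ennreal (1 / \<kappa>) * Mx g z"
      using \<kappa> by (intro ennreal_mult_strict_left_mono that) auto
    moreover have "ennreal (1 / \<kappa>) * ennreal (\<kappa> * d powr \<gamma>) = ennreal (d powr \<gamma>)" using \<kappa> by (simp flip: ennreal_mult)
    ultimately show ?thesis by (simp add: h_def)
  qed
  have "(\<integral>\<^sup>+ x. u x * level_int lam \<gamma> 1 \<gamma> f x \<partial>lborel)
     = (\<integral>\<^sup>+ x. \<integral>\<^sup>+ y. u x * (indicator (Dset lam \<gamma> 1 f) (x, y) * ?k x y) \<partial>lborel \<partial>lborel)"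
    unfolding level_int_def by (intro nn_integral_cong nn_integral_cmult[symmetric]) measurable
  also have "\<dots> \<le> (\<integral>\<^sup>+ x. \<integral>\<^sup>+ y. ?A x y + ?B x y \<partial>lborel \<partial>lborel)"
  proof (intro nn_integral_mono)
    fix x y
    show "u x * (indicator (Dset lam \<gamma> 1 f) (x, y) * ?k x y) \<le> ?A x y + ?B x y"
    proof (cases "(x, y) \<in> Dset lam \<gamma> 1 f")
      case True
      have "ennreal (\<kappa> * dist x y powr \<gamma>) < Mx g x \<or> ennreal (\<kappa> * dist x y powr \<gamma>) < Mx g y"
        unfolding \<kappa>_def by (rule Dset_threshold_Mx[OF _ _ sb True lam]) measurable
      then show ?thesis
      proof
        assume "ennreal (\<kappa> * dist x y powr \<gamma>) < Mx g x"
        from up[OF this] show ?thesis using True by (simp add: mult.commute)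
      next
        assume "ennreal (\<kappa> * dist x y powr \<gamma>) < Mx g y"
        from up[OF this] show ?thesis using True by (simp add: mult.commute dist_commute)
      qed
    qed simp
  qed
  also have "\<dots> = (\<integral>\<^sup>+ x. (\<integral>\<^sup>+ y. ?A x y \<partial>lborel) + (\<integral>\<^sup>+ y. ?B x y \<partial>lborel) \<partial>lborel)"
    by (intro nn_integral_cong nn_integral_add) measurable
  also have "\<dots> = (\<integral>\<^sup>+ x. \<integral>\<^sup>+ y. ?A x y \<partial>lborel \<partial>lborel) + (\<integral>\<^sup>+ x. \<integral>\<^sup>+ y. ?B x y \<partial>lborel \<partial>lborel)"
    by (intro nn_integral_add) measurable
  also have "(\<integral>\<^sup>+ x. \<integral>\<^sup>+ y. ?B x y \<partial>lborel \<partial>lborel) = (\<integral>\<^sup>+ y. \<integral>\<^sup>+ x. ?B x y \<partial>lborel \<partial>lborel)"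
    by (rule lborel_pair.Fubini'[symmetric]) measurable
  also have "\<dots> \<le> (\<integral>\<^sup>+ y. ennreal C1 * (h y * Mx u y) \<partial>lborel)"
    unfolding C1_def by (intro nn_integral_mono kernel_far_level \<gamma>) measurable
  also have "(\<integral>\<^sup>+ x. \<integral>\<^sup>+ y. ?A x y \<partial>lborel \<partial>lborel) \<le> (\<integral>\<^sup>+ x. ennreal C1 * (h x * u x) \<partial>lborel)"
  proof (intro nn_integral_mono)
    fix x
    have "(\<integral>\<^sup>+ y. ?A x y \<partial>lborel) = (\<integral>\<^sup>+ y. indicator {y. ennreal (dist x y powr \<gamma>) < h x} y * ?k x y * 1 \<partial>lborel) * u x"
      by (subst nn_integral_multc[symmetric]) (auto simp: indicator_def)
    also have "\<dots> \<le> (ennreal C1 * (h x * Mx (\<lambda>_. 1) x)) * u x"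
      unfolding C1_def by (intro mult_right_mono kernel_far_level \<gamma>) auto
    finally show "(\<integral>\<^sup>+ y. ?A x y \<partial>lborel) \<le> ennreal C1 * (h x * u x)" by (simp add: Mx_const_1 mult.assoc)
  qed
  finally have "(\<integral>\<^sup>+ x. u x * level_int lam \<gamma> 1 \<gamma> f x \<partial>lborel)
    \<le> (\<integral>\<^sup>+ x. ennreal C1 * (h x * u x) \<partial>lborel) + (\<integral>\<^sup>+ y. ennreal C1 * (h y * Mx u y) \<partial>lborel)"
    by (simp add: add_mono)
  also have "\<dots> = ennreal (C1 * (1 / \<kappa>)) * ((\<integral>\<^sup>+ x. Mx g x * u x \<partial>lborel) + (\<integral>\<^sup>+ x. Mx g x * Mx u x \<partial>lborel))"
  proof -
    have "ennreal (C1 * (1 / \<kappa>)) = ennreal C1 * ennreal (1 / \<kappa>)" using C1 \<kappa> by (intro ennreal_mult) auto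
    then show ?thesis unfolding h_def by (simp add: nn_integral_cmult mult.assoc distrib_left)
  qed
  also have "C1 * (1 / \<kappa>) = C / lam" using lam by (simp add: C_def C1_def \<kappa>_def)
  finally show ?thesis .
qed

section \<open>Exponents below -1 on the line\<close>

text \<open>A Euclidean space of dimension 1 is isometric to \<open>real\<close> but need not be
  that type; the multiples of its only basis vector carry integrals over.\<close>

lemma nn_integral_lborel_line:
  fixes b :: "'a::euclidean_space" and k :: "'a \<Rightarrow> ennreal"
  assumes b: "Basis = {b}" and [measurable]: "k \<in> borel_measurable borel"
  shows "(\<integral>\<^sup>+ x. k x \<partial>lborel) = (\<integral>\<^sup>+ s. k (s *\<^sub>R b) \<partial>lborel)"
proof -
  have b1: "b \<in> Basis" using b by blast
  then have b2: "b \<bullet> b = 1" by (rule inner_same_Basis)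
  have "lborel = distr lborel (borel :: 'a measure) (\<lambda>s. s *\<^sub>R b)"
  proof (rule lborel_eqI)
    fix l u :: 'a assume lu: "\<And>b. b \<in> Basis \<Longrightarrow> l \<bullet> b \<le> u \<bullet> b"
    have "(\<lambda>s. s *\<^sub>R b) -` box l u = {l \<bullet> b<..<u \<bullet> b}" by (auto simp: box_def b b2)
    then have "emeasure (distr lborel borel (\<lambda>s. s *\<^sub>R b)) (box l u) = emeasure lborel {l \<bullet> b<..<u \<bullet> b}"
      by (subst emeasure_distr) auto
    also have "\<dots> = ennreal (\<Prod>b\<in>Basis. (u - l) \<bullet> b)" using lu[OF b1] by (simp add: b inner_diff_left)
    finally show "emeasure (distr lborel borel (\<lambda>s. s *\<^sub>R b)) (box l u) = ennreal (\<Prod>b\<in>Basis. (u - l) \<bullet> b)" .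
  qed simp
  then have "(\<integral>\<^sup>+ x. k x \<partial>lborel) = (\<integral>\<^sup>+ x. k x \<partial>distr lborel borel (\<lambda>s. s *\<^sub>R b))"
    by (rule arg_cong)
  also have "\<dots> = (\<integral>\<^sup>+ s. k (s *\<^sub>R b) \<partial>lborel)"
    by (intro nn_integral_distr) measurable
  finally show ?thesis .
qed

text \<open>In dimension 1 a segment is an interval, so the line integral is already a volume
  integral and no averaging over endpoints is required. The interval is enlarged to a ball about
  \<open>x\<close> because the covering deals with balls.\<close>

lemma seg_bound_line:
  fixes f :: "'a::euclidean_space \<Rightarrow> real" and g :: "'a \<Rightarrow> ennreal"
  assumes dim: "DIM('a) = 1" and [measurable]: "g \<in> borel_measurable borel" and sb: "seg_bound f g"
  shows "ennreal \<bar>f x - f y\<bar> \<le> (\<integral>\<^sup>+ z\<in>cball x (dist x y). g z \<partial>lborel)"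
proof (cases "x = y")
  case False
  obtain b :: 'a where b: "Basis = {b}" using card_1_singletonE[OF dim] by metis
  have "b \<in> Basis" using b by blast
  then have b1: "b \<bullet> b = 1" by (rule inner_same_Basis)
  have rep: "(v \<bullet> b) *\<^sub>R b = v" for v using euclidean_representation[of v] by (simp add: b)
  define c where "c = (y - x) \<bullet> b"
  have cb: "c *\<^sub>R b = y - x" by (simp add: c_def rep)
  have c: "c \<noteq> 0" "\<bar>c\<bar> = dist x y"
  proof -
    show "c \<noteq> 0" using cb False by auto
    have "norm (c *\<^sub>R b) = \<bar>c\<bar>" using b1 by (simp add: norm_eq_sqrt_inner)
    then show "\<bar>c\<bar> = dist x y" by (simp add: cb dist_norm norm_minus_commute)
  qed
  have line: "(x \<bullet> b + c * t) *\<^sub>R b = x + t *\<^sub>R (y - x)" for t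
    by (simp add: scaleR_add_left rep mult.commute flip: cb)
  have "ennreal \<bar>f x - f y\<bar> \<le> ennreal (dist x y) * (\<integral>\<^sup>+ t\<in>{0<..1}. g (x + t *\<^sub>R (y - x)) \<partial>lborel)"
    using sb by (simp add: seg_bound_def abs_minus_commute)
  also have "\<dots> \<le> ennreal \<bar>c\<bar> * (\<integral>\<^sup>+ t. g ((x \<bullet> b + c * t) *\<^sub>R b) * indicator (cball x (dist x y)) ((x \<bullet> b + c * t) *\<^sub>R b) \<partial>lborel)"
    unfolding c(2) line
  proof (intro mult_left_mono nn_integral_mono)
    fix t :: real
    have "dist x (x + t *\<^sub>R (y - x)) \<le> dist x y" if "t \<in> {0<..1}"
      using that mult_right_mono[of t 1 "dist x y"] by (simp add: dist_norm norm_minus_commute)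
    then show "indicator {0<..1} t \<le> (indicator (cball x (dist x y)) (x + t *\<^sub>R (y - x)) :: ennreal)"
      by (auto simp: indicator_def)
  qed auto
  also have "\<dots> = (\<integral>\<^sup>+ s. g (s *\<^sub>R b) * indicator (cball x (dist x y)) (s *\<^sub>R b) \<partial>lborel)"
    by (rule nn_integral_real_affine[symmetric]) (use c in auto)
  also have "\<dots> = (\<integral>\<^sup>+ z\<in>cball x (dist x y). g z \<partial>lborel)"
    by (rule nn_integral_lborel_line[OF b, symmetric]) measurable
  finally show ?thesis .
qed simp

text \<open>The mass lam r^(1+\<gamma>) demanded of a ball grows as r decreases, so the small balls
  have to be kept. The heavy ball of a pair (x, y) has radius |x-y| and meets a selected ball of at
  most twice that radius; hence |x-y| is at least a third of \<open>\<rho> j x\<close>, and the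
  kernel integral over such y is of the order of the power \<gamma> of \<open>\<rho> j x\<close>.
  Integrated against \<open>u\<close> this gives r^(1+\<gamma>) times M u at any point of the
  selected ball: the power of r is that of the demanded mass and cancels.\<close>

lemma level_int_bound_line:
  fixes f :: "'a::euclidean_space \<Rightarrow> real" and g u :: "'a \<Rightarrow> ennreal"
  assumes dim: "DIM('a) = 1"
    and [measurable]: "f \<in> borel_measurable borel" "g \<in> borel_measurable borel" "u \<in> borel_measurable borel"
    and sb: "seg_bound f g" and lam: "0 < lam" and \<gamma>: "\<gamma> < -1"
  defines "C \<equiv> 4 * omega TYPE('a) / (1 - 2 powr \<gamma>) * 3 powr -\<gamma> * (2 * omega TYPE('a) + 4 * omega TYPE('a) / (1 - 2 powr (\<gamma> + 1)))"
  shows "(\<integral>\<^sup>+ x. u x * level_int lam \<gamma> 1 \<gamma> f x \<partial>lborel) \<le> ennreal (C / lam) * (\<integral>\<^sup>+ x. g x * Mx u x \<partial>lborel)"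
proof (rule level_int_truncate)
  fix N0 :: nat
  define N where "N = real (Suc N0)"
  have N: "0 < N" by (simp add: N_def)
  define K where "K = {(x, r). 1 / N \<le> r \<and> r \<le> N \<and> ennreal (lam * r powr (1 + \<gamma>)) < (\<integral>\<^sup>+ z\<in>cball (x::'a) r. g z \<partial>lborel)}"
  have K: "1 / N \<le> snd i \<and> snd i \<le> N" if "i \<in> K" for i using that by (auto simp: K_def)
  obtain J where J: "countable J" "J \<subseteq> K" "pairwise (\<lambda>i j. disjnt (cball (fst i) (snd i)) (cball (fst j) (snd j))) J"
    "\<And>i. i \<in> K \<Longrightarrow> \<exists>j\<in>J. \<not> disjnt (cball (fst i) (snd i)) (cball (fst j) (snd j)) \<and> snd j \<le> 2 * snd i"
    by (rule reverse_Vitali[of "1 / N" K snd N fst]) (use N K in auto)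
  define \<rho> where "\<rho> j x = max (snd j) (dist (fst j) x)" for j :: "'a \<times> real" and x
  have [measurable]: "\<rho> j \<in> borel_measurable borel" for j unfolding \<rho>_def by measurable
  define C1 where "C1 = 4 * omega TYPE('a) / (1 - 2 powr \<gamma>) * 3 powr -\<gamma>"
  define C2 where "C2 = 2 * omega TYPE('a) + 4 * omega TYPE('a) / (1 - 2 powr (\<gamma> + 1))"
  have C12: "0 \<le> C1" "0 \<le> C2" using \<gamma> powr_less_mono[of "\<gamma>" 0 2] powr_less_mono[of "\<gamma> + 1" 0 2] by (auto simp: C1_def C2_def)
  let ?k = "\<lambda>x y. ennreal (dist x y powr (\<gamma> - real DIM('a)))"
  let ?E = "\<lambda>x. {y. 1 / N \<le> dist x y \<and> dist x y \<le> N}"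
  have "(\<integral>\<^sup>+ x. \<integral>\<^sup>+ y. u x * (indicator (Dset lam \<gamma> 1 f) (x, y) * indicator (?E x) y * ?k x y) \<partial>lborel \<partial>lborel)
    \<le> (\<integral>\<^sup>+ x. \<integral>\<^sup>+ j. ennreal C1 * (ennreal (\<rho> j x powr \<gamma>) * u x) \<partial>count_space J \<partial>lborel)"
  proof (intro nn_integral_mono)
    fix x
    have "(\<integral>\<^sup>+ y. u x * (indicator (Dset lam \<gamma> 1 f) (x, y) * indicator (?E x) y * ?k x y) \<partial>lborel)
      \<le> (\<integral>\<^sup>+ y. \<integral>\<^sup>+ j. u x * (indicator (- ball x (\<rho> j x / 3)) y * ?k x y * 1) \<partial>count_space J \<partial>lborel)"
    proof (intro nn_integral_mono)
      fix y
      show "u x * (indicator (Dset lam \<gamma> 1 f) (x, y) * indicator (?E x) y * ?k x y)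
        \<le> (\<integral>\<^sup>+ j. u x * (indicator (- ball x (\<rho> j x / 3)) y * ?k x y * 1) \<partial>count_space J)"
      proof (cases "(x, y) \<in> Dset lam \<gamma> 1 f \<and> y \<in> ?E x")
        case True
        then have r: "0 < dist x y" and gt: "\<bar>f x - f y\<bar> / dist x y powr (1 + \<gamma>) > lam" by (auto simp: Dset_def)
        have "lam * dist x y powr (1 + \<gamma>) < \<bar>f x - f y\<bar>" using gt r by (simp add: field_simps)
        then have "ennreal (lam * dist x y powr (1 + \<gamma>)) < ennreal \<bar>f x - f y\<bar>"
          using lam by (subst ennreal_less_iff) auto
        also have "\<dots> \<le> (\<integral>\<^sup>+ z\<in>cball x (dist x y). g z \<partial>lborel)" by (rule seg_bound_line[OF dim _ sb]) measurable
        finally have i: "(x, dist x y) \<in> K" using True by (auto simp: K_def)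
        obtain j where j: "j \<in> J" "\<not> disjnt (cball x (dist x y)) (cball (fst j) (snd j))" "snd j \<le> 2 * dist x y"
          using J(4)[OF i] by auto
        have "dist (fst j) x \<le> dist x y + snd j"
        proof -
          obtain z where "dist x z \<le> dist x y" "dist (fst j) z \<le> snd j" using j(2) by (auto simp: disjnt_def)
          then show ?thesis using dist_triangle[of "fst j" x z] by (simp add: dist_commute)
        qed
        then have "dist (fst j) x \<le> 3 * dist x y" "snd j \<le> 3 * dist x y" using j(3) r by linarith+
        then have "\<rho> j x \<le> 3 * dist x y" by (simp add: \<rho>_def)
        then have "u x * (indicator (Dset lam \<gamma> 1 f) (x, y) * indicator (?E x) y * ?k x y)
          = u x * (indicator (- ball x (\<rho> j x / 3)) y * ?k x y * 1)" using True by simp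
        also have "\<dots> \<le> (\<integral>\<^sup>+ j. u x * (indicator (- ball x (\<rho> j x / 3)) y * ?k x y * 1) \<partial>count_space J)"
          using j(1) by (rule nn_integral_ge_point)
        finally show ?thesis .
      qed (auto simp: indicator_def)
    qed
    also have "\<dots> = (\<integral>\<^sup>+ j. \<integral>\<^sup>+ y. u x * (indicator (- ball x (\<rho> j x / 3)) y * ?k x y * 1) \<partial>lborel \<partial>count_space J)"
      by (rule nn_integral_count_space_nn_integral) (use J in measurable)
    also have "\<dots> \<le> (\<integral>\<^sup>+ j. ennreal C1 * (ennreal (\<rho> j x powr \<gamma>) * u x) \<partial>count_space J)"
    proof (intro nn_integral_mono)
      fix j assume "j \<in> space (count_space J)"
      then have "j \<in> K" using J(2) by auto
      then have "1 / N \<le> snd j" using K by blast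
      moreover have "0 < 1 / N" using N by simp
      ultimately have "0 < snd j" by linarith
      then have \<rho>: "0 < \<rho> j x" by (simp add: \<rho>_def)
      have "(\<integral>\<^sup>+ y. u x * (indicator (- ball x (\<rho> j x / 3)) y * ?k x y * 1) \<partial>lborel)
         = u x * (\<integral>\<^sup>+ y. indicator (- ball x (\<rho> j x / 3)) y * ?k x y * 1 \<partial>lborel)"
        by (intro nn_integral_cmult) measurable
      also have "\<dots> \<le> u x * (ennreal (4 ^ DIM('a) * omega TYPE('a) / (1 - 2 powr \<gamma>) * (\<rho> j x / 3) powr \<gamma>) * Mx (\<lambda>_. 1) x)"
        using \<rho> \<gamma> by (intro mult_left_mono kernel_far) auto
      also have "4 ^ DIM('a) * omega TYPE('a) / (1 - 2 powr \<gamma>) * (\<rho> j x / 3) powr \<gamma> = C1 * \<rho> j x powr \<gamma>"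
        using \<rho> by (simp add: C1_def dim powr_divide powr_minus field_simps)
      also have "u x * (ennreal (C1 * \<rho> j x powr \<gamma>) * Mx (\<lambda>_. 1) x) = ennreal C1 * (ennreal (\<rho> j x powr \<gamma>) * u x)"
        using C12 by (simp add: Mx_const_1 ennreal_mult mult_ac)
      finally show "(\<integral>\<^sup>+ y. u x * (indicator (- ball x (\<rho> j x / 3)) y * ?k x y * 1) \<partial>lborel)
        \<le> ennreal C1 * (ennreal (\<rho> j x powr \<gamma>) * u x)" .
    qed
    finally show "(\<integral>\<^sup>+ y. u x * (indicator (Dset lam \<gamma> 1 f) (x, y) * indicator (?E x) y * ?k x y) \<partial>lborel)
      \<le> (\<integral>\<^sup>+ j. ennreal C1 * (ennreal (\<rho> j x powr \<gamma>) * u x) \<partial>count_space J)" .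
  qed
  also have "\<dots> = (\<integral>\<^sup>+ j. \<integral>\<^sup>+ x. ennreal C1 * (ennreal (\<rho> j x powr \<gamma>) * u x) \<partial>lborel \<partial>count_space J)"
    by (rule nn_integral_count_space_nn_integral) (use J in measurable)
  also have "\<dots> \<le> (\<integral>\<^sup>+ j. ennreal (C / lam) * (\<integral>\<^sup>+ z\<in>cball (fst j) (snd j). g z * Mx u z \<partial>lborel) \<partial>count_space J)"
  proof (intro nn_integral_mono)
    fix j assume "j \<in> space (count_space J)"
    then have jK: "j \<in> K" using J(2) by auto
    define r where "r = snd j"
    have "0 < 1 / N" using N by simp
    then have r: "0 < r" using K[OF jK] unfolding r_def by linarith
    have "(\<integral>\<^sup>+ x. ennreal (\<rho> j x powr \<gamma>) * u x \<partial>lborel)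
       \<le> ennreal (C2 * r powr (1 + \<gamma>) / (lam * r powr (1 + \<gamma>))) * (\<integral>\<^sup>+ z\<in>cball (fst j) r. g z * Mx u z \<partial>lborel)"
    proof (rule ball_mass_transfer)
      show "ennreal (lam * r powr (1 + \<gamma>)) \<le> (\<integral>\<^sup>+ z\<in>cball (fst j) r. g z \<partial>lborel)"
        using jK by (auto simp: K_def r_def less_imp_le)
      \<comment> \<open>Outside the ball the power \<gamma> of the distance is the radial kernel
        with exponent \<gamma> + 1, because the dimension is 1; \<gamma> < -1 makes it integrable at
        infinity.\<close>
      fix z assume z: "z \<in> cball (fst j) r"
      have "(\<integral>\<^sup>+ x. ennreal (\<rho> j x powr \<gamma>) * u x \<partial>lborel)
        \<le> (\<integral>\<^sup>+ x. ennreal (r powr \<gamma>) * (u x * indicator (ball (fst j) r) x)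
            + indicator (- ball (fst j) r) x * ennreal (dist (fst j) x powr ((\<gamma> + 1) - DIM('a))) * u x \<partial>lborel)"
        by (intro nn_integral_mono) (auto simp: \<rho>_def r_def indicator_def dim max_def mult_ac)
      also have "\<dots> = ennreal (r powr \<gamma>) * (\<integral>\<^sup>+ x\<in>ball (fst j) r. u x \<partial>lborel)
          + (\<integral>\<^sup>+ x. indicator (- ball (fst j) r) x * ennreal (dist (fst j) x powr ((\<gamma> + 1) - DIM('a))) * u x \<partial>lborel)"
        by (subst nn_integral_add) (auto simp: nn_integral_cmult)
      also have "\<dots> \<le> ennreal (r powr \<gamma>) * (ennreal (omega TYPE('a) * (2 * r) ^ DIM('a)) * Mx u z)
          + ennreal (4 ^ DIM('a) * omega TYPE('a) / (1 - 2 powr (\<gamma> + 1)) * r powr (\<gamma> + 1)) * Mx u z"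
      proof (intro add_mono mult_left_mono ball_integral_le_Mx kernel_far)
        show "ball (fst j) r \<subseteq> ball z (2 * r)"
        proof
          fix y assume "y \<in> ball (fst j) r"
          then show "y \<in> ball z (2 * r)" using z dist_triangle[of z y "fst j"] by (simp add: dist_commute)
        qed
      qed (use r \<gamma> z in auto)
      also have "\<dots> = (ennreal (r powr \<gamma> * (omega TYPE('a) * (2 * r) ^ DIM('a)))
          + ennreal (4 ^ DIM('a) * omega TYPE('a) / (1 - 2 powr (\<gamma> + 1)) * r powr (\<gamma> + 1))) * Mx u z"
        using r by (simp only: distrib_right) (simp add: ennreal_mult mult.assoc)
      also have "ennreal (r powr \<gamma> * (omega TYPE('a) * (2 * r) ^ DIM('a)))
          + ennreal (4 ^ DIM('a) * omega TYPE('a) / (1 - 2 powr (\<gamma> + 1)) * r powr (\<gamma> + 1)) = ennreal (C2 * r powr (1 + \<gamma>))"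
        using r \<gamma> powr_less_mono[of "\<gamma> + 1" 0 2]
        by (subst ennreal_plus[symmetric]) (auto simp: C2_def dim powr_add algebra_simps)
      finally show "(\<integral>\<^sup>+ x. ennreal (\<rho> j x powr \<gamma>) * u x \<partial>lborel) \<le> ennreal (C2 * r powr (1 + \<gamma>)) * Mx u z" .
    next
      show "0 < lam * r powr (1 + \<gamma>)" "0 \<le> C2 * r powr (1 + \<gamma>)" using r lam C12 by auto
    qed measurable
    also have "C2 * r powr (1 + \<gamma>) / (lam * r powr (1 + \<gamma>)) = C2 / lam" using r by simp
    finally have "ennreal C1 * (\<integral>\<^sup>+ x. ennreal (\<rho> j x powr \<gamma>) * u x \<partial>lborel)
      \<le> ennreal C1 * (ennreal (C2 / lam) * (\<integral>\<^sup>+ z\<in>cball (fst j) r. g z * Mx u z \<partial>lborel))"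
      by (intro mult_left_mono) auto
    also have "\<dots> = ennreal (C / lam) * (\<integral>\<^sup>+ z\<in>cball (fst j) r. g z * Mx u z \<partial>lborel)"
      using C12 lam by (simp add: C_def C1_def C2_def mult.assoc[symmetric] flip: ennreal_mult)
    finally show "(\<integral>\<^sup>+ x. ennreal C1 * (ennreal (\<rho> j x powr \<gamma>) * u x) \<partial>lborel)
      \<le> ennreal (C / lam) * (\<integral>\<^sup>+ z\<in>cball (fst j) (snd j). g z * Mx u z \<partial>lborel)"
      by (subst nn_integral_cmult) (auto simp: r_def)
  qed
  also have "\<dots> = ennreal (C / lam) * (\<integral>\<^sup>+ j. (\<integral>\<^sup>+ z\<in>cball (fst j) (snd j). g z * Mx u z \<partial>lborel) \<partial>count_space J)"
    by (intro nn_integral_cmult) auto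
  also have "\<dots> \<le> ennreal (C / lam) * (\<integral>\<^sup>+ x. g x * Mx u x \<partial>lborel)"
    using J(3) by (intro mult_left_mono sum_disjoint_integrals J(1)) (auto simp: pairwise_def)
  finally show "(\<integral>\<^sup>+ x. \<integral>\<^sup>+ y. u x * (indicator (Dset lam \<gamma> 1 f) (x, y)
       * indicator {y. 1 / real (Suc N0) \<le> dist x y \<and> dist x y \<le> real (Suc N0)} y * ?k x y) \<partial>lborel \<partial>lborel)
     \<le> ennreal (C / lam) * (\<integral>\<^sup>+ x. g x * Mx u x \<partial>lborel)"
    by (simp only: N_def)
qed measurable

section \<open>The endpoint estimate\<close>

lemma Mx_cmult:
  fixes u :: "'a::euclidean_space \<Rightarrow> ennreal"
  assumes [measurable]: "u \<in> borel_measurable borel"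
  shows "Mx (\<lambda>y. c * u y) x = c * Mx u x"
proof -
  have "avg x r (\<lambda>y. c * u y) = c * avg x r u" for r
    unfolding avg_def by (simp add: mult.assoc nn_integral_cmult ennreal_times_divide)
  then show ?thesis unfolding Mx_def by (simp add: SUP_mult_left_ennreal)
qed

locale maximal_norm = function_norm N for N :: "('a::euclidean_space \<Rightarrow> ennreal) \<Rightarrow> ennreal" +
  fixes L :: real
  assumes L_pos: "0 < L"
    and dual_Mx: "\<And>u. u \<in> borel_measurable borel \<Longrightarrow> dual_le u 1 \<Longrightarrow> dual_le (Mx u) (ennreal L)"
begin

text \<open>\<open>dual_Mx\<close> is stated for the dual unit ball only, so M u is divided by
  \<open>L\<close> before the operator is applied a second time.\<close>

lemma dual_Mx_Mx:
  assumes [measurable]: "u \<in> borel_measurable borel" and u: "dual_le u 1"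
  shows "dual_le (Mx (Mx u)) (ennreal (L * L))"
  unfolding dual_le_def
proof (intro ballI impI)
  fix h :: "'a \<Rightarrow> ennreal" assume [measurable]: "h \<in> borel_measurable borel" and h: "N h \<le> 1"
  define v where "v x = ennreal (1 / L) * Mx u x" for x
  have [measurable]: "v \<in> borel_measurable borel" unfolding v_def by measurable
  have inv: "ennreal L * ennreal (1 / L) = 1" "ennreal (1 / L) * ennreal L = 1" using L_pos by (auto simp flip: ennreal_mult)
  have "dual_le v 1"
    unfolding dual_le_def
  proof (intro ballI impI)
    fix k :: "'a \<Rightarrow> ennreal" assume [measurable]: "k \<in> borel_measurable borel" and k: "N k \<le> 1"
    have "(\<integral>\<^sup>+x. v x * k x \<partial>lborel) = ennreal (1 / L) * (\<integral>\<^sup>+x. Mx u x * k x \<partial>lborel)"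
      unfolding v_def by (simp add: mult.assoc nn_integral_cmult)
    also have "\<dots> \<le> ennreal (1 / L) * ennreal L"
      using dual_Mx[OF _ u] k by (intro mult_left_mono) (auto simp: dual_le_def)
    finally show "(\<integral>\<^sup>+x. v x * k x \<partial>lborel) \<le> 1" by (simp only: inv)
  qed
  then have "dual_le (Mx v) (ennreal L)" by (intro dual_Mx) auto
  then have "(\<integral>\<^sup>+x. Mx v x * h x \<partial>lborel) \<le> ennreal L" using h by (auto simp: dual_le_def)
  moreover have "Mx v x = ennreal (1 / L) * Mx (Mx u) x" for x unfolding v_def by (intro Mx_cmult) measurable
  ultimately have "ennreal (1 / L) * (\<integral>\<^sup>+x. Mx (Mx u) x * h x \<partial>lborel) \<le> ennreal L"
    by (simp add: mult.assoc nn_integral_cmult)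
  then have "ennreal L * (ennreal (1 / L) * (\<integral>\<^sup>+x. Mx (Mx u) x * h x \<partial>lborel)) \<le> ennreal L * ennreal L"
    by (intro mult_left_mono) auto
  then show "(\<integral>\<^sup>+x. Mx (Mx u) x * h x \<partial>lborel) \<le> ennreal (L * L)"
    using L_pos by (simp add: mult.assoc[symmetric] inv ennreal_mult)
qed

text \<open>The bound is stated against weights and not for the norm, because for Sobolev functions
  the limit of the mollified functions is taken inside these integrals before
  \<open>Lorentz_Luxemburg\<close> is applied.\<close>

lemma level_int_dual_bound:
  assumes \<gamma>: "\<gamma> \<noteq> 0"
    and neg: "\<gamma> < 0 \<Longrightarrow> (\<exists>A>0. \<forall>g\<in>borel_measurable borel. N g < \<infinity> \<longrightarrow> N (Mx g) \<le> ennreal A * N g) \<or> (DIM('a) = 1 \<and> \<gamma> < -1)"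
  shows "\<exists>C>0. \<forall>lam>0. \<forall>f g u. f \<in> borel_measurable borel \<longrightarrow> g \<in> borel_measurable borel \<longrightarrow> u \<in> borel_measurable borel
     \<longrightarrow> seg_bound f g \<longrightarrow> N g < \<infinity> \<longrightarrow> dual_le u 1 \<longrightarrow>
     (\<integral>\<^sup>+ x. u x * level_int lam \<gamma> 1 \<gamma> f x \<partial>lborel) \<le> ennreal (C / lam) * N g"
proof -
  have Mu: "(\<integral>\<^sup>+ x. g x * Mx u x \<partial>lborel) \<le> ennreal L * N g" if "g \<in> borel_measurable borel" "u \<in> borel_measurable borel" "dual_le u 1" "N g < \<infinity>" for g u
    using dual_le_D[OF dual_Mx[of u] _ that(1,4)] that by (simp add: mult.commute)
  have MMu: "(\<integral>\<^sup>+ x. g x * Mx (Mx u) x \<partial>lborel) \<le> ennreal (L * L) * N g" if "g \<in> borel_measurable borel" "u \<in> borel_measurable borel" "dual_le u 1" "N g < \<infinity>" for g u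
    using dual_le_D[OF dual_Mx_Mx[of u] _ that(1,4)] that by (simp add: mult.commute)
  have one: "(\<integral>\<^sup>+ x. g x * u x \<partial>lborel) \<le> N g" if "g \<in> borel_measurable borel" "u \<in> borel_measurable borel" "dual_le u 1" "N g < \<infinity>" for g u
    using dual_le_D[of u 1 g] that by (simp add: mult.commute)
  have scale: "x \<le> ennreal (C * b / lam) * n" if "x \<le> ennreal (C / lam) * (y + z)" "y \<le> ennreal b1 * n" "z \<le> ennreal b2 * n" "b = b1 + b2" "0 \<le> b1" "0 \<le> b2" "0 < C" "0 < lam"
    for x y z n C b lam b1 b2
  proof -
    have "y + z \<le> ennreal b * n"
      using add_mono[OF that(2,3)] that(4-6) by (simp add: ennreal_plus distrib_right)
    then have "x \<le> ennreal (C / lam) * (ennreal b * n)" by (intro order_trans[OF that(1)] mult_left_mono) auto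
    also have "\<dots> = ennreal (C / lam) * ennreal b * n" by (simp only: mult.assoc)
    also have "ennreal (C / lam) * ennreal b = ennreal (C * b / lam)"
    proof -
      have "0 \<le> b" "0 \<le> C / lam" using that(4-8) by auto
      then show ?thesis by (simp flip: ennreal_mult)
    qed
    finally show ?thesis .
  qed
  have s2: "sqrt 2 < 2" "1 < sqrt 2" using real_sqrt_less_mono[of 2 4] by auto
  consider "0 < \<gamma>" | A where "\<gamma> < 0" "0 < A" "\<And>g. g\<in>borel_measurable borel \<Longrightarrow> N g < \<infinity> \<Longrightarrow> N (Mx g) \<le> ennreal A * N g"
    | "DIM('a) = 1" "\<gamma> < -1"
    using \<gamma> neg by (metis linorder_neqE)
  then show ?thesis
  proof cases
    case 1
    define C where "C = 2 powr \<gamma> * (2 ^ DIM('a) * omega TYPE('a) / (1 - 2 powr -\<gamma>)) * (5 powr \<gamma> * 6 ^ DIM('a)) * 4 ^ DIM('a)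
      / (1 - sqrt 2 / 2) / (1 - 1 / sqrt 2)"
    have "0 < 1 - 2 powr -\<gamma>" using powr_less_mono[of "-\<gamma>" 0 2] 1 by simp
    moreover have "0 < 1 - sqrt 2 / 2" "0 < 1 - 1 / sqrt 2" using s2 by auto
    ultimately have C: "0 < C" unfolding C_def using omega_pos[where 'a='a] by (intro mult_pos_pos divide_pos_pos) auto
    show ?thesis
    proof (intro exI[of _ "C * (L + L * L)"] conjI allI impI)
      show "0 < C * (L + L * L)" using C L_pos by (simp add: add_pos_pos)
      fix lam :: real and f :: "'a \<Rightarrow> real" and g u :: "'a \<Rightarrow> ennreal"
      assume *: "0 < lam" "f \<in> borel_measurable borel" "g \<in> borel_measurable borel" "u \<in> borel_measurable borel" "seg_bound f g" "N g < \<infinity>" "dual_le u 1"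
      show "(\<integral>\<^sup>+ x. u x * level_int lam \<gamma> 1 \<gamma> f x \<partial>lborel) \<le> ennreal (C * (L + L * L) / lam) * N g"
        by (rule scale[OF level_int_bound_pos[OF *(2,3,4,5,1) 1, folded C_def] Mu[OF *(3,4,7,6)] MMu[OF *(3,4,7,6)]])
           (use C L_pos * in auto)
    qed
  next
    case (2 A)
    define C where "C = 4 ^ DIM('a) * omega TYPE('a) / (1 - 2 powr \<gamma>) * (2 * 4 ^ DIM('a))"
    have "0 < 1 - 2 powr \<gamma>" using powr_less_mono[of "\<gamma>" 0 2] 2 by simp
    then have C: "0 < C" unfolding C_def using omega_pos[where 'a='a] by (intro mult_pos_pos divide_pos_pos) auto
    show ?thesis
    proof (intro exI[of _ "C * (A + L * A)"] conjI allI impI)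
      show "0 < C * (A + L * A)" using C L_pos 2 by (simp add: add_pos_pos)
      fix lam :: real and f :: "'a \<Rightarrow> real" and g u :: "'a \<Rightarrow> ennreal"
      assume *: "0 < lam" "f \<in> borel_measurable borel" "g \<in> borel_measurable borel" "u \<in> borel_measurable borel" "seg_bound f g" "N g < \<infinity>" "dual_le u 1"
      have NM: "N (Mx g) \<le> ennreal A * N g" using 2 * by blast
      then have fin: "N (Mx g) < \<infinity>" using *(6) by (auto simp: ennreal_mult_less_top intro: le_less_trans)
      have m: "Mx g \<in> borel_measurable borel" using * by measurable
      have b1: "(\<integral>\<^sup>+ x. Mx g x * u x \<partial>lborel) \<le> ennreal A * N g"
        using one[OF m *(4,7) fin] NM by (rule order_trans)
      have "(\<integral>\<^sup>+ x. Mx g x * Mx u x \<partial>lborel) \<le> ennreal L * (ennreal A * N g)"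
        using Mu[OF m *(4,7) fin] mult_left_mono[OF NM] by (rule order_trans) simp
      then have b2: "(\<integral>\<^sup>+ x. Mx g x * Mx u x \<partial>lborel) \<le> ennreal (L * A) * N g"
        using L_pos 2 by (simp add: ennreal_mult mult.assoc)
      show "(\<integral>\<^sup>+ x. u x * level_int lam \<gamma> 1 \<gamma> f x \<partial>lborel) \<le> ennreal (C * (A + L * A) / lam) * N g"
        by (rule scale[OF level_int_bound_neg[OF *(2,3,4,5,1) 2(1), folded C_def] b1 b2])
           (use C L_pos * 2 in auto)
    qed
  next
    case 3
    define C where "C = 4 * omega TYPE('a) / (1 - 2 powr \<gamma>) * 3 powr -\<gamma> * (2 * omega TYPE('a) + 4 * omega TYPE('a) / (1 - 2 powr (\<gamma> + 1)))"
    have "0 < 1 - 2 powr \<gamma>" "0 < 1 - 2 powr (\<gamma> + 1)" using powr_less_mono[of "\<gamma>" 0 2] powr_less_mono[of "\<gamma> + 1" 0 2] 3 by auto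
    then have C: "0 < C" unfolding C_def using omega_pos[where 'a='a] by (intro mult_pos_pos divide_pos_pos add_pos_pos) auto
    show ?thesis
    proof (intro exI[of _ "C * L"] conjI allI impI)
      show "0 < C * L" using C L_pos by simp
      fix lam :: real and f :: "'a \<Rightarrow> real" and g u :: "'a \<Rightarrow> ennreal"
      assume *: "0 < lam" "f \<in> borel_measurable borel" "g \<in> borel_measurable borel" "u \<in> borel_measurable borel" "seg_bound f g" "N g < \<infinity>" "dual_le u 1"
      have "(\<integral>\<^sup>+ x. u x * level_int lam \<gamma> 1 \<gamma> f x \<partial>lborel) \<le> ennreal (C / lam) * ((\<integral>\<^sup>+ x. g x * Mx u x \<partial>lborel) + 0)"
        using level_int_bound_line[OF 3(1) *(2,3,4,5,1) 3(2), folded C_def] by simp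
      then show "(\<integral>\<^sup>+ x. u x * level_int lam \<gamma> 1 \<gamma> f x \<partial>lborel) \<le> ennreal (C * L / lam) * N g"
        by (rule scale[of _ C lam _ 0 L _ 0 L, OF _ Mu[OF *(3,4,7,6)]]) (use C L_pos * in auto)
    qed
  qed
qed

end

section \<open>Mollification\<close>

text \<open>The factor t^(-k) is carried along because the derivative of exp(-1/t) t^(-k) is a
  combination of the same expressions with k + 2 and k + 1, so that the linear span of the family is
  closed under differentiation.\<close>

definition psi :: "nat \<Rightarrow> real \<Rightarrow> real" where
  "psi k t = (if 0 < t then exp (- inverse t) * inverse t ^ k else 0)"

lemma psi_tendsto_0: "(psi k \<longlongrightarrow> 0) (at 0)"
  unfolding filterlim_at_split
proof
  have "\<forall>\<^sub>F t in at_left (0::real). psi k t = 0"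
    by (auto simp: psi_def eventually_at_filter intro!: always_eventually)
  then show "(psi k \<longlongrightarrow> 0) (at_left 0)" by (rule tendsto_eventually)
  have "((\<lambda>x::real. x ^ k / exp x) \<longlongrightarrow> 0) at_top" by (rule tendsto_power_div_exp_0)
  then have "((\<lambda>t::real. inverse t ^ k / exp (inverse t)) \<longlongrightarrow> 0) (at_right 0)"
    by (rule filterlim_compose) (rule filterlim_inverse_at_top_right)
  moreover have "\<forall>\<^sub>F t in at_right (0::real). inverse t ^ k / exp (inverse t) = psi k t"
    by (auto simp: psi_def eventually_at_filter exp_minus field_simps intro!: always_eventually)
  ultimately show "(psi k \<longlongrightarrow> 0) (at_right 0)" by (rule Lim_transform_eventually)
qed

lemma psi_deriv: "(psi k has_real_derivative psi (k + 2) t - real k * psi (k + 1) t) (at t)"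
proof -
  consider "t < 0" | "t = 0" | "0 < t" by linarith
  then show ?thesis
  proof cases
    case 1
    have "((\<lambda>_. 0) has_real_derivative 0) (at t)" by simp
    then have "(psi k has_real_derivative 0) (at t)"
      by (rule has_field_derivative_transform_within_open[where S="{..<0}"]) (use 1 in \<open>auto simp: psi_def\<close>)
    then show ?thesis using 1 by (simp add: psi_def)
  next
    case 2
    \<comment> \<open>At 0 the difference quotient of \<open>psi k\<close> is
      \<open>psi (k + 1)\<close>, so \<open>psi_tendsto_0\<close> gives the derivative
      there.\<close>
    have "\<forall>\<^sub>F h in at (0::real). psi (k + 1) h = (psi k (0 + h) - psi k 0) / h"
      by (auto simp: psi_def eventually_at_filter field_simps intro!: always_eventually)
    with psi_tendsto_0[of "k + 1"] have "((\<lambda>h. (psi k (0 + h) - psi k 0) / h) \<longlongrightarrow> 0) (at 0)"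
      by (rule Lim_transform_eventually)
    then show ?thesis using 2 by (simp add: DERIV_def psi_def)
  next
    case 3
    have "((\<lambda>t. exp (- inverse t) * inverse t ^ k) has_real_derivative
       exp (- inverse t) * inverse t ^ (k + 2) - real k * (exp (- inverse t) * inverse t ^ (k + 1))) (at t)"
    proof -
      have inv: "(inverse has_real_derivative - (inverse t ^ Suc (Suc 0))) (at t)"
        using 3 DERIV_inverse[of t UNIV] by simp
      have pow: "((\<lambda>t. inverse t ^ k) has_real_derivative - real k * inverse t ^ (k + 1)) (at t)"
        by (rule DERIV_cong[OF DERIV_power[OF inv]]) (cases k; simp add: algebra_simps)
      have exp: "((\<lambda>t. exp (- inverse t)) has_real_derivative exp (- inverse t) * inverse t ^ Suc (Suc 0)) (at t)"
        using DERIV_fun_exp[OF DERIV_minus[OF inv]] by simp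
      show ?thesis
        by (rule DERIV_cong[OF DERIV_mult[OF exp pow]]) (simp add: algebra_simps)
    qed
    then have "(psi k has_real_derivative
       exp (- inverse t) * inverse t ^ (k + 2) - real k * (exp (- inverse t) * inverse t ^ (k + 1))) (at t)"
      by (rule has_field_derivative_transform_within_open[where S="{0<..}"]) (use 3 in \<open>auto simp: psi_def\<close>)
    then show ?thesis using 3 by (simp add: psi_def)
  qed
qed

text \<open>A class of functions that contains the bump functions and is closed under partial derivatives;
  it is the invariant of the coinduction that shows the bumps to be smooth.\<close>

inductive bump_class :: "'a::euclidean_space \<Rightarrow> real \<Rightarrow> ('a \<Rightarrow> real) \<Rightarrow> bool" for c \<kappa> where
  base: "bump_class c \<kappa> (\<lambda>x. psi k (1 - \<kappa> * ((x - c) \<bullet> (x - c))))"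
| add: "bump_class c \<kappa> u \<Longrightarrow> bump_class c \<kappa> v \<Longrightarrow> bump_class c \<kappa> (\<lambda>x. u x + v x)"
| cmult: "bump_class c \<kappa> u \<Longrightarrow> bump_class c \<kappa> (\<lambda>x. a * u x)"
| coord: "bump_class c \<kappa> u \<Longrightarrow> i \<in> Basis \<Longrightarrow> bump_class c \<kappa> (\<lambda>x. ((x - c) \<bullet> i) * u x)"

lemma bump_class_gradient:
  assumes "bump_class c \<kappa> u"
  shows "\<exists>G. (\<forall>x. (u has_derivative (\<lambda>h. G x \<bullet> h)) (at x)) \<and> (\<forall>i\<in>Basis. bump_class c \<kappa> (\<lambda>x. G x \<bullet> i))"
  using assms
proof induction
  case (base k)
  define d where "d t = psi (k + 2) t - real k * psi (k + 1) t" for t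
  define G where "G x = (d (1 - \<kappa> * ((x - c) \<bullet> (x - c))) * (- 2 * \<kappa>)) *\<^sub>R (x - c)" for x
  have "((\<lambda>x. psi k (1 - \<kappa> * ((x - c) \<bullet> (x - c)))) has_derivative (\<lambda>h. G x \<bullet> h)) (at x)" for x
  proof -
    have "((\<lambda>x. 1 - \<kappa> * ((x - c) \<bullet> (x - c))) has_derivative (\<lambda>h. (- 2 * \<kappa>) * ((x - c) \<bullet> h))) (at x)"
      by (auto intro!: derivative_eq_intros simp: inner_commute algebra_simps)
    moreover have "(psi k has_derivative (\<lambda>y. d (1 - \<kappa> * ((x - c) \<bullet> (x - c))) * y)) (at (1 - \<kappa> * ((x - c) \<bullet> (x - c))))"
      using psi_deriv[of k "1 - \<kappa> * ((x - c) \<bullet> (x - c))"] by (simp add: has_field_derivative_def d_def)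
    ultimately have "((\<lambda>x. psi k (1 - \<kappa> * ((x - c) \<bullet> (x - c)))) has_derivative
        (\<lambda>h. d (1 - \<kappa> * ((x - c) \<bullet> (x - c))) * ((- 2 * \<kappa>) * ((x - c) \<bullet> h)))) (at x)"
      by (rule has_derivative_compose)
    then show ?thesis by (simp add: G_def mult.assoc)
  qed
  moreover have "bump_class c \<kappa> (\<lambda>x. G x \<bullet> i)" if "i \<in> Basis" for i
  proof -
    let ?t = "\<lambda>x. 1 - \<kappa> * ((x - c) \<bullet> (x - c))"
    have "bump_class c \<kappa> (\<lambda>x. ((x - c) \<bullet> i) * ((- 2 * \<kappa>) * (psi (k + 2) (?t x) + (- real k) * psi (k + 1) (?t x))))"
      by (intro bump_class.coord bump_class.cmult bump_class.add bump_class.base that)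
    moreover have "(\<lambda>x. G x \<bullet> i) = (\<lambda>x. ((x - c) \<bullet> i) * ((- 2 * \<kappa>) * (psi (k + 2) (?t x) + (- real k) * psi (k + 1) (?t x))))"
      by (simp add: G_def d_def fun_eq_iff mult_ac)
    ultimately show ?thesis by simp
  qed
  ultimately show ?case by blast
next
  case (add u v)
  then obtain G H where "\<forall>x. (u has_derivative (\<lambda>h. G x \<bullet> h)) (at x)" "\<forall>i\<in>Basis. bump_class c \<kappa> (\<lambda>x. G x \<bullet> i)"
    "\<forall>x. (v has_derivative (\<lambda>h. H x \<bullet> h)) (at x)" "\<forall>i\<in>Basis. bump_class c \<kappa> (\<lambda>x. H x \<bullet> i)" by blast
  then show ?case
    by (intro exI[of _ "\<lambda>x. G x + H x"]) (auto simp: inner_add_left intro!: derivative_intros bump_class.add)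
next
  case (cmult u a)
  then obtain G where "\<forall>x. (u has_derivative (\<lambda>h. G x \<bullet> h)) (at x)" "\<forall>i\<in>Basis. bump_class c \<kappa> (\<lambda>x. G x \<bullet> i)" by blast
  then show ?case
    by (intro exI[of _ "\<lambda>x. a *\<^sub>R G x"]) (auto intro!: has_derivative_mult_right bump_class.cmult)
next
  case (coord u i)
  then obtain G where G: "\<And>x. (u has_derivative (\<lambda>h. G x \<bullet> h)) (at x)" "\<And>i. i \<in> Basis \<Longrightarrow> bump_class c \<kappa> (\<lambda>x. G x \<bullet> i)" by blast
  define H where "H x = u x *\<^sub>R i + ((x - c) \<bullet> i) *\<^sub>R G x" for x
  have "((\<lambda>x. ((x - c) \<bullet> i) * u x) has_derivative (\<lambda>h. H x \<bullet> h)) (at x)" for x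
    unfolding H_def
    by (rule has_derivative_eq_rhs, rule has_derivative_mult[OF _ G(1)])
       (auto intro!: derivative_eq_intros simp: inner_add_left inner_commute algebra_simps fun_eq_iff)
  moreover have "bump_class c \<kappa> (\<lambda>x. H x \<bullet> j)" if "j \<in> Basis" for j
  proof -
    have "bump_class c \<kappa> (\<lambda>x. (i \<bullet> j) * u x + ((x - c) \<bullet> i) * (G x \<bullet> j))"
      by (intro bump_class.coord bump_class.cmult bump_class.add coord G that)
    moreover have "(\<lambda>x. H x \<bullet> j) = (\<lambda>x. (i \<bullet> j) * u x + ((x - c) \<bullet> i) * (G x \<bullet> j))"
      by (simp add: H_def inner_add_left fun_eq_iff)
    ultimately show ?thesis by simp
  qed
  ultimately show ?case by blast
qed

lemma bump_class_smooth: "bump_class c \<kappa> u \<Longrightarrow> smooth_fn u"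
proof (coinduction arbitrary: u rule: smooth_fn.coinduct)
  case smooth_fn
  then show ?case using bump_class_gradient[of c \<kappa> u] by blast
qed

lemma bump_class_support: "bump_class c \<kappa> u \<Longrightarrow> 1 \<le> \<kappa> * ((x - c) \<bullet> (x - c)) \<Longrightarrow> u x = 0"
  by (induction rule: bump_class.induct) (auto simp: psi_def)

definition bump :: "'a::euclidean_space \<Rightarrow> real \<Rightarrow> 'a \<Rightarrow> real" where
  "bump c \<rho> x = psi 0 (1 - (1 / \<rho>\<^sup>2) * ((x - c) \<bullet> (x - c)))"

lemma bump_class_bump: "bump_class c (1 / \<rho>\<^sup>2) (bump c \<rho>)"
proof -
  have "bump_class c (1 / \<rho>\<^sup>2) (\<lambda>x. psi 0 (1 - (1 / \<rho>\<^sup>2) * ((x - c) \<bullet> (x - c))))" by (rule bump_class.base)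
  then show ?thesis by (simp add: bump_def[abs_def])
qed

lemma bump_nonneg: "0 \<le> bump c \<rho> x" and bump_le_1: "bump c \<rho> x \<le> 1"
  by (auto simp: bump_def psi_def)

lemma far_from_center: "0 < \<rho> \<Longrightarrow> \<rho> \<le> dist x c \<Longrightarrow> 1 \<le> (1 / \<rho>\<^sup>2) * ((x - c) \<bullet> (x - c))"
  using power_mono[of \<rho> "norm (x - c)" 2] by (simp add: dist_norm field_simps flip: power2_norm_eq_inner)

lemma bump_eq_0: "0 < \<rho> \<Longrightarrow> \<rho> \<le> dist x c \<Longrightarrow> bump c \<rho> x = 0"
  using bump_class_support[OF bump_class_bump] far_from_center by blast

text \<open>Within half the radius the argument of \<open>psi 0\<close> is at least 1 - 1/4, and the
  inverse of 3/4 is 4/3. The bound keeps the mass of the bump comparable to a volume.\<close>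

lemma bump_ge:
  assumes "0 < \<rho>" "dist x c \<le> \<rho> / 2"
  shows "exp (- (4/3)) \<le> bump c \<rho> x"
proof -
  have "(norm (x - c))\<^sup>2 \<le> (\<rho> / 2)\<^sup>2" using assms by (intro power_mono) (auto simp: dist_norm)
  then have "(1 / \<rho>\<^sup>2) * ((x - c) \<bullet> (x - c)) \<le> 1/4"
    using assms by (simp add: field_simps power2_norm_eq_inner)
  define r where "r = 1 - (1 / \<rho>\<^sup>2) * ((x - c) \<bullet> (x - c))"
  have r: "3/4 \<le> r" using \<open>(1 / \<rho>\<^sup>2) * ((x - c) \<bullet> (x - c)) \<le> 1/4\<close> unfolding r_def by linarith
  then have "inverse r \<le> inverse (3/4)" by (intro le_imp_inverse_le) auto
  then have "exp (- (4/3)) \<le> psi 0 r" using r by (simp add: psi_def)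
  then show ?thesis by (simp only: bump_def r_def)
qed

lemma bump_translate: "bump (c + x) \<rho> y = bump c \<rho> (y - x)"
  by (simp add: bump_def algebra_simps)

lemma bump_test_fn: "0 < \<rho> \<Longrightarrow> test_fn (bump c \<rho>)"
  unfolding test_fn_def
proof
  show "smooth_fn (bump c \<rho>)" by (rule bump_class_smooth[OF bump_class_bump])
  assume "0 < \<rho>"
  then have "{x. bump c \<rho> x \<noteq> 0} \<subseteq> ball c \<rho>"
    using bump_eq_0[of \<rho> _ c] by (force simp: dist_commute not_le[symmetric])
  then show "bounded {x. bump c \<rho> x \<noteq> 0}" using bounded_ball bounded_subset by blast
qed

lemma bump_gradient:
  assumes "0 < \<rho>"
  obtains W where "\<And>x. (bump c \<rho> has_derivative (\<lambda>h. W x \<bullet> h)) (at x)" "continuous_on UNIV W" "\<And>x. \<rho> \<le> dist x c \<Longrightarrow> W x = 0"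
proof -
  obtain W where W: "\<And>x. (bump c \<rho> has_derivative (\<lambda>h. W x \<bullet> h)) (at x)" "\<And>i. i \<in> Basis \<Longrightarrow> bump_class c (1 / \<rho>\<^sup>2) (\<lambda>x. W x \<bullet> i)"
    using bump_class_gradient[OF bump_class_bump] by blast
  show ?thesis
  proof
    show "continuous_on UNIV W"
    proof (rule continuous_on_componentwise[THEN iffD2], intro ballI)
      fix i :: 'a assume "i \<in> Basis"
      then obtain H where "\<forall>x. ((\<lambda>x. W x \<bullet> i) has_derivative (\<lambda>h. H x \<bullet> h)) (at x)"
        using bump_class_gradient[OF W(2)] by blast
      then show "continuous_on UNIV (\<lambda>x. W x \<bullet> i)"
        by (meson continuous_at_imp_continuous_on has_derivative_continuous)
    qed
    show "W x = 0" if "\<rho> \<le> dist x c" for x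
    proof (rule euclidean_eqI)
      fix i :: 'a assume "i \<in> Basis"
      from bump_class_support[OF W(2)[OF this] far_from_center[OF assms that]] show "W x \<bullet> i = 0 \<bullet> i" by simp
    qed
  qed (rule W(1))
qed

section \<open>Segment bounds for smooth and mollified functions\<close>

lemma line_FTC:
  fixes f :: "'a::euclidean_space \<Rightarrow> real"
  assumes f: "\<And>x. (f has_derivative (\<lambda>h. G x \<bullet> h)) (at x)" and G: "continuous_on UNIV G"
  shows "(\<integral>t. indicator {0..1} t *\<^sub>R (G (x + t *\<^sub>R v) \<bullet> v) \<partial>lborel) = f (x + v) - f x"
proof -
  have "((\<lambda>t. f (x + t *\<^sub>R v)) has_vector_derivative (G (x + t *\<^sub>R v) \<bullet> v)) (at t within {0..1})" for t
  proof -
    have "((\<lambda>t. x + t *\<^sub>R v) has_derivative (\<lambda>h. h *\<^sub>R v)) (at t within {0..1})"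
      by (auto intro!: derivative_eq_intros)
    from has_derivative_compose[OF this f] show ?thesis
      by (simp add: has_vector_derivative_def)
  qed
  moreover have "continuous_on {0..1} (\<lambda>t. G (x + t *\<^sub>R v) \<bullet> v)"
    by (intro continuous_intros continuous_on_compose2[OF G]) auto
  ultimately show ?thesis
    by (subst integral_FTC_atLeastAtMost[where F="\<lambda>t. f (x + t *\<^sub>R v)"]) auto
qed

lemma nn_integral_Icc_Ioc:
  fixes k :: "real \<Rightarrow> ennreal"
  shows "(\<integral>\<^sup>+ t\<in>{0..1}. k t \<partial>lborel) = (\<integral>\<^sup>+ t\<in>{0<..1}. k t \<partial>lborel)"
proof (rule nn_integral_cong_AE)
  have "AE t in lborel. t \<noteq> (0::real)" by (rule AE_lborel_singleton)
  then show "AE t in lborel. k t * indicator {0..1} t = k t * indicator {0<..1} t"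
    by eventually_elim (auto simp: indicator_def)
qed

lemma seg_bound_gradient:
  fixes f :: "'a::euclidean_space \<Rightarrow> real"
  assumes f: "\<And>x. (f has_derivative (\<lambda>h. G x \<bullet> h)) (at x)" and G: "continuous_on UNIV G"
  shows "seg_bound f (\<lambda>x. ennreal (norm (G x)))"
  unfolding seg_bound_def
proof (intro allI)
  fix x z :: 'a
  define v where "v = z - x"
  have m [measurable]: "G \<in> borel_measurable borel" using G by (rule borel_measurable_continuous_onI)
  have c: "continuous_on {0..1} (\<lambda>t. G (x + t *\<^sub>R v) \<bullet> v)"
    by (intro continuous_intros continuous_on_compose2[OF G]) auto
  have "integrable lborel (\<lambda>t. indicator {0..1} t *\<^sub>R (G (x + t *\<^sub>R v) \<bullet> v))"
    by (rule borel_integrable_compact[OF compact_Icc c])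
  then have "ennreal (norm (\<integral>t. indicator {0..1} t *\<^sub>R (G (x + t *\<^sub>R v) \<bullet> v) \<partial>lborel))
    \<le> (\<integral>\<^sup>+ t. ennreal (norm (indicator {0..1} t *\<^sub>R (G (x + t *\<^sub>R v) \<bullet> v))) \<partial>lborel)"
    by (rule integral_norm_bound_ennreal)
  also have "\<dots> \<le> (\<integral>\<^sup>+ t. ennreal (norm v) * (ennreal (norm (G (x + t *\<^sub>R v))) * indicator {0..1} t) \<partial>lborel)"
  proof (intro nn_integral_mono)
    fix t :: real
    have "\<bar>G (x + t *\<^sub>R v) \<bullet> v\<bar> \<le> norm v * norm (G (x + t *\<^sub>R v))"
      using Cauchy_Schwarz_ineq2[of "G (x + t *\<^sub>R v)" v] by (simp add: mult.commute)
    then show "ennreal (norm (indicator {0..1} t *\<^sub>R (G (x + t *\<^sub>R v) \<bullet> v)))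
      \<le> ennreal (norm v) * (ennreal (norm (G (x + t *\<^sub>R v))) * indicator {0..1} t)"
      by (auto simp: indicator_def ennreal_leI simp flip: ennreal_mult)
  qed
  also have "\<dots> = ennreal (norm v) * (\<integral>\<^sup>+ t\<in>{0..1}. ennreal (norm (G (x + t *\<^sub>R v))) \<partial>lborel)"
    by (intro nn_integral_cmult) measurable
  finally show "ennreal \<bar>f z - f x\<bar> \<le> ennreal (dist x z) * (\<integral>\<^sup>+ t\<in>{0<..1}. ennreal (norm (G (x + t *\<^sub>R (z - x)))) \<partial>lborel)"
    using line_FTC[OF f G, of x v] by (simp add: nn_integral_Icc_Ioc v_def dist_norm norm_minus_commute)
qed

lemma bounded_support_product_integrable:
  fixes f :: "'a::euclidean_space \<Rightarrow> real" and k :: "'a \<Rightarrow> 'b::euclidean_space"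
  assumes f: "\<And>R. integrable lborel (\<lambda>y. indicator (ball 0 R) y *\<^sub>R f y)" and [measurable]: "f \<in> borel_measurable borel"
    and [measurable]: "k \<in> borel_measurable borel" and k: "\<And>y. norm (k y) \<le> B" "\<And>y. y \<notin> ball 0 R \<Longrightarrow> k y = 0"
  shows "integrable lborel (\<lambda>y. f y *\<^sub>R k y)"
proof (rule Bochner_Integration.integrable_bound)
  show "integrable lborel (\<lambda>y. B * (indicator (ball 0 R) y *\<^sub>R f y))" using f by (intro integrable_mult_right)
  show "AE y in lborel. norm (f y *\<^sub>R k y) \<le> norm (B * (indicator (ball 0 R) y *\<^sub>R f y))"
  proof (intro AE_I2)
    fix y
    have "0 \<le> B" using k(1)[of y] norm_ge_zero order_trans by blast
    then show "norm (f y *\<^sub>R k y) \<le> norm (B * (indicator (ball 0 R) y *\<^sub>R f y))"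
      using mult_left_mono[OF k(1)[of y], of "\<bar>f y\<bar>"] k(2)[of y]
      by (cases "y \<in> ball 0 R") (auto simp: abs_mult mult.commute)
  qed
qed measurable

text \<open>The convolution itself is not differentiated. The difference of two translates of the
  bump is an integral along the segment; after the order of integration is exchanged, the translated
  bump is, for each t, a test function for the weak gradient.\<close>

lemma mollified_seg_bound:
  fixes f :: "'a::euclidean_space \<Rightarrow> real" and G :: "'a \<Rightarrow> 'a"
  assumes [measurable]: "f \<in> borel_measurable borel" "G \<in> borel_measurable borel"
    and f: "\<And>R. integrable lborel (\<lambda>y. indicator (ball 0 R) y *\<^sub>R f y)"
    and weak: "\<And>\<phi> G\<phi>. test_fn \<phi> \<Longrightarrow> (\<And>x. (\<phi> has_derivative (\<lambda>h. G\<phi> x \<bullet> h)) (at x)) \<Longrightarrow>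
        (\<integral>x. f x *\<^sub>R G\<phi> x \<partial>lborel) = - (\<integral>x. \<phi> x *\<^sub>R G x \<partial>lborel)"
    and G: "\<And>R. integrable lborel (\<lambda>y. indicator (ball 0 R) y *\<^sub>R G y)"
    and \<rho>: "0 < \<rho>"
  shows "seg_bound (\<lambda>x. \<integral>y. f y * bump c \<rho> (y - x) \<partial>lborel) (\<lambda>x. \<integral>\<^sup>+ y. ennreal (bump c \<rho> (y - x)) * ennreal (norm (G y)) \<partial>lborel)"
  unfolding seg_bound_def
proof (intro allI)
  fix x z :: 'a
  obtain W where W: "\<And>x. (bump c \<rho> has_derivative (\<lambda>h. W x \<bullet> h)) (at x)" "continuous_on UNIV W" "\<And>x. \<rho> \<le> dist x c \<Longrightarrow> W x = 0"
    using bump_gradient[OF \<rho>] by metis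
  have Wm [measurable]: "W \<in> borel_measurable borel" using W(2) by (rule borel_measurable_continuous_onI)
  have wc: "continuous_on UNIV (bump c \<rho>)"
    using W(1) by (meson continuous_at_imp_continuous_on has_derivative_continuous)
  then have wm [measurable]: "bump c \<rho> \<in> borel_measurable borel" by (rule borel_measurable_continuous_onI)
  obtain B where B: "\<And>y. norm (W y) \<le> B"
  proof -
    have "compact (W ` cball c \<rho>)" using W(2) by (intro compact_continuous_image continuous_on_subset[OF W(2)]) auto
    then obtain B where "\<And>y. y \<in> cball c \<rho> \<Longrightarrow> norm (W y) \<le> B" using compact_imp_bounded bounded_iff by (metis imageI)
    then have "norm (W y) \<le> max B 0" for y using W(3)[of y] by (cases "dist c y \<le> \<rho>") (auto simp: dist_commute le_max_iff_disj)
    then show ?thesis by (rule that)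
  qed
  define p where "p t = x + t *\<^sub>R (z - x)" for t
  \<comment> \<open>A radius for which all translates of the bump along the segment are supported in
    the ball about 0.\<close>
  define R where "R = norm c + \<rho> + norm x + norm (z - x) + 1"
  have out: "\<rho> \<le> dist (y - p t) c" if "y \<notin> ball 0 R" "t \<in> {0..1}" for y t
  proof -
    have "norm (p t) \<le> norm x + norm (z - x)"
      unfolding p_def using that(2) by (intro norm_triangle_le add_mono) (auto intro: mult_left_le_one_le)
    moreover have "norm y \<le> norm (y - p t - c) + norm (p t) + norm c"
      using norm_triangle_ineq[of "y - p t - c" "p t + c"] norm_triangle_ineq[of "p t" c] by simp
    ultimately show ?thesis using that(1) by (simp add: R_def dist_norm)
  qed
  \<comment> \<open>The direction is x - z because the centre a enters the bump as y - a.\<close>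
  define H where "H y t = indicator {0..1} t *\<^sub>R (f y *\<^sub>R (W (y - p t) \<bullet> (x - z)))" for y t
  have p_meas [measurable]: "p \<in> borel_measurable borel" unfolding p_def by measurable
  have wint: "integrable lborel (\<lambda>y. f y *\<^sub>R bump c \<rho> (y - a))" for a
  proof (rule bounded_support_product_integrable[OF f, where B=1 and R="norm c + \<rho> + norm a"])
    fix y :: 'a assume "y \<notin> ball 0 (norm c + \<rho> + norm a)"
    moreover have "norm y \<le> norm (y - a - c) + norm a + norm c"
      using norm_triangle_ineq[of "y - a - c" "a + c"] norm_triangle_ineq[of a c] by simp
    ultimately have "\<rho> \<le> dist (y - a) c" by (simp add: dist_norm)
    then show "bump c \<rho> (y - a) = 0" by (rule bump_eq_0[OF \<rho>])
  qed (auto simp: bump_nonneg bump_le_1 abs_of_nonneg)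
  have FTC: "(\<integral>t. H y t \<partial>lborel) = f y * bump c \<rho> (y - z) - f y * bump c \<rho> (y - x)" for y
  proof -
    have "(\<integral>t. H y t \<partial>lborel) = (\<integral>t. f y * (indicator {0..1} t *\<^sub>R (W ((y - x) + t *\<^sub>R (x - z)) \<bullet> (x - z))) \<partial>lborel)"
      unfolding H_def p_def by (intro Bochner_Integration.integral_cong) (auto simp: algebra_simps)
    also have "\<dots> = f y * (bump c \<rho> ((y - x) + (x - z)) - bump c \<rho> (y - x))"
      by (subst integral_mult_right_zero, subst line_FTC[OF W(1,2)]) simp
    finally show ?thesis by (simp add: algebra_simps)
  qed
  have Hint: "integrable (lborel \<Otimes>\<^sub>M lborel) (\<lambda>(y, t). H y t)"
  proof (rule Bochner_Integration.integrable_bound)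
    let ?K = "\<lambda>(y, t::real). (B * norm (x - z) * (indicator (ball 0 R) y *\<^sub>R f y)) * (indicator {0..1} t :: real)"
    have i: "integrable lborel (\<lambda>y. B * norm (x - z) * (indicator (ball 0 R) y *\<^sub>R f y))"
      using f by (intro integrable_mult_right)
    show "integrable (lborel \<Otimes>\<^sub>M lborel) ?K"
    proof (rule lborel_pair.Fubini_integrable)
      show "integrable lborel (\<lambda>y. \<integral>t. norm (?K (y, t)) \<partial>lborel)"
        using integrable_norm[OF i] by (simp add: abs_mult)
      show "?K \<in> borel_measurable (lborel \<Otimes>\<^sub>M lborel)" by measurable
      have "integrable lborel (indicator {0..1::real} :: real \<Rightarrow> real)" by (intro integrable_real_indicator) auto
      then show "AE y in lborel. integrable lborel (\<lambda>t. ?K (y, t))"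
        by (auto intro!: AE_I2 integrable_mult_right)
    qed
    show "AE q in lborel \<Otimes>\<^sub>M lborel. norm (case q of (y, t) \<Rightarrow> H y t) \<le> norm (?K q)"
    proof (intro AE_I2, clarify)
      fix y t
      show "norm (H y t) \<le> norm ((B * norm (x - z) * (indicator (ball 0 R) y *\<^sub>R f y)) * (indicator {0..1} t :: real))"
      proof (cases "t \<in> {0..1} \<and> y \<in> ball 0 R")
        case True
        have "0 \<le> B" using B[of 0] norm_ge_zero order_trans by blast
        have "\<bar>W (y - p t) \<bullet> (x - z)\<bar> \<le> norm (W (y - p t)) * norm (x - z)" by (rule Cauchy_Schwarz_ineq2)
        also have "\<dots> \<le> B * norm (x - z)" by (intro mult_right_mono B) auto
        finally have "\<bar>f y\<bar> * \<bar>W (y - p t) \<bullet> (x - z)\<bar> \<le> \<bar>f y\<bar> * (B * norm (x - z))" by (intro mult_left_mono) auto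
        then show ?thesis using True \<open>0 \<le> B\<close> by (simp add: H_def abs_mult mult_ac)
      next
        case False
        then show ?thesis using out[of y t] W(3)[of "y - p t"] by (cases "t \<in> {0..1}") (auto simp: H_def)
      qed
    qed
  qed (unfold H_def, measurable)
  define F where "F a = (\<integral>y. f y * bump c \<rho> (y - a) \<partial>lborel)" for a
  define g where "g a = (\<integral>\<^sup>+ y. ennreal (bump c \<rho> (y - a)) * ennreal (norm (G y)) \<partial>lborel)" for a
  have "F z - F x = (\<integral>y. f y * bump c \<rho> (y - z) - f y * bump c \<rho> (y - x) \<partial>lborel)"
    unfolding F_def using wint by (intro Bochner_Integration.integral_diff[symmetric]) auto
  also have "\<dots> = (\<integral>y. (\<integral>t. H y t \<partial>lborel) \<partial>lborel)" by (simp only: FTC)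
  also have "\<dots> = (\<integral>t. (\<integral>y. H y t \<partial>lborel) \<partial>lborel)" by (rule lborel_pair.Fubini_integral[OF Hint, symmetric])
  finally have diff: "F z - F x = (\<integral>t. (\<integral>y. H y t \<partial>lborel) \<partial>lborel)" .
  have inner: "norm (\<integral>y. H y t \<partial>lborel) \<le> ennreal (dist x z) * (g (p t) * indicator {0..1} t)" for t
  proof (cases "t \<in> {0..1}")
    case True
    let ?\<phi> = "bump (c + p t) \<rho>"
    have deriv: "(?\<phi> has_derivative (\<lambda>h. W (y - p t) \<bullet> h)) (at y)" for y
    proof -
      have "((\<lambda>y. y - p t) has_derivative (\<lambda>h. h)) (at y)" by (auto intro!: derivative_eq_intros)
      from has_derivative_compose[OF this W(1)] show ?thesis by (simp add: bump_translate[abs_def])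
    qed
    have fW: "integrable lborel (\<lambda>y. f y *\<^sub>R W (y - p t))"
      by (rule bounded_support_product_integrable[OF f, where B=B and R=R]) (use B out[OF _ True] W(3) in auto)
    have "(\<integral>y. H y t \<partial>lborel) = (\<integral>y. (f y *\<^sub>R W (y - p t)) \<bullet> (x - z) \<partial>lborel)"
      using True by (simp add: H_def)
    also have "\<dots> = (\<integral>y. f y *\<^sub>R W (y - p t) \<partial>lborel) \<bullet> (x - z)"
      using fW by (rule integral_inner_left)
    also have "\<dots> = - (\<integral>y. ?\<phi> y *\<^sub>R G y \<partial>lborel) \<bullet> (x - z)"
      using weak[OF bump_test_fn[OF \<rho>] deriv] by simp
    finally have "\<bar>\<integral>y. H y t \<partial>lborel\<bar> \<le> norm (\<integral>y. ?\<phi> y *\<^sub>R G y \<partial>lborel) * dist x z"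
      using Cauchy_Schwarz_ineq2[of "- (\<integral>y. ?\<phi> y *\<^sub>R G y \<partial>lborel)" "x - z"] by (simp add: dist_norm)
    then have "ennreal (norm (\<integral>y. H y t \<partial>lborel)) \<le> ennreal (norm (\<integral>y. ?\<phi> y *\<^sub>R G y \<partial>lborel)) * ennreal (dist x z)"
      by (simp add: ennreal_leI flip: ennreal_mult)
    also have "ennreal (norm (\<integral>y. ?\<phi> y *\<^sub>R G y \<partial>lborel)) \<le> g (p t)"
    proof (cases "integrable lborel (\<lambda>y. ?\<phi> y *\<^sub>R G y)")
      case True
      then have "ennreal (norm (\<integral>y. ?\<phi> y *\<^sub>R G y \<partial>lborel)) \<le> (\<integral>\<^sup>+ y. ennreal (norm (?\<phi> y *\<^sub>R G y)) \<partial>lborel)"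
        by (rule integral_norm_bound_ennreal)
      also have "\<dots> = g (p t)"
        unfolding g_def by (intro nn_integral_cong) (simp add: bump_translate bump_nonneg ennreal_mult)
      finally show ?thesis .
    qed (simp add: not_integrable_integral_eq)
    finally show ?thesis using True by (simp add: mult.commute mult_right_mono)
  qed (simp add: H_def)
  have g_meas: "g \<in> borel_measurable borel" unfolding g_def by measurable
  note [measurable] = g_meas
  have "integrable lborel (\<lambda>t. \<integral>y. H y t \<partial>lborel)"
    using lborel_pair.integrable_snd[OF Hint] .
  then have "ennreal (norm (F z - F x)) \<le> (\<integral>\<^sup>+ t. ennreal (norm (\<integral>y. H y t \<partial>lborel)) \<partial>lborel)"
    unfolding diff by (rule integral_norm_bound_ennreal)
  also have "\<dots> \<le> (\<integral>\<^sup>+ t. ennreal (dist x z) * (g (p t) * indicator {0..1} t) \<partial>lborel)"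
    by (intro nn_integral_mono inner)
  also have "\<dots> = ennreal (dist x z) * (\<integral>\<^sup>+ t\<in>{0..1}. g (p t) \<partial>lborel)"
    by (intro nn_integral_cmult) measurable
  finally show "ennreal \<bar>(\<integral>y. f y * bump c \<rho> (y - z) \<partial>lborel) - (\<integral>y. f y * bump c \<rho> (y - x) \<partial>lborel)\<bar>
    \<le> ennreal (dist x z) * (\<integral>\<^sup>+ t\<in>{0<..1}. (\<integral>\<^sup>+ y. ennreal (bump c \<rho> (y - (x + t *\<^sub>R (z - x)))) * ennreal (norm (G y)) \<partial>lborel) \<partial>lborel)"
    by (simp add: F_def g_def p_def nn_integral_Icc_Ioc)
qed

section \<open>Lebesgue points and convergence of the mollified functions\<close>

text \<open>The differentiation theorem is applied to |f - q| for all rational q, at the cost of a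
  countable union of null sets. A rational q close to f(x) is then replaced by f(x) with a small
  error.\<close>

lemma lebesgue_points:
  fixes f :: "'a::euclidean_space \<Rightarrow> real"
  assumes [measurable]: "f \<in> borel_measurable borel"
    and f: "\<And>R. integrable lborel (\<lambda>y. indicator (ball 0 R) y *\<^sub>R f y)"
  shows "AE x in lborel. \<forall>e>0. \<exists>d>0. \<forall>h. 0 < h \<and> h < d \<longrightarrow>
     (\<integral>y. indicator (cbox x (x + h *\<^sub>R One)) y * \<bar>f y - f x\<bar> \<partial>lborel) \<le> e * h ^ DIM('a)"
proof -
  have cbox_int: "integrable lborel (\<lambda>y. indicator (cbox a b) y * \<bar>f y - q\<bar>)" for a b q
  proof -
    obtain R where R: "cbox a b \<subseteq> ball 0 R"
      using bounded_subset_ballD[OF bounded_cbox, of a b 0] by blast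
    have fi: "integrable lborel (\<lambda>y. indicator (cbox a b) y * f y)"
      by (rule Bochner_Integration.integrable_bound[OF f[of R]]) (use R in \<open>auto intro!: AE_I2 simp: indicator_def\<close>)
    have "integrable lborel (indicator (cbox a b) :: 'a \<Rightarrow> real)"
      using emeasure_lborel_cbox_finite by (intro integrable_real_indicator) auto
    then have "integrable lborel (\<lambda>y. indicator (cbox a b) y * f y - q * indicator (cbox a b) y)"
      using fi by (intro Bochner_Integration.integrable_diff integrable_mult_right) auto
    then have "integrable lborel (\<lambda>y. \<bar>indicator (cbox a b) y * f y - q * indicator (cbox a b) y\<bar>)"
      by (rule integrable_abs)
    then show ?thesis
      by (rule Bochner_Integration.integrable_bound) (auto intro!: AE_I2 simp: indicator_def)
  qed
  have box: "(\<lambda>y. \<bar>f y - q\<bar>) integrable_on cbox a b"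
    "integral (cbox a b) (\<lambda>y. \<bar>f y - q\<bar>) = (\<integral>y. indicator (cbox a b) y * \<bar>f y - q\<bar> \<partial>lborel)" for a b q
    using set_borel_integral_eq_integral[of "cbox a b" "\<lambda>y. \<bar>f y - q\<bar>"] cbox_int[of a b q]
    by (auto simp: set_integrable_def set_lebesgue_integral_def)
  have "\<exists>S. negligible S \<and> (\<forall>x e. x \<notin> S \<and> 0 < e \<longrightarrow> (\<exists>d>0. \<forall>h. 0 < h \<and> h < d \<longrightarrow>
      norm (integral (cbox x (x + h *\<^sub>R One)) (\<lambda>y. \<bar>f y - q\<bar>) /\<^sub>R h ^ DIM('a) - \<bar>f x - q\<bar>) < e))" for q
    using integrable_ccontinuous_explicit[of "\<lambda>y. \<bar>f y - q\<bar>", OF box(1)] by metis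
  then obtain S where S: "\<And>q. negligible (S q)" "\<And>q x e. x \<notin> S q \<Longrightarrow> 0 < e \<Longrightarrow> \<exists>d>0. \<forall>h. 0 < h \<and> h < d \<longrightarrow>
      norm (integral (cbox x (x + h *\<^sub>R One)) (\<lambda>y. \<bar>f y - q\<bar>) /\<^sub>R h ^ DIM('a) - \<bar>f x - q\<bar>) < e" by metis
  have "AE x in lebesgue. x \<notin> S q" for q
    using S(1)[of q] unfolding negligible_iff_null_sets by (rule AE_not_in)
  then have "AE x in lborel. x \<notin> S q" for q by (simp only: AE_completion_iff)
  then have "AE x in lborel. \<forall>q\<in>\<rat>. x \<notin> S q" by (subst AE_ball_countable) (auto simp: countable_rat)
  then show ?thesis
  proof eventually_elim
    case (elim x)
    show ?case
    proof (intro allI impI)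
      fix e :: real assume e: "0 < e"
      obtain q where q: "q \<in> \<rat>" "\<bar>f x - q\<bar> < e / 4"
      proof -
        obtain q where "q \<in> \<rat>" "f x - e/4 < q" "q < f x" using Rats_dense_in_real[of "f x - e/4" "f x"] e by auto
        then show ?thesis by (intro that[of q]) auto
      qed
      obtain d where d: "0 < d" "\<And>h. 0 < h \<Longrightarrow> h < d \<Longrightarrow>
         norm (integral (cbox x (x + h *\<^sub>R One)) (\<lambda>y. \<bar>f y - q\<bar>) /\<^sub>R h ^ DIM('a) - \<bar>f x - q\<bar>) < e / 4"
        using S(2)[of x q "e/4"] elim q(1) e by auto
      show "\<exists>d>0. \<forall>h. 0 < h \<and> h < d \<longrightarrow> (\<integral>y. indicator (cbox x (x + h *\<^sub>R One)) y * \<bar>f y - f x\<bar> \<partial>lborel) \<le> e * h ^ DIM('a)"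
      proof (intro exI[of _ d] conjI allI impI)
        fix h :: real assume h: "0 < h \<and> h < d"
        let ?B = "cbox x (x + h *\<^sub>R One)"
        have m: "measure lborel ?B = h ^ DIM('a)"
        proof -
          have c: "(x + h *\<^sub>R One) \<bullet> b - x \<bullet> b = h" if "b \<in> Basis" for b
            using that by (simp add: inner_add_left inner_sum_left_Basis)
          have "measure lborel ?B = (\<Prod>b\<in>Basis. (x + h *\<^sub>R One) \<bullet> b - x \<bullet> b)"
          proof (intro content_cbox ballI)
            fix b :: 'a assume "b \<in> Basis"
            from c[OF this] h show "x \<bullet> b \<le> (x + h *\<^sub>R One) \<bullet> b" by linarith
          qed
          also have "\<dots> = (\<Prod>b\<in>(Basis :: 'a set). h)" by (intro prod.cong refl c)
          finally show ?thesis by simp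
        qed
        have "(\<integral>y. indicator ?B y * \<bar>f y - q\<bar> \<partial>lborel) / h ^ DIM('a) - \<bar>f x - q\<bar> < e / 4"
        proof -
          define I where "I = (\<integral>y. indicator ?B y * \<bar>f y - q\<bar> \<partial>lborel)"
          have "norm (I /\<^sub>R h ^ DIM('a) - \<bar>f x - q\<bar>) < e / 4"
            unfolding I_def box(2)[symmetric] using d(2)[of h] h by blast
          then have "I /\<^sub>R h ^ DIM('a) - \<bar>f x - q\<bar> < e / 4" unfolding real_norm_def abs_less_iff by (rule conjunct1)
          also have "I /\<^sub>R h ^ DIM('a) = I / h ^ DIM('a)" by (simp add: field_simps)
          finally show ?thesis by (simp only: I_def)
        qed
        then have "(\<integral>y. indicator ?B y * \<bar>f y - q\<bar> \<partial>lborel) / h ^ DIM('a) \<le> e / 4 + e / 4" using q(2) by linarith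
        then have le: "(\<integral>y. indicator ?B y * \<bar>f y - q\<bar> \<partial>lborel) \<le> (e / 2) * h ^ DIM('a)" using h by (simp add: field_simps)
        have i: "integrable lborel (indicator ?B :: 'a \<Rightarrow> real)"
          using emeasure_lborel_cbox_finite by (intro integrable_real_indicator) auto
        have "(\<integral>y. indicator ?B y * \<bar>f y - f x\<bar> \<partial>lborel) \<le> (\<integral>y. indicator ?B y * \<bar>f y - q\<bar> + (e / 4) * indicator ?B y \<partial>lborel)"
        proof (rule integral_mono)
          show "integrable lborel (\<lambda>y. indicator ?B y * \<bar>f y - q\<bar> + (e / 4) * indicator ?B y)"
            by (rule Bochner_Integration.integrable_add[OF cbox_int integrable_mult_right[OF i]])
          fix y
          have "\<bar>f y - f x\<bar> \<le> \<bar>f y - q\<bar> + e / 4" using q(2) by linarith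
          then show "indicator ?B y * \<bar>f y - f x\<bar> \<le> indicator ?B y * \<bar>f y - q\<bar> + (e / 4) * indicator ?B y"
            by (cases "y \<in> ?B") auto
        qed (rule cbox_int)
        also have "\<dots> = (\<integral>y. indicator ?B y * \<bar>f y - q\<bar> \<partial>lborel) + (e / 4) * h ^ DIM('a)"
          using cbox_int i m by (subst Bochner_Integration.integral_add) auto
        also have "\<dots> \<le> (e / 2) * h ^ DIM('a) + (e / 4) * h ^ DIM('a)" using le by simp
        also have "\<dots> \<le> e * h ^ DIM('a)" using e h by (simp add: field_simps)
        finally show "(\<integral>y. indicator ?B y * \<bar>f y - f x\<bar> \<partial>lborel) \<le> e * h ^ DIM('a)" .
      qed (rule d(1))
    qed
  qed
qed

text \<open>The bump is placed in the corner of the cube with side h, because the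
  differentiation theorem of the library averages over cubes that have the point as a corner.\<close>

definition corner_bump :: "real \<Rightarrow> 'a::euclidean_space \<Rightarrow> real" where
  "corner_bump h = bump ((h / 2) *\<^sub>R One) (h / 2)"

definition mollify :: "real \<Rightarrow> ('a::euclidean_space \<Rightarrow> real) \<Rightarrow> 'a \<Rightarrow> real" where
  "mollify h f x = (\<integral>y. f y * corner_bump h (y - x) \<partial>lborel) / (\<integral>y. corner_bump h (y::'a) \<partial>lborel)"

lemma corner_bump_measurable [measurable]: "corner_bump h \<in> borel_measurable borel"
  unfolding corner_bump_def bump_def psi_def by measurable

lemma corner_bump_bounds: "0 \<le> corner_bump h z" "corner_bump h z \<le> 1"
  by (auto simp: corner_bump_def bump_nonneg bump_le_1)

lemma corner_bump_support:
  assumes h: "0 < h" and nz: "corner_bump h (z::'a::euclidean_space) \<noteq> 0"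
  shows "z \<in> cbox 0 (h *\<^sub>R One)" "norm z < h * (norm (One :: 'a) + 1)"
proof -
  have d: "norm (z - (h / 2) *\<^sub>R One) < h / 2"
    using nz bump_eq_0[of "h/2" z "(h / 2) *\<^sub>R One"] h by (auto simp: corner_bump_def dist_norm not_le[symmetric])
  have "0 \<le> z \<bullet> b \<and> z \<bullet> b \<le> h" if "b \<in> Basis" for b
  proof -
    have "\<bar>z \<bullet> b - h / 2\<bar> < h / 2"
      using le_less_trans[OF Basis_le_norm[OF that, of "z - (h / 2) *\<^sub>R One"] d] that
      by (simp add: inner_diff_left inner_sum_left_Basis)
    then show ?thesis unfolding abs_less_iff by linarith
  qed
  then show "z \<in> cbox 0 (h *\<^sub>R One)" by (auto simp: mem_box inner_sum_left_Basis)
  have "norm z \<le> norm (z - (h / 2) *\<^sub>R One) + norm ((h / 2) *\<^sub>R (One::'a))"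
    using norm_triangle_ineq[of "z - (h / 2) *\<^sub>R One" "(h / 2) *\<^sub>R One"] by simp
  also have "\<dots> < h / 2 + h / 2 * norm (One :: 'a)" using d h by simp
  also have "\<dots> \<le> h * (norm (One :: 'a) + 1)" using h by (simp add: field_simps)
  finally show "norm z < h * (norm (One :: 'a) + 1)" .
qed

lemma corner_bump_integrable:
  assumes "0 < h"
  shows "integrable lborel (corner_bump h :: 'a::euclidean_space \<Rightarrow> real)"
proof (rule Bochner_Integration.integrable_bound)
  show "integrable lborel (indicator (cbox 0 (h *\<^sub>R One)) :: 'a \<Rightarrow> real)"
    using emeasure_lborel_cbox_finite by (intro integrable_real_indicator) auto
  show "AE z::'a in lborel. norm (corner_bump h z) \<le> norm (indicator (cbox 0 (h *\<^sub>R One)) z :: real)"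
  proof (intro AE_I2)
    fix z :: 'a
    show "norm (corner_bump h z) \<le> norm (indicator (cbox 0 (h *\<^sub>R One)) z :: real)"
      using corner_bump_support(1)[OF assms, of z] corner_bump_bounds[of h z]
      by (cases "corner_bump h z = 0") auto
  qed
qed measurable

lemma corner_bump_mass:
  assumes h: "0 < h"
  shows "exp (- (4/3)) * (omega TYPE('a) * (h / 4) ^ DIM('a)) \<le> (\<integral>z. corner_bump h (z::'a::euclidean_space) \<partial>lborel)"
proof -
  let ?c = "(h / 2) *\<^sub>R One :: 'a"
  have i: "integrable lborel (indicator (ball ?c (h / 4)) :: 'a \<Rightarrow> real)"
    using emeasure_lborel_ball_finite by (intro integrable_real_indicator) auto
  have "exp (- (4/3)) * (omega TYPE('a) * (h / 4) ^ DIM('a)) = (\<integral>z. exp (- (4/3)) * indicator (ball ?c (h / 4)) z \<partial>lborel)"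
    using h by (simp add: content_ball)
  also have "\<dots> \<le> (\<integral>z. corner_bump h (z::'a) \<partial>lborel)"
  proof (intro integral_mono integrable_mult_right i corner_bump_integrable h)
    fix z :: 'a
    show "exp (- (4/3)) * indicator (ball ?c (h / 4)) z \<le> corner_bump h z"
      using bump_ge[of "h/2" z ?c] h bump_nonneg[of ?c "h/2" z]
      by (cases "z \<in> ball ?c (h / 4)") (auto simp: corner_bump_def dist_commute)
  qed
  finally show ?thesis .
qed

lemma corner_bump_mass_pos:
  assumes h: "0 < h"
  shows "0 < (\<integral>z. corner_bump h (z::'a::euclidean_space) \<partial>lborel)"
proof -
  have "0 < exp (- (4/3)) * (omega TYPE('a) * (h / 4) ^ DIM('a))" using h omega_pos[where 'a='a] by simp
  with corner_bump_mass[OF h, where 'a='a] show ?thesis by linarith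
qed

lemma integral_translate:
  fixes k :: "'a::euclidean_space \<Rightarrow> real"
  assumes [measurable]: "k \<in> borel_measurable borel"
  shows "(\<integral>y. k (y - x) \<partial>lborel) = (\<integral>y. k y \<partial>lborel)"
proof -
  have "(\<integral>y. k y \<partial>lborel) = (\<integral>y. k y \<partial>distr lborel borel ((+) (- x)))" by (simp only: lborel_distr_plus)
  also have "\<dots> = (\<integral>y. k (- x + y) \<partial>lborel)" by (intro integral_distr) auto
  finally show ?thesis by simp
qed

lemma integrable_translate:
  fixes k :: "'a::euclidean_space \<Rightarrow> real"
  assumes k: "integrable lborel k"
  shows "integrable lborel (\<lambda>y. k (y - x))"
proof -
  have [measurable]: "k \<in> borel_measurable borel" using k by auto
  have "integrable (distr lborel borel ((+) (- x))) k" using k by (simp only: lborel_distr_plus)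
  then have "integrable lborel (\<lambda>y. k (- x + y))" by (subst (asm) integrable_distr_eq) auto
  then show ?thesis by simp
qed

lemma corner_bump_product_integrable:
  fixes f :: "'a::euclidean_space \<Rightarrow> real"
  assumes [measurable]: "f \<in> borel_measurable borel"
    and f: "\<And>R. integrable lborel (\<lambda>y. indicator (ball 0 R) y *\<^sub>R f y)" and h: "0 < h"
  shows "integrable lborel (\<lambda>y. f y * corner_bump h (y - x))"
proof -
  let ?R = "h * (norm (One :: 'a) + 1) + norm x"
  have "integrable lborel (\<lambda>y. f y *\<^sub>R corner_bump h (y - x))"
  proof (rule bounded_support_product_integrable[OF f, where B=1 and R="?R"])
    fix y :: 'a assume y: "y \<notin> ball 0 ?R"
    show "corner_bump h (y - x) = 0"
    proof (rule ccontr)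
      assume "corner_bump h (y - x) \<noteq> 0"
      from corner_bump_support(2)[OF h this] norm_triangle_ineq[of "y - x" x] y show False by simp
    qed
  qed (auto simp: corner_bump_bounds abs_of_nonneg)
  then show ?thesis by simp
qed

lemma mollify_tendsto:
  fixes f :: "'a::euclidean_space \<Rightarrow> real"
  assumes [measurable]: "f \<in> borel_measurable borel"
    and f: "\<And>R. integrable lborel (\<lambda>y. indicator (ball 0 R) y *\<^sub>R f y)"
  shows "AE x in lborel. (\<lambda>k. mollify (1 / real (Suc k)) f x) \<longlonglongrightarrow> f x"
  using lebesgue_points[OF assms]
proof eventually_elim
  case (elim x)
  define c where "c = exp (- (4/3)) * omega TYPE('a) / 4 ^ DIM('a)"
  have c: "0 < c" using omega_pos[where 'a='a] by (simp add: c_def)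
  show ?case
  proof (rule LIMSEQ_I)
    fix r :: real assume r: "0 < r"
    \<comment> \<open>Scaled so that e h^n \<le> (r / 2) Z, in view of c h^n \<le> Z for the mass
      \<open>Z\<close> of the bump.\<close>
    define e where "e = r * c / 2"
    have "0 < e" using r c by (simp add: e_def)
    with elim obtain d where d: "0 < d" "\<And>h. 0 < h \<Longrightarrow> h < d \<Longrightarrow>
      (\<integral>y. indicator (cbox x (x + h *\<^sub>R One)) y * \<bar>f y - f x\<bar> \<partial>lborel) \<le> e * h ^ DIM('a)"
      by blast
    obtain K :: nat where K: "inverse (real (Suc K)) < d" using reals_Archimedean[OF d(1)] by blast
    show "\<exists>K. \<forall>k\<ge>K. norm (mollify (1 / real (Suc k)) f x - f x) < r"
    proof (intro exI[of _ K] allI impI)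
      fix k assume "K \<le> k"
      define h where "h = 1 / real (Suc k)"
      have "h \<le> inverse (real (Suc K))" using \<open>K \<le> k\<close> by (simp add: h_def inverse_eq_divide divide_left_mono)
      then have h: "0 < h" "h < d" using K by (auto simp: h_def)
      define Z where "Z = (\<integral>z. corner_bump h (z::'a) \<partial>lborel)"
      have Z: "0 < Z" "c * h ^ DIM('a) \<le> Z"
        using corner_bump_mass_pos[OF h(1), where 'a='a] corner_bump_mass[OF h(1), where 'a='a] by (auto simp: Z_def c_def power_divide)
      have wi: "integrable lborel (\<lambda>y. corner_bump h (y - x))" by (intro integrable_translate corner_bump_integrable h)
      have fi: "integrable lborel (\<lambda>y. f y * corner_bump h (y - x))" by (intro corner_bump_product_integrable f h) measurable
      have B: "integrable lborel (\<lambda>y. indicator (cbox x (x + h *\<^sub>R One)) y * \<bar>f y - f x\<bar>)"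
      proof -
        obtain R where R: "cbox x (x + h *\<^sub>R One) \<subseteq> ball 0 R"
          using bounded_subset_ballD[OF bounded_cbox, of x "x + h *\<^sub>R One" 0] by blast
        have "integrable lborel (\<lambda>y. \<bar>indicator (ball 0 R) y *\<^sub>R f y\<bar> + \<bar>f x\<bar> * indicator (ball 0 R) y)"
          using f[of R] emeasure_lborel_ball_finite
          by (intro Bochner_Integration.integrable_add integrable_mult_right integrable_abs integrable_real_indicator) auto
        then show ?thesis
          by (rule Bochner_Integration.integrable_bound) (use R in \<open>auto intro!: AE_I2 simp: indicator_def\<close>)
      qed
      have "(mollify h f x - f x) * Z = (\<integral>y. f y * corner_bump h (y - x) \<partial>lborel) - f x * (\<integral>y. corner_bump h (y - x) \<partial>lborel)"
        using Z by (simp add: mollify_def Z_def integral_translate field_simps)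
      also have "\<dots> = (\<integral>y. f y * corner_bump h (y - x) - f x * corner_bump h (y - x) \<partial>lborel)"
        using wi fi by simp
      finally have eq: "(mollify h f x - f x) * Z = (\<integral>y. f y * corner_bump h (y - x) - f x * corner_bump h (y - x) \<partial>lborel)" .
      have "\<bar>(mollify h f x - f x) * Z\<bar> \<le> (\<integral>y. indicator (cbox x (x + h *\<^sub>R One)) y * \<bar>f y - f x\<bar> \<partial>lborel)"
        unfolding eq
      proof (rule integral_abs_bound[THEN order_trans], rule integral_mono)
        show "integrable lborel (\<lambda>y. \<bar>f y * corner_bump h (y - x) - f x * corner_bump h (y - x)\<bar>)" using wi fi by simp
        fix y
        show "\<bar>f y * corner_bump h (y - x) - f x * corner_bump h (y - x)\<bar> \<le> indicator (cbox x (x + h *\<^sub>R One)) y * \<bar>f y - f x\<bar>"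
        proof (cases "corner_bump h (y - x) = 0")
          case False
          from corner_bump_support(1)[OF h(1) this] have "y \<in> cbox x (x + h *\<^sub>R One)"
            by (auto simp: mem_box inner_diff_left inner_add_left)
          moreover have "\<bar>f y * corner_bump h (y - x) - f x * corner_bump h (y - x)\<bar> = \<bar>f y - f x\<bar> * corner_bump h (y - x)"
            using corner_bump_bounds[of h "y - x"] by (simp add: abs_mult flip: left_diff_distrib)
          moreover have "\<dots> \<le> \<bar>f y - f x\<bar> * 1" by (intro mult_left_mono corner_bump_bounds) auto
          ultimately show ?thesis by simp
        qed simp
      qed (rule B)
      also have "\<dots> \<le> e * h ^ DIM('a)" by (rule d(2)[OF h])
      also have "\<dots> = r / 2 * (c * h ^ DIM('a))" by (simp add: e_def)
      also have "\<dots> \<le> r / 2 * Z" using r Z by (intro mult_left_mono) auto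
      finally have "\<bar>mollify h f x - f x\<bar> * Z \<le> r / 2 * Z" using Z by (simp add: abs_mult)
      then have "\<bar>mollify h f x - f x\<bar> \<le> r / 2" using Z by (meson mult_right_le_imp_le)
      then show "norm (mollify (1 / real (Suc k)) f x - f x) < r" using r by (simp add: h_def)
    qed
  qed
qed

lemma mollify_measurable [measurable]:
  fixes f :: "'a::euclidean_space \<Rightarrow> real"
  assumes [measurable]: "f \<in> borel_measurable borel"
  shows "mollify h f \<in> borel_measurable borel"
  unfolding mollify_def by measurable

lemma seg_bound_cmult:
  assumes [measurable]: "g \<in> borel_measurable borel" and sb: "seg_bound f g" and a: "0 \<le> a"
  shows "seg_bound (\<lambda>x. a * f x) (\<lambda>x. ennreal a * g x)"
  unfolding seg_bound_def
proof (intro allI)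
  fix x z
  have "ennreal \<bar>a * f z - a * f x\<bar> = ennreal a * ennreal \<bar>f z - f x\<bar>"
    using a by (simp add: abs_mult flip: right_diff_distrib ennreal_mult)
  also have "\<dots> \<le> ennreal a * (ennreal (dist x z) * (\<integral>\<^sup>+ t\<in>{0<..1}. g (x + t *\<^sub>R (z - x)) \<partial>lborel))"
    using sb by (intro mult_left_mono) (auto simp: seg_bound_def)
  also have "\<dots> = ennreal (dist x z) * (\<integral>\<^sup>+ t\<in>{0<..1}. ennreal a * g (x + t *\<^sub>R (z - x)) \<partial>lborel)"
    by (simp add: nn_integral_cmult mult_ac)
  finally show "ennreal \<bar>a * f z - a * f x\<bar> \<le> \<dots>" .
qed

section \<open>Averaging operators and the endpoint estimate for Sobolev functions\<close>

context maximal_norm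
begin

text \<open>By duality the kernel is moved to the weight, where it becomes at most \<open>A\<close>
  times an average over a ball about y, hence at most \<open>A\<close> times \<open>Mx u\<close>.
  The constant does not depend on \<rho>, so the bound is uniform over all scales of
  mollification.\<close>

lemma N_averaging:
  fixes K :: "'a \<Rightarrow> 'a \<Rightarrow> ennreal"
  assumes [measurable]: "(\<lambda>(x, y). K x y) \<in> borel_measurable (lborel \<Otimes>\<^sub>M lborel)" "g \<in> borel_measurable borel"
    and K: "\<And>x y. K x y \<le> ennreal (A / (omega TYPE('a) * \<rho> ^ DIM('a))) * indicator (ball y \<rho>) x"
    and A: "0 \<le> A" and \<rho>: "0 < \<rho>" and fin: "N g < \<infinity>"
  shows "N (\<lambda>x. \<integral>\<^sup>+ y. K x y * g y \<partial>lborel) \<le> ennreal (A * L) * N g"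
proof (rule Lorentz_Luxemburg)
  fix u :: "'a \<Rightarrow> ennreal" assume [measurable]: "u \<in> borel_measurable borel" and u: "dual_le u 1"
  have om: "0 < omega TYPE('a) * \<rho> ^ DIM('a)" using \<rho> omega_pos[where 'a='a] by simp
  have "(\<integral>\<^sup>+ x. u x * (\<integral>\<^sup>+ y. K x y * g y \<partial>lborel) \<partial>lborel) = (\<integral>\<^sup>+ x. \<integral>\<^sup>+ y. u x * (K x y * g y) \<partial>lborel \<partial>lborel)"
    by (intro nn_integral_cong nn_integral_cmult[symmetric]) measurable
  also have "\<dots> = (\<integral>\<^sup>+ y. \<integral>\<^sup>+ x. u x * (K x y * g y) \<partial>lborel \<partial>lborel)"
    by (rule lborel_pair.Fubini'[symmetric]) measurable
  also have "\<dots> \<le> (\<integral>\<^sup>+ y. ennreal A * (g y * Mx u y) \<partial>lborel)"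
  proof (intro nn_integral_mono)
    fix y
    have "(\<integral>\<^sup>+ x. u x * (K x y * g y) \<partial>lborel) \<le> (\<integral>\<^sup>+ x. (ennreal (A / (omega TYPE('a) * \<rho> ^ DIM('a))) * g y) * (u x * indicator (ball y \<rho>) x) \<partial>lborel)"
    proof (intro nn_integral_mono)
      fix x
      have "u x * (K x y * g y) \<le> u x * ((ennreal (A / (omega TYPE('a) * \<rho> ^ DIM('a))) * indicator (ball y \<rho>) x) * g y)"
        by (intro mult_left_mono mult_right_mono K) auto
      then show "u x * (K x y * g y) \<le> (ennreal (A / (omega TYPE('a) * \<rho> ^ DIM('a))) * g y) * (u x * indicator (ball y \<rho>) x)"
        by (simp only: mult_ac)
    qed
    also have "\<dots> = (ennreal (A / (omega TYPE('a) * \<rho> ^ DIM('a))) * g y) * (\<integral>\<^sup>+ x\<in>ball y \<rho>. u x \<partial>lborel)"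
      by (intro nn_integral_cmult) measurable
    also have "\<dots> = (ennreal (A / (omega TYPE('a) * \<rho> ^ DIM('a))) * ennreal (omega TYPE('a) * \<rho> ^ DIM('a))) * (g y * avg y \<rho> u)"
      by (simp only: ball_integral_eq[OF \<rho>] mult_ac)
    also have "ennreal (A / (omega TYPE('a) * \<rho> ^ DIM('a))) * ennreal (omega TYPE('a) * \<rho> ^ DIM('a)) = ennreal A"
    proof -
      have "ennreal (A / m) * ennreal m = ennreal A" if "0 < m" for m using that A by (simp flip: ennreal_mult)
      then show ?thesis using om by blast
    qed
    also have "ennreal A * (g y * avg y \<rho> u) \<le> ennreal A * (g y * Mx u y)"
      by (intro mult_left_mono avg_le_Mx \<rho>) auto
    finally show "(\<integral>\<^sup>+ x. u x * (K x y * g y) \<partial>lborel) \<le> ennreal A * (g y * Mx u y)" .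
  qed
  also have "\<dots> = ennreal A * (\<integral>\<^sup>+ y. Mx u y * g y \<partial>lborel)"
    by (subst nn_integral_cmult) (auto simp: mult.commute)
  also have "\<dots> \<le> ennreal A * (ennreal L * N g)"
    using dual_le_D[OF dual_Mx[OF _ u] _ _ fin] by (intro mult_left_mono) auto
  also have "\<dots> = ennreal (A * L) * N g" using A L_pos by (simp add: ennreal_mult mult.assoc)
  finally show "(\<integral>\<^sup>+ x. u x * (\<integral>\<^sup>+ y. K x y * g y \<partial>lborel) \<partial>lborel) \<le> ennreal (A * L) * N g" .
qed measurable

text \<open>Apart from \<open>L\<close>, this bounds the quotient of the normalised bump by the
  normalised indicator of a ball that contains its support. The mass is at least exp(-4/3) times the
  volume for radius h/4, and the support lies within h (|One| + 1) of the point, so h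
  cancels.\<close>

definition sobolev_const :: real where
  "sobolev_const = exp (4/3) * (4 * (norm (One :: 'a) + 1)) ^ DIM('a) * L"

text \<open>The mollified functions satisfy the segment bound with gradients of uniformly bounded
  norm. The inequality that defines \<open>Dset\<close> is strict, so almost every pair in the level
  set of \<open>f\<close> eventually belongs to the level sets of the mollified functions; the lower
  limit of their integrands therefore dominates that of \<open>f\<close>.\<close>

lemma level_int_sobolev:
  assumes [measurable]: "f \<in> borel_measurable borel" "G \<in> borel_measurable borel"
    and f: "\<And>R. integrable lborel (\<lambda>y. indicator (ball 0 R) y *\<^sub>R f y)"
    and weak: "\<And>\<phi> G\<phi>. test_fn \<phi> \<Longrightarrow> (\<And>x. (\<phi> has_derivative (\<lambda>h. G\<phi> x \<bullet> h)) (at x)) \<Longrightarrow>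
        (\<integral>x. f x *\<^sub>R G\<phi> x \<partial>lborel) = - (\<integral>x. \<phi> x *\<^sub>R G x \<partial>lborel)"
    and G: "\<And>R. integrable lborel (\<lambda>y. indicator (ball 0 R) y *\<^sub>R G y)"
    and fin: "N (\<lambda>x. ennreal (norm (G x))) < \<infinity>"
    and C: "\<And>f g u. f \<in> borel_measurable borel \<Longrightarrow> g \<in> borel_measurable borel \<Longrightarrow> u \<in> borel_measurable borel
     \<Longrightarrow> seg_bound f g \<Longrightarrow> N g < \<infinity> \<Longrightarrow> dual_le u 1 \<Longrightarrow>
     (\<integral>\<^sup>+ x. u x * level_int lam \<beta> \<sigma> \<gamma> f x \<partial>lborel) \<le> ennreal c * N g"
    and c: "0 \<le> c"
  shows "N (level_int lam \<beta> \<sigma> \<gamma> f) \<le> ennreal (c * sobolev_const) * N (\<lambda>x. ennreal (norm (G x)))"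
proof (rule Lorentz_Luxemburg)
  fix u :: "'a \<Rightarrow> ennreal" assume [measurable]: "u \<in> borel_measurable borel" and u: "dual_le u 1"
  let ?k = "\<lambda>x y. ennreal (dist x y powr (\<gamma> - real DIM('a)))"
  define fk where "fk k = mollify (1 / real (Suc k)) f" for k
  have [measurable]: "fk k \<in> borel_measurable borel" for k unfolding fk_def by measurable
  define a where "a k x y = u x * (indicator (Dset lam \<beta> \<sigma> (fk k)) (x, y) * ?k x y)" for k x y
  have [measurable]: "(\<lambda>(x, y). a k x y) \<in> borel_measurable (lborel \<Otimes>\<^sub>M lborel)" for k
    unfolding a_def by measurable
  let ?B = "ennreal (c * sobolev_const) * N (\<lambda>x. ennreal (norm (G x)))"
  have bound: "(\<integral>\<^sup>+ x. \<integral>\<^sup>+ y. a k x y \<partial>lborel \<partial>lborel) \<le> ?B" for k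
  proof -
    define h where "h = 1 / real (Suc k)"
    have h: "0 < h" by (simp add: h_def)
    define Z where "Z = (\<integral>z. corner_bump h (z::'a) \<partial>lborel)"
    have Z: "0 < Z" unfolding Z_def by (rule corner_bump_mass_pos[OF h])
    define g where "g x = (\<integral>\<^sup>+ y. (ennreal (1 / Z) * ennreal (corner_bump h (y - x))) * ennreal (norm (G y)) \<partial>lborel)" for x
    have [measurable]: "g \<in> borel_measurable borel" unfolding g_def by measurable
    have "seg_bound (\<lambda>x. (1 / Z) * (\<integral>y. f y * corner_bump h (y - x) \<partial>lborel))
       (\<lambda>x. ennreal (1 / Z) * (\<integral>\<^sup>+ y. ennreal (corner_bump h (y - x)) * ennreal (norm (G y)) \<partial>lborel))"
    proof (rule seg_bound_cmult)
      show "seg_bound (\<lambda>x. \<integral>y. f y * corner_bump h (y - x) \<partial>lborel) (\<lambda>x. \<integral>\<^sup>+ y. ennreal (corner_bump h (y - x)) * ennreal (norm (G y)) \<partial>lborel)"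
        unfolding corner_bump_def by (rule mollified_seg_bound[OF _ _ f weak G]) (use h in auto)
    qed (use Z in auto)
    moreover have "(\<lambda>x. (1 / Z) * (\<integral>y. f y * corner_bump h (y - x) \<partial>lborel)) = fk k"
      by (simp add: fk_def mollify_def[abs_def] Z_def h_def fun_eq_iff)
    moreover have "(\<lambda>x. ennreal (1 / Z) * (\<integral>\<^sup>+ y. ennreal (corner_bump h (y - x)) * ennreal (norm (G y)) \<partial>lborel)) = g"
      unfolding g_def by (simp add: nn_integral_cmult mult.assoc fun_eq_iff)
    ultimately have sb: "seg_bound (fk k) g" by simp
    define \<rho> where "\<rho> = h * (norm (One :: 'a) + 1)"
    define A where "A = exp (4/3) * (4 * (norm (One :: 'a) + 1)) ^ DIM('a)"
    have \<rho>: "0 < \<rho>" using h by (simp add: \<rho>_def add_nonneg_pos)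
    have Zinv: "1 / Z \<le> A / (omega TYPE('a) * \<rho> ^ DIM('a))"
    proof -
      have pos: "0 < exp (- (4/3)) * (omega TYPE('a) * (h / 4) ^ DIM('a))" using h omega_pos[where 'a='a] by simp
      have "1 / Z \<le> 1 / (exp (- (4/3)) * (omega TYPE('a) * (h / 4) ^ DIM('a)))"
        using corner_bump_mass[OF h, where 'a='a] Z pos by (intro divide_left_mono) (auto simp: Z_def)
      also have "\<dots> = A / (omega TYPE('a) * \<rho> ^ DIM('a))"
      proof -
        have "1 / (exp (- (4/3)) * (v * (h / 4) ^ DIM('a))) = exp (4/3) * (4 * r) ^ DIM('a) / (v * (h * r) ^ DIM('a))"
          if "0 < r" "0 < v" for r v :: real
          using h that by (simp add: power_mult_distrib power_divide exp_minus field_simps)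
        moreover have "0 < norm (One :: 'a) + 1" by (simp add: add_nonneg_pos)
        ultimately show ?thesis using omega_pos[where 'a='a] by (simp only: A_def \<rho>_def)
      qed
      finally show ?thesis .
    qed
    have "N g \<le> ennreal (A * L) * N (\<lambda>x. ennreal (norm (G x)))"
      unfolding g_def
    proof (rule N_averaging[OF _ _ _ _ \<rho> fin])
      fix x y :: 'a
      show "ennreal (1 / Z) * ennreal (corner_bump h (y - x)) \<le> ennreal (A / (omega TYPE('a) * \<rho> ^ DIM('a))) * indicator (ball y \<rho>) x"
      proof (cases "corner_bump h (y - x) = 0")
        case False
        then have "x \<in> ball y \<rho>" using corner_bump_support(2)[OF h False] by (simp add: \<rho>_def dist_norm)
        moreover have "ennreal (1 / Z) * ennreal (corner_bump h (y - x)) \<le> ennreal (A / (omega TYPE('a) * \<rho> ^ DIM('a))) * 1"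
          using Zinv corner_bump_bounds[of h "y - x"] by (intro mult_mono ennreal_leI) auto
        ultimately show ?thesis by simp
      qed simp
    qed (auto simp: A_def)
    then have Ng: "N g \<le> ennreal sobolev_const * N (\<lambda>x. ennreal (norm (G x)))" by (simp add: sobolev_const_def A_def)
    then have "N g < \<infinity>" using fin by (auto simp: ennreal_mult_less_top intro: le_less_trans)
    then have "(\<integral>\<^sup>+ x. u x * level_int lam \<beta> \<sigma> \<gamma> (fk k) x \<partial>lborel) \<le> ennreal c * N g"
      by (intro C sb u) auto
    also have "\<dots> \<le> ennreal c * (ennreal sobolev_const * N (\<lambda>x. ennreal (norm (G x))))"
      by (intro mult_left_mono Ng) auto
    also have "\<dots> = ?B" using c L_pos by (simp add: ennreal_mult mult.assoc sobolev_const_def)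
    also have "(\<integral>\<^sup>+ x. u x * level_int lam \<beta> \<sigma> \<gamma> (fk k) x \<partial>lborel) = (\<integral>\<^sup>+ x. \<integral>\<^sup>+ y. a k x y \<partial>lborel \<partial>lborel)"
      unfolding a_def level_int_def by (intro nn_integral_cong nn_integral_cmult[symmetric]) measurable
    finally show ?thesis .
  qed
  have conv: "AE x in lborel. (\<lambda>k. fk k x) \<longlonglongrightarrow> f x"
    unfolding fk_def by (rule mollify_tendsto[OF _ f]) measurable
  have "(\<integral>\<^sup>+ x. u x * level_int lam \<beta> \<sigma> \<gamma> f x \<partial>lborel) = (\<integral>\<^sup>+ x. \<integral>\<^sup>+ y. u x * (indicator (Dset lam \<beta> \<sigma> f) (x, y) * ?k x y) \<partial>lborel \<partial>lborel)"
    unfolding level_int_def by (intro nn_integral_cong nn_integral_cmult[symmetric]) measurable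
  also have "\<dots> \<le> (\<integral>\<^sup>+ x. \<integral>\<^sup>+ y. liminf (\<lambda>k. a k x y) \<partial>lborel \<partial>lborel)"
  proof (rule nn_integral_mono_AE)
    show "AE x in lborel. (\<integral>\<^sup>+ y. u x * (indicator (Dset lam \<beta> \<sigma> f) (x, y) * ?k x y) \<partial>lborel) \<le> (\<integral>\<^sup>+ y. liminf (\<lambda>k. a k x y) \<partial>lborel)"
      using conv
    proof eventually_elim
      case x: (elim x)
      show ?case
      proof (rule nn_integral_mono_AE)
        show "AE y in lborel. u x * (indicator (Dset lam \<beta> \<sigma> f) (x, y) * ?k x y) \<le> liminf (\<lambda>k. a k x y)"
          using conv
        proof eventually_elim
          case y: (elim y)
          show ?case
          proof (cases "(x, y) \<in> Dset lam \<beta> \<sigma> f")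
            case True
            have "(\<lambda>k. \<bar>fk k x - fk k y\<bar> / dist x y powr (\<sigma> + \<beta>)) \<longlonglongrightarrow> \<bar>f x - f y\<bar> / dist x y powr (\<sigma> + \<beta>)"
              using True by (intro tendsto_intros x y) (auto simp: Dset_def)
            then have "\<forall>\<^sub>F k in sequentially. lam < \<bar>fk k x - fk k y\<bar> / dist x y powr (\<sigma> + \<beta>)"
              using True by (intro order_tendstoD) (auto simp: Dset_def)
            then have "\<forall>\<^sub>F k in sequentially. u x * (indicator (Dset lam \<beta> \<sigma> f) (x, y) * ?k x y) \<le> a k x y"
              by eventually_elim (use True in \<open>auto simp: a_def Dset_def\<close>)
            then show ?thesis by (rule Liminf_bounded)
          qed simp
        qed
      qed
    qed
  qed
  also have "\<dots> \<le> (\<integral>\<^sup>+ x. liminf (\<lambda>k. \<integral>\<^sup>+ y. a k x y \<partial>lborel) \<partial>lborel)"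
    by (intro nn_integral_mono nn_integral_liminf) measurable
  also have "\<dots> \<le> liminf (\<lambda>k. \<integral>\<^sup>+ x. \<integral>\<^sup>+ y. a k x y \<partial>lborel \<partial>lborel)"
    by (intro nn_integral_liminf) measurable
  also have "\<dots> \<le> liminf (\<lambda>k::nat. ?B)" by (intro Liminf_mono always_eventually allI bound)
  also have "\<dots> = ?B" by (simp add: Liminf_const)
  finally show "(\<integral>\<^sup>+ x. u x * level_int lam \<beta> \<sigma> \<gamma> f x \<partial>lborel) \<le> ?B" .
qed measurable

end

section \<open>Ball Banach function spaces\<close>

lemma borel_imp_meas: "f \<in> borel_measurable borel \<Longrightarrow> f \<in> meas"
  unfolding meas_def by (rule measurable_completion) simp

lemma AE_lebesgue_iff: "(AE x in lebesgue. P x) \<longleftrightarrow> (AE x in lborel. P x)"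
  by (rule AE_completion_iff)

lemma meas_AE_borel:
  assumes "f \<in> meas"
  obtains f' where "f' \<in> borel_measurable borel" "AE x in lborel. f x = f' x"
  using completion_ex_borel_measurable_real[of f lborel] assms unfolding meas_def by auto

lemma meas_cong_AE: "f \<in> meas \<Longrightarrow> AE x in lborel. f x = g x \<Longrightarrow> g \<in> meas"
  unfolding meas_def by (rule borel_measurable_AE) (auto simp: AE_lebesgue_iff)

lemma ennreal_mult_unbounded:
  assumes "0 < a" "\<And>j::nat. of_nat j * a \<le> s"
  shows "s = (\<infinity> :: ennreal)"
proof -
  have "(SUP j::nat. of_nat j * a) \<le> s" using assms(2) by (intro SUP_least)
  also have "(SUP j::nat. of_nat j * a) = (SUP j::nat. of_nat j) * a" by (simp add: SUP_mult_right_ennreal)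
  also have "\<dots> = \<infinity>" using assms(1) by (simp add: ennreal_SUP_of_nat_eq_top ennreal_top_mult)
  finally show ?thesis by (simp add: top_unique)
qed

locale ball_space =
  fixes X :: "'a::euclidean_space qnorm"
  assumes ball_Banach: "ball_Banach_fs X"
begin

lemma X_cmult: "f \<in> meas \<Longrightarrow> X (\<lambda>x. c * f x) = ennreal \<bar>c\<bar> * X f"
  using ball_Banach unfolding ball_Banach_fs_def ball_quasi_Banach_fs_def by blast

lemma X_add: "f \<in> meas \<Longrightarrow> g \<in> meas \<Longrightarrow> X (\<lambda>x. f x + g x) \<le> X f + X g"
  using ball_Banach unfolding ball_Banach_fs_def by blast

lemma X_eq_0: "f \<in> meas \<Longrightarrow> X f = 0 \<Longrightarrow> AE x in lborel. f x = 0"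
  using ball_Banach unfolding ball_Banach_fs_def ball_quasi_Banach_fs_def AE_lebesgue_iff by blast

lemma X_mono: "f \<in> meas \<Longrightarrow> g \<in> meas \<Longrightarrow> AE x in lborel. \<bar>g x\<bar> \<le> \<bar>f x\<bar> \<Longrightarrow> X g \<le> X f"
  using ball_Banach unfolding ball_Banach_fs_def ball_quasi_Banach_fs_def AE_lebesgue_iff by blast

lemma X_Fatou:
  assumes "f \<in> meas" "\<And>m::nat. F m \<in> meas" "\<And>m. AE x in lborel. 0 \<le> F m x \<and> F m x \<le> F (Suc m) x"
    "AE x in lborel. (\<lambda>m. F m x) \<longlonglongrightarrow> f x"
  shows "X f = (SUP m. X (F m))"
proof -
  have "incseq (\<lambda>m. X (F m)) \<and> (\<lambda>m. X (F m)) \<longlonglongrightarrow> X f"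
    using ball_Banach assms unfolding ball_Banach_fs_def ball_quasi_Banach_fs_def AE_lebesgue_iff by blast
  then show ?thesis using LIMSEQ_SUP[of "\<lambda>m. X (F m)"] LIMSEQ_unique by blast
qed

lemma X_ball: "X (indicator (ball c r)) < \<infinity>"
  using ball_Banach unfolding ball_Banach_fs_def ball_quasi_Banach_fs_def by blast

lemma X_cong_AE:
  assumes "f \<in> meas" "AE x in lborel. f x = g x"
  shows "X f = X g"
proof -
  have "g \<in> meas" using assms by (rule meas_cong_AE)
  then show ?thesis using assms by (intro antisym X_mono) (auto elim: eventually_mono)
qed

lemma X_const_0: "X (\<lambda>_. 0) = 0"
  using X_cmult[of "\<lambda>_. 0" 0] by (simp add: borel_imp_meas)

lemma Xext_real: "f \<in> borel_measurable borel \<Longrightarrow> Xext X (\<lambda>x. ennreal \<bar>f x\<bar>) = X f"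
  unfolding Xext_def
  by (auto intro!: antisym X_mono simp: borel_imp_meas)

lemma Xext_cong_AE:
  assumes [measurable]: "H \<in> borel_measurable borel" and eq: "AE x in lborel. F x = H x"
  shows "Xext X F = Xext X H"
proof -
  have "(AE x in lborel. F x < \<infinity>) \<longleftrightarrow> (AE x in lborel. H x < \<infinity>)"
  proof
    show "AE x in lborel. H x < \<infinity>" if "AE x in lborel. F x < \<infinity>"
      using that eq by eventually_elim simp
    show "AE x in lborel. F x < \<infinity>" if "AE x in lborel. H x < \<infinity>"
      using that eq by eventually_elim simp
  qed
  moreover have "X (\<lambda>x. enn2real (H x)) = X (\<lambda>x. enn2real (F x))"
  proof (rule X_cong_AE)
    show "(\<lambda>x. enn2real (H x)) \<in> meas" by (rule borel_imp_meas) measurable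
    show "AE x in lborel. enn2real (H x) = enn2real (F x)" using eq by eventually_elim simp
  qed
  ultimately show ?thesis by (simp add: Xext_def AE_lebesgue_iff)
qed

sublocale function_norm "Xext X"
proof
  fix F H :: "'a \<Rightarrow> ennreal"
  assume [measurable]: "F \<in> borel_measurable borel" "H \<in> borel_measurable borel"
  show "Xext X F \<le> Xext X H" if le: "AE x in lborel. F x \<le> H x"
  proof (cases "AE x in lborel. H x < \<infinity>")
    case True
    have fin: "AE x in lborel. F x < \<infinity>" using le True by eventually_elim (rule le_less_trans)
    have "AE x in lborel. \<bar>enn2real (F x)\<bar> \<le> \<bar>enn2real (H x)\<bar>"
      using le True by eventually_elim (auto intro: enn2real_mono)
    then have "X (\<lambda>x. enn2real (F x)) \<le> X (\<lambda>x. enn2real (H x))"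
      by (intro X_mono borel_imp_meas) measurable
    then show ?thesis using True fin by (simp add: Xext_def AE_lebesgue_iff)
  qed (simp add: Xext_def AE_lebesgue_iff)
  show "Xext X (\<lambda>x. F x + H x) \<le> Xext X F + Xext X H"
  proof (cases "(AE x in lborel. F x < \<infinity>) \<and> (AE x in lborel. H x < \<infinity>)")
    case True
    have m: "(\<lambda>x. enn2real (F x)) \<in> meas" "(\<lambda>x. enn2real (H x)) \<in> meas" by (auto intro!: borel_imp_meas)
    have "AE x in lborel. enn2real (F x) + enn2real (H x) = enn2real (F x + H x)"
      using conjunct1[OF True] conjunct2[OF True] by eventually_elim (simp add: enn2real_plus)
    then have "X (\<lambda>x. enn2real (F x + H x)) = X (\<lambda>x. enn2real (F x) + enn2real (H x))"
      by (intro X_cong_AE[symmetric] borel_imp_meas) measurable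
    also have "\<dots> \<le> X (\<lambda>x. enn2real (F x)) + X (\<lambda>x. enn2real (H x))" by (rule X_add[OF m])
    finally show ?thesis using True by (simp add: Xext_def AE_lebesgue_iff)
  qed (auto simp: Xext_def AE_lebesgue_iff)
next
  fix F :: "'a \<Rightarrow> ennreal" and c :: real
  assume [measurable]: "F \<in> borel_measurable borel"
  show "Xext X (\<lambda>x. ennreal c * F x) = ennreal c * Xext X F"
  proof (cases "0 < c")
    case False
    then show ?thesis by (simp add: ennreal_neg not_less Xext_def X_const_0)
  next
    case True
    have "ennreal c * F x < \<infinity> \<longleftrightarrow> F x < \<infinity>" for x using True by (auto simp: ennreal_mult_less_top)
    moreover have "X (\<lambda>x. enn2real (ennreal c * F x)) = ennreal c * X (\<lambda>x. enn2real (F x))"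
      using True X_cmult[of "\<lambda>x. enn2real (F x)" c] by (simp add: enn2real_mult borel_imp_meas)
    moreover have "ennreal c * \<infinity> = \<infinity>" using True by (simp add: ennreal_mult_top)
    ultimately show ?thesis by (simp only: Xext_def) simp
  qed
next
  fix F :: "nat \<Rightarrow> 'a \<Rightarrow> ennreal"
  assume Fm [measurable]: "\<And>k. F k \<in> borel_measurable borel" and inc: "incseq F"
  let ?S = "\<lambda>x. SUP k. F k x"
  have incx: "F k x \<le> F (Suc k) x" "F k x \<le> ?S x" for k x
    using inc by (auto simp: incseq_Suc_iff le_fun_def intro: SUP_upper)
  show "Xext X ?S \<le> (SUP k. Xext X (F k))"
  proof (cases "AE x in lborel. ?S x < \<infinity>")
    case True
    have fin: "AE x in lborel. F k x < \<infinity>" for k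
      using True by eventually_elim (rule le_less_trans[OF incx(2)])
    have "X (\<lambda>x. enn2real (?S x)) = (SUP k. X (\<lambda>x. enn2real (F k x)))"
    proof (rule X_Fatou)
      show "AE x in lborel. 0 \<le> enn2real (F k x) \<and> enn2real (F k x) \<le> enn2real (F (Suc k) x)" for k
        using fin[of "Suc k"] by eventually_elim (auto intro: enn2real_mono incx)
      show "AE x in lborel. (\<lambda>k. enn2real (F k x)) \<longlonglongrightarrow> enn2real (?S x)"
        using True
      proof eventually_elim
        case (elim x)
        have "(\<lambda>k. F k x) \<longlonglongrightarrow> ?S x" using incx by (intro LIMSEQ_SUP incseq_SucI) auto
        then have "(\<lambda>k. F k x) \<longlonglongrightarrow> ennreal (enn2real (?S x))" using elim by simp
        then show ?case by (rule tendsto_enn2real) simp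
      qed
    qed (auto intro!: borel_imp_meas)
    then show ?thesis using True fin by (simp add: Xext_def AE_lebesgue_iff)
  next
    case False
    have "(SUP k. Xext X (F k)) = \<infinity>"
    proof (cases "\<forall>k. AE x in lborel. F k x < \<infinity>")
      case nfin: False
      then obtain k where "\<not> (AE x in lborel. F k x < \<infinity>)" by blast
      then have "Xext X (F k) = \<infinity>" by (simp add: Xext_def AE_lebesgue_iff)
      then show ?thesis by (metis SUP_upper UNIV_I infinity_ennreal_def top_unique)
    next
      case fin: True
      \<comment> \<open>On the set where the supremum is infinite, the truncations of F k at height
        j increase to j. Hence the supremum of the norms is at least j times the norm of the
        indicator of \<open>E\<close>, for every j, and this norm is positive.\<close>
      define E where "E = {x. ?S x = \<infinity>}"
      have [measurable]: "E \<in> sets borel" unfolding E_def by measurable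
      have Em: "(indicator E :: 'a \<Rightarrow> real) \<in> meas" by (intro borel_imp_meas) measurable
      have pos: "0 < X (indicator E)"
      proof (rule ccontr)
        assume "\<not> 0 < X (indicator E)"
        then have "AE x in lborel. indicator E x = (0::real)" by (intro X_eq_0 Em) simp
        then have "AE x in lborel. ?S x < \<infinity>"
        proof eventually_elim
          case (elim x)
          then have "?S x \<noteq> \<infinity>" by (auto simp: E_def indicator_def split: if_splits)
          then show ?case by (simp only: infinity_ennreal_def top.not_eq_extremum)
        qed
        with False show False by simp
      qed
      show ?thesis
      proof (rule ennreal_mult_unbounded[OF pos])
        fix j :: nat
        let ?G = "\<lambda>k x. enn2real (min (F k x) (of_nat j)) * indicator E x"
        have "X (\<lambda>x. real j * indicator E x) = (SUP k. X (?G k))"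
        proof (rule X_Fatou)
          have "min (F k x) (of_nat j) \<le> min (F (Suc k) x) (of_nat j)" for k x using incx(1) by (intro min.mono) auto
          then have "enn2real (min (F k x) (of_nat j)) \<le> enn2real (min (F (Suc k) x) (of_nat j))" for k x
            by (intro enn2real_mono) (auto simp: min_less_iff_disj of_nat_less_top)
          then show "AE x in lborel. 0 \<le> ?G k x \<and> ?G k x \<le> ?G (Suc k) x" for k
            by (intro AE_I2) (auto simp: indicator_def)
          show "AE x in lborel. (\<lambda>k. ?G k x) \<longlonglongrightarrow> real j * indicator E x"
          proof (intro AE_I2)
            fix x
            show "(\<lambda>k. ?G k x) \<longlonglongrightarrow> real j * indicator E x"
            proof (cases "x \<in> E")
              case True
              then have "?S x = \<infinity>" by (simp add: E_def)
              then have "of_nat j < ?S x" by (simp only: infinity_ennreal_def of_nat_less_top)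
              then obtain k0 where k0: "of_nat j < F k0 x" by (auto simp: less_SUP_iff)
              have "of_nat j \<le> F k x" if "k0 \<le> k" for k
                using order_trans[OF less_imp_le[OF k0] lift_Suc_mono_le[of "\<lambda>k. F k x", OF incx(1) that]] .
              then have "\<forall>k\<ge>k0. ?G k x = real j * indicator E x" using True
                by (simp add: min_absorb2)
              then show ?thesis by (intro tendsto_eventually) (auto simp: eventually_sequentially)
            qed simp
          qed
        qed (auto intro!: borel_imp_meas)
        also have "\<dots> \<le> (SUP k. Xext X (F k))"
        proof (intro SUP_mono' )
          fix k
          have "X (?G k) \<le> X (\<lambda>x. enn2real (F k x))"
          proof (intro X_mono borel_imp_meas)
            show "AE x in lborel. \<bar>?G k x\<bar> \<le> \<bar>enn2real (F k x)\<bar>"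
              using spec[OF fin, of k] by eventually_elim (auto simp: indicator_def intro!: enn2real_mono)
          qed measurable
          then show "X (?G k) \<le> Xext X (F k)" using fin by (simp add: Xext_def AE_lebesgue_iff)
        qed
        also have "X (\<lambda>x. real j * indicator E x) = of_nat j * X (indicator E)"
          using X_cmult[OF Em, of "real j"] by (simp add: ennreal_of_nat_eq_real_of_nat)
        finally show "of_nat j * X (indicator E) \<le> (SUP k. Xext X (F k))" .
      qed
    qed
    then show ?thesis by (simp only: infinity_ennreal_def top_greatest)
  qed
next
  fix F :: "'a \<Rightarrow> ennreal"
  assume [measurable]: "F \<in> borel_measurable borel" and 0: "Xext X F = 0"
  then have fin: "AE x in lborel. F x < \<infinity>" and "X (\<lambda>x. enn2real (F x)) = 0"
    by (auto simp: Xext_def AE_lebesgue_iff split: if_splits)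
  then have "AE x in lborel. enn2real (F x) = 0" by (intro X_eq_0 borel_imp_meas) measurable
  with fin show "AE x in lborel. F x = 0" by eventually_elim (auto simp: enn2real_eq_0_iff)
next
  fix c r
  show "Xext X (indicator (ball c r)) < \<infinity>"
    using X_ball[of c r] Xext_real[of "indicator (ball c r)"] by (simp add: ennreal_indicator)
qed

end

section \<open>The maximal operator on associate spaces\<close>

lemma maxop_eq_Mx: "maxop f = Mx (\<lambda>x. ennreal \<bar>f x\<bar>)"
  by (simp add: maxop_def Mx_def ball_avg_def avg_def nn_integral_completion fun_eq_iff)

text \<open>\<open>M_opnorm\<close> is an infimum, whose own admissibility is not asserted; a
  strictly larger \<open>B\<close> lies above some admissible constant.\<close>

lemma M_bound_exists:
  assumes "M_opnorm Y < ennreal B"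
  shows "\<And>f. f \<in> meas \<Longrightarrow> Y f < \<infinity> \<Longrightarrow> Xext Y (maxop f) \<le> ennreal B * Y f"
proof -
  fix f :: "'a \<Rightarrow> real" assume f: "f \<in> meas" "Y f < \<infinity>"
  obtain C where C: "M_bound_const Y C" "C < ennreal B"
    using assms unfolding M_opnorm_def by (auto simp: Inf_less_iff)
  have "Xext Y (maxop f) \<le> C * Y f" using C(1) f by (auto simp: M_bound_const_def)
  also have "\<dots> \<le> ennreal B * Y f" using C(2) by (intro mult_right_mono) auto
  finally show "Xext Y (maxop f) \<le> ennreal B * Y f" .
qed

lemma Mx_SUP:
  fixes u :: "nat \<Rightarrow> 'a::euclidean_space \<Rightarrow> ennreal"
  assumes [measurable]: "\<And>k. u k \<in> borel_measurable borel" and inc: "incseq u"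
  shows "Mx (\<lambda>y. SUP k. u k y) x = (SUP k. Mx (u k) x)"
proof -
  have "avg x r (\<lambda>y. SUP k. u k y) = (SUP k. avg x r (u k))" for r
  proof -
    have "(\<integral>\<^sup>+ y\<in>ball x r. (SUP k. u k y) \<partial>lborel) = (\<integral>\<^sup>+ y. (SUP k. u k y * indicator (ball x r) y) \<partial>lborel)"
      by (simp add: SUP_mult_right_ennreal)
    also have "\<dots> = (SUP k. \<integral>\<^sup>+ y\<in>ball x r. u k y \<partial>lborel)"
      using inc by (intro nn_integral_monotone_convergence_SUP) (auto simp: incseq_def le_fun_def intro!: mult_right_mono)
    finally show ?thesis by (simp add: avg_def SUP_divide_ennreal)
  qed
  then show ?thesis unfolding Mx_def by (simp only:) (rule SUP_commute)
qed

context ball_space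
begin

lemma Mx_bounded:
  assumes "M_bounded X"
  shows "\<exists>A>0. \<forall>g\<in>borel_measurable borel. Xext X g < \<infinity> \<longrightarrow> Xext X (Mx g) \<le> ennreal A * Xext X g"
proof -
  obtain B where B: "M_opnorm X = ennreal B" "0 \<le> B" using assms by (cases "M_opnorm X") (auto simp: M_bounded_def)
  have lt: "M_opnorm X < ennreal (B + 1)" unfolding B(1) using B(2) by (intro ennreal_lessI) auto
  show ?thesis
  proof (intro exI[of _ "B + 1"] conjI ballI impI)
    show "0 < B + 1" using B by simp
    fix g :: "'a \<Rightarrow> ennreal" assume [measurable]: "g \<in> borel_measurable borel" and g: "Xext X g < \<infinity>"
    define f where "f x = enn2real (g x)" for x
    have f: "f \<in> meas" unfolding f_def by (intro borel_imp_meas) measurable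
    have fin: "AE x in lborel. g x < \<infinity>" and Xg: "Xext X g = X f"
      using g by (auto simp: Xext_def AE_lebesgue_iff f_def[abs_def] split: if_splits)
    have "AE x in lborel. ennreal \<bar>f x\<bar> = g x" using fin by eventually_elim (auto simp: f_def)
    then have "maxop f = Mx g" unfolding maxop_eq_Mx by (intro ext Mx_cong_AE)
    with M_bound_exists[OF lt f] g show "Xext X (Mx g) \<le> ennreal (B + 1) * Xext X g" by (simp add: Xg)
  qed
qed

text \<open>Young's inequality |g| \<le> (1 - \<theta>) + \<theta> |g|^(1/\<theta>) compares the two
  spaces: if g has norm 1 in X^(1/\<theta>), then |g|^(1/\<theta>) has norm 1 in X, and the dual
  bound of \<open>w\<close> takes care of the second term. The first costs the integral of
  \<open>w\<close> with a factor that vanishes as \<theta> tends to 1.\<close>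

lemma assoc_Xpow_bound:
  assumes \<theta>: "0 < \<theta>" "\<theta> < 1" and [measurable]: "w \<in> borel_measurable borel" and w: "\<And>x. 0 \<le> w x"
    and dual: "dual_le (\<lambda>x. ennreal (w x)) 1"
  shows "assoc (Xpow X (1 / \<theta>)) w \<le> ennreal (1 - \<theta>) * (\<integral>\<^sup>+ x. ennreal (w x) \<partial>lborel) + ennreal \<theta>"
  unfolding assoc_def
proof (intro SUP_least)
  fix g assume "g \<in> {g \<in> meas. Xpow X (1 / \<theta>) g = 1}"
  then have g: "g \<in> meas" and Yg: "Xpow X (1 / \<theta>) g = 1" by auto
  obtain g' where [measurable]: "g' \<in> borel_measurable borel" and gg': "AE x in lborel. g x = g' x"
    using meas_AE_borel[OF g] by blast
  let ?p = "\<lambda>x. \<bar>g' x\<bar> powr (1 / \<theta>)"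
  have gp: "X (\<lambda>x. \<bar>g x\<bar> powr (1 / \<theta>)) = X ?p"
  proof (rule X_cong_AE[symmetric])
    show "?p \<in> meas" by (rule borel_imp_meas) measurable
    show "AE x in lborel. ?p x = \<bar>g x\<bar> powr (1 / \<theta>)" using gg' by eventually_elim simp
  qed
  have "X ?p \<noteq> \<infinity>" and "enn2real (X ?p) powr \<theta> = 1"
    using Yg unfolding Xpow_def gp enn_powr_def by (auto split: if_splits)
  then have "(enn2real (X ?p) powr \<theta>) powr (1 / \<theta>) = 1" by simp
  then have "enn2real (X ?p) = 1" using \<theta> by (simp add: powr_powr)
  then have X1: "X ?p = 1" using \<open>X ?p \<noteq> \<infinity>\<close> by (cases "X ?p") auto
  have "Xext X (\<lambda>x. ennreal \<bar>?p x\<bar>) = X ?p" by (rule Xext_real) measurable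
  then have d: "(\<integral>\<^sup>+ x. ennreal (w x) * ennreal (?p x) \<partial>lborel) \<le> 1"
    using dual X1 unfolding dual_le_def by auto
  have "(\<integral>\<^sup>+ x. ennreal \<bar>w x * g x\<bar> \<partial>lebesgue) = (\<integral>\<^sup>+ x. ennreal \<bar>w x * g x\<bar> \<partial>lborel)" by (rule nn_integral_completion)
  also have "\<dots> \<le> (\<integral>\<^sup>+ x. ennreal (1 - \<theta>) * ennreal (w x) + ennreal \<theta> * (ennreal (w x) * ennreal (?p x)) \<partial>lborel)"
  proof (rule nn_integral_mono_AE)
    show "AE x in lborel. ennreal \<bar>w x * g x\<bar> \<le> ennreal (1 - \<theta>) * ennreal (w x) + ennreal \<theta> * (ennreal (w x) * ennreal (?p x))"
      using gg'
    proof eventually_elim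
      case (elim x)
      have "\<bar>g' x\<bar> \<le> (1 - \<theta>) + \<theta> * ?p x"
      proof (cases "g' x = 0")
        case False
        then have "1 powr (1 - \<theta>) * ?p x powr \<theta> \<le> (1 - \<theta>) * 1 + \<theta> * ?p x"
          using \<theta> by (intro Youngs_inequality_0) auto
        moreover have "?p x powr \<theta> = \<bar>g' x\<bar>" using \<theta> by (simp add: powr_powr)
        ultimately show ?thesis by simp
      qed (use \<theta> in simp)
      then have "\<bar>w x * g x\<bar> \<le> (1 - \<theta>) * w x + \<theta> * (w x * ?p x)"
        using mult_left_mono[of "\<bar>g' x\<bar>" "(1 - \<theta>) + \<theta> * ?p x" "w x"] w[of x] elim by (simp add: abs_mult algebra_simps)
      then have "ennreal \<bar>w x * g x\<bar> \<le> ennreal ((1 - \<theta>) * w x + \<theta> * (w x * ?p x))" by (rule ennreal_leI)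
      also have "\<dots> = ennreal (1 - \<theta>) * ennreal (w x) + ennreal \<theta> * (ennreal (w x) * ennreal (?p x))"
        using \<theta> w[of x] by (simp add: ennreal_plus ennreal_mult)
      finally show ?case .
    qed
  qed
  also have "\<dots> = ennreal (1 - \<theta>) * (\<integral>\<^sup>+ x. ennreal (w x) \<partial>lborel) + ennreal \<theta> * (\<integral>\<^sup>+ x. ennreal (w x) * ennreal (?p x) \<partial>lborel)"
    by (simp add: nn_integral_add nn_integral_cmult)
  also have "\<dots> \<le> ennreal (1 - \<theta>) * (\<integral>\<^sup>+ x. ennreal (w x) \<partial>lborel) + ennreal \<theta> * 1"
    using d by (intro add_mono mult_left_mono) auto
  finally show "(\<integral>\<^sup>+ x. ennreal \<bar>w x * g x\<bar> \<partial>lebesgue) \<le> ennreal (1 - \<theta>) * (\<integral>\<^sup>+ x. ennreal (w x) \<partial>lborel) + ennreal \<theta>" by simp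
qed

text \<open>From 0 \<le> h \<le> k one gets h^(1/\<theta>) \<le> k^(1/\<theta> - 1) h. The power
  \<theta> of the norm leaves k^(1-\<theta>), which tends to 1 as \<theta> does.\<close>

lemma Xpow_bounded_le:
  assumes \<theta>: "0 < \<theta>" "\<theta> < 1" and [measurable]: "h \<in> borel_measurable borel"
    and h: "\<And>x. 0 \<le> h x" "\<And>x. h x \<le> k" and k: "1 \<le> k" and X1: "X h \<le> 1"
  shows "Xpow X (1 / \<theta>) h \<le> ennreal (k powr (1 - \<theta>))"
proof -
  have hm: "h \<in> meas" by (rule borel_imp_meas) measurable
  have "X (\<lambda>x. \<bar>h x\<bar> powr (1 / \<theta>)) \<le> X (\<lambda>x. k powr (1 / \<theta> - 1) * h x)"
  proof (intro X_mono borel_imp_meas AE_I2)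
    fix x
    have "h x powr (1 / \<theta>) \<le> k powr (1 / \<theta> - 1) * h x"
    proof (cases "h x = 0")
      case False
      have "h x powr (1 / \<theta>) = h x powr (1 / \<theta> - 1 + 1)" by simp
      also have "\<dots> = h x powr (1 / \<theta> - 1) * h x powr 1" by (rule powr_add)
      also have "\<dots> \<le> k powr (1 / \<theta> - 1) * h x"
        using h[of x] \<theta> False by (intro mult_mono powr_mono2) auto
      finally show ?thesis .
    qed simp
    then show "\<bar>\<bar>h x\<bar> powr (1 / \<theta>)\<bar> \<le> \<bar>k powr (1 / \<theta> - 1) * h x\<bar>" using h(1)[of x] by simp
  qed measurable
  also have "\<dots> = ennreal (k powr (1 / \<theta> - 1)) * X h" using X_cmult[OF hm] by simp
  also have "\<dots> \<le> ennreal (k powr (1 / \<theta> - 1)) * 1" by (intro mult_left_mono X1) auto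
  finally have le: "X (\<lambda>x. \<bar>h x\<bar> powr (1 / \<theta>)) \<le> ennreal (k powr (1 / \<theta> - 1))" by simp
  then have "enn2real (X (\<lambda>x. \<bar>h x\<bar> powr (1 / \<theta>))) \<le> k powr (1 / \<theta> - 1)"
    using enn2real_mono[OF le] by simp
  then have "enn2real (X (\<lambda>x. \<bar>h x\<bar> powr (1 / \<theta>))) powr \<theta> \<le> (k powr (1 / \<theta> - 1)) powr \<theta>"
    using \<theta> by (intro powr_mono2) auto
  also have "\<dots> = k powr (1 - \<theta>)" using \<theta> by (simp add: powr_powr left_diff_distrib)
  finally show ?thesis using le unfolding Xpow_def enn_powr_def by (auto simp: ennreal_leI top_unique)
qed

text \<open>The operator bound on the associate of X^(1/\<theta>) is applied to \<open>w\<close>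
  through \<open>assoc_Xpow_bound\<close> and tested with \<open>h\<close> through
  \<open>Xpow_bounded_le\<close>. For fixed \<open>W\<close> and \<open>k\<close> both correction
  factors tend to 1 with \<theta>, so that only \<open>B\<close> survives.\<close>

lemma maximal_dual_bounded:
  assumes \<theta>: "0 < \<theta>" "\<theta> < 1" and Y: "ball_Banach_fs (Xpow X (1 / \<theta>))"
    and M: "M_opnorm (assoc (Xpow X (1 / \<theta>))) < ennreal B"
    and [measurable]: "w \<in> borel_measurable borel" "h \<in> borel_measurable borel"
    and w: "\<And>x. 0 \<le> w x" and W: "(\<integral>\<^sup>+ x. ennreal (w x) \<partial>lborel) = ennreal W" "0 \<le> W"
    and dual: "dual_le (\<lambda>x. ennreal (w x)) 1"
    and h: "\<And>x. 0 \<le> h x" "\<And>x. h x \<le> k" and k: "1 \<le> k" and X1: "X h \<le> 1" and B: "0 \<le> B"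
  shows "(\<integral>\<^sup>+ x. Mx (\<lambda>x. ennreal (w x)) x * ennreal (h x) \<partial>lborel)
     \<le> ennreal (B * ((1 - \<theta>) * W + \<theta>) * k powr (1 - \<theta>))"
proof -
  interpret Y: ball_space "Xpow X (1 / \<theta>)" using Y by unfold_locales
  let ?Y = "Xpow X (1 / \<theta>)" and ?Mw = "Mx (\<lambda>x. ennreal (w x))"
  define b where "b = (1 - \<theta>) * W + \<theta>"
  have b: "0 \<le> b" using \<theta> W by (simp add: b_def)
  have aw: "assoc ?Y w \<le> ennreal b"
    using assoc_Xpow_bound[OF \<theta> _ w dual] \<theta> W by (simp add: b_def ennreal_plus ennreal_mult)
  have "Xext (assoc ?Y) (maxop w) \<le> ennreal B * assoc ?Y w"
    by (rule M_bound_exists[OF M]) (use aw in \<open>auto intro: borel_imp_meas le_less_trans\<close>)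
  also have "\<dots> \<le> ennreal B * ennreal b" by (intro mult_left_mono aw) auto
  also have "maxop w = ?Mw" using w by (simp add: maxop_eq_Mx)
  finally have Mw: "Xext (assoc ?Y) ?Mw \<le> ennreal (B * b)" using B b by (simp add: ennreal_mult)
  then have fin: "AE x in lborel. ?Mw x < \<infinity>" and as: "assoc ?Y (\<lambda>x. enn2real (?Mw x)) \<le> ennreal (B * b)"
    by (auto simp: Xext_def AE_lebesgue_iff top_unique split: if_splits)
  have hm: "h \<in> meas" by (rule borel_imp_meas) measurable
  have Yh: "?Y h \<le> ennreal (k powr (1 - \<theta>))" by (rule Xpow_bounded_le[OF \<theta> _ h k X1]) measurable
  then obtain y where y: "?Y h = ennreal y" "0 \<le> y" by (cases "?Y h") (auto simp: top_unique)
  have yk: "y \<le> k powr (1 - \<theta>)" using Yh y by simp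
  have "(\<integral>\<^sup>+ x. ?Mw x * ennreal (h x) \<partial>lborel) \<le> ennreal (B * b) * ennreal y"
  \<comment> \<open>\<open>assoc\<close> tests on the unit sphere, so \<open>h\<close> has to be
    divided by its norm; if the norm is 0, then \<open>h\<close> vanishes almost everywhere.\<close>
  proof (cases "y = 0")
    case True
    then have "AE x in lborel. h x = 0" using Y.X_eq_0[OF hm] y by simp
    then have "AE x in lborel. ?Mw x * ennreal (h x) = 0" by eventually_elim simp
    then have "(\<integral>\<^sup>+ x. ?Mw x * ennreal (h x) \<partial>lborel) = (\<integral>\<^sup>+ (x::'a). 0 \<partial>lborel)" by (rule nn_integral_cong_AE)
    then show ?thesis by simp
  next
    case False
    define g where "g x = (1 / y) * h x" for x
    have [measurable]: "g \<in> borel_measurable borel" unfolding g_def by measurable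
    have "?Y g = ennreal (1 / y) * ennreal y"
      unfolding g_def using Y.X_cmult[OF hm, of "1 / y"] y False by simp
    also have "\<dots> = 1" using y False by (simp flip: ennreal_mult)
    finally have "g \<in> {g \<in> meas. ?Y g = 1}" by (auto intro!: borel_imp_meas)
    then have "(\<integral>\<^sup>+ x. ennreal \<bar>enn2real (?Mw x) * g x\<bar> \<partial>lebesgue) \<le> assoc ?Y (\<lambda>x. enn2real (?Mw x))"
      unfolding assoc_def by (rule SUP_upper)
    then have le: "(\<integral>\<^sup>+ x. ennreal \<bar>enn2real (?Mw x) * g x\<bar> \<partial>lborel) \<le> ennreal (B * b)"
      using as by (simp add: nn_integral_completion)
    have "AE x in lborel. ?Mw x * ennreal (h x) = ennreal y * ennreal \<bar>enn2real (?Mw x) * g x\<bar>"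
      using fin
    proof eventually_elim
      case (elim x)
      have "ennreal y * ennreal \<bar>enn2real (?Mw x) * g x\<bar> = ennreal (y * (enn2real (?Mw x) * (1 / y * h x)))"
        using y h(1)[of x] by (simp add: g_def abs_mult flip: ennreal_mult)
      also have "y * (enn2real (?Mw x) * (1 / y * h x)) = enn2real (?Mw x) * h x" using False by simp
      also have "ennreal \<dots> = ?Mw x * ennreal (h x)" using elim h(1)[of x] by (simp add: ennreal_mult)
      finally show ?case by simp
    qed
    then have "(\<integral>\<^sup>+ x. ?Mw x * ennreal (h x) \<partial>lborel) = (\<integral>\<^sup>+ x. ennreal y * ennreal \<bar>enn2real (?Mw x) * g x\<bar> \<partial>lborel)"
      by (rule nn_integral_cong_AE)
    also have "\<dots> = ennreal y * (\<integral>\<^sup>+ x. ennreal \<bar>enn2real (?Mw x) * g x\<bar> \<partial>lborel)"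
      by (intro nn_integral_cmult) measurable
    also have "\<dots> \<le> ennreal y * ennreal (B * b)" by (intro mult_left_mono le) auto
    finally show ?thesis by (simp add: mult.commute)
  qed
  also have "\<dots> = ennreal (B * b * y)" using B b y by (simp add: ennreal_mult)
  also have "\<dots> \<le> ennreal (B * b * k powr (1 - \<theta>))" using B b yk by (intro ennreal_leI mult_left_mono) auto
  finally show ?thesis by (simp add: b_def)
qed

text \<open>With weight and test function both truncated, m tends to infinity first; monotone
  convergence then removes the truncations. Passing from \<open>L\<close> to L + 1 makes the bound
  of the operator norms strict for all large m, as \<open>M_bound_exists\<close> requires.\<close>

lemma dual_maximal_operator:
  fixes \<theta> :: "nat \<Rightarrow> real" and L :: real
  assumes \<theta>: "\<And>m. 0 < \<theta> m \<and> \<theta> m < 1" "\<theta> \<longlonglongrightarrow> 1" and Y: "\<And>m. ball_Banach_fs (Xpow X (1 / \<theta> m))"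
    and L: "(\<lambda>m. M_opnorm (assoc (Xpow X (1 / \<theta> m)))) \<longlonglongrightarrow> ennreal L" "0 \<le> L"
    and [measurable]: "u \<in> borel_measurable borel" and u: "dual_le u 1"
  shows "dual_le (Mx u) (ennreal (L + 1))"
  unfolding dual_le_def
proof (intro ballI impI)
  fix h :: "'a \<Rightarrow> ennreal" assume [measurable]: "h \<in> borel_measurable borel" and h: "Xext X h \<le> 1"
  let ?u = "\<lambda>k x. ennreal (trunc k u x)" and ?h = "\<lambda>j x. ennreal (trunc j h x)"
  have bound: "(\<integral>\<^sup>+ x. Mx (?u k) x * ?h j x \<partial>lborel) \<le> ennreal (L + 1)" for k j
  proof -
    \<comment> \<open>The summand 1 ensures kk \<ge> 1 also for j = 0.\<close>
    define kk where "kk = real j + 1"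
    have d: "dual_le (?u k) 1"
      using u unfolding dual_le_def
      by (auto intro: order_trans[OF nn_integral_mono[OF mult_right_mono[OF trunc_bounds(3)]]])
    have X1: "X (trunc j h) \<le> 1"
    proof -
      have "X (trunc j h) = Xext X (\<lambda>x. ennreal \<bar>trunc j h x\<bar>)" by (rule Xext_real[symmetric]) measurable
      also have "\<dots> \<le> Xext X h" using trunc_bounds(1,3)[of j h] by (intro N_mono AE_I2) auto
      finally show ?thesis using h by simp
    qed
    obtain W where W: "(\<integral>\<^sup>+ x. ?u k x \<partial>lborel) = ennreal W" "0 \<le> W"
    proof -
      have "(\<integral>\<^sup>+ x. ?u k x \<partial>lborel) \<le> (\<integral>\<^sup>+ x. of_nat k * indicator (ball (0::'a) (real k)) x \<partial>lborel)"
        by (intro nn_integral_mono) (auto simp: ennreal_trunc indicator_def)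
      also have "\<dots> < \<infinity>"
        using emeasure_lborel_ball_finite[of "0::'a" "real k"]
        by (subst nn_integral_cmult_indicator) (auto simp: ennreal_mult_less_top of_nat_less_top)
      finally show ?thesis using that by (cases "\<integral>\<^sup>+ x. ?u k x \<partial>lborel") auto
    qed
    have "\<forall>\<^sub>F m in sequentially. M_opnorm (assoc (Xpow X (1 / \<theta> m))) < ennreal (L + 1)"
      using L by (intro order_tendstoD(2)[OF L(1)]) (auto intro!: ennreal_lessI)
    then have "\<forall>\<^sub>F m in sequentially. (\<integral>\<^sup>+ x. Mx (?u k) x * ?h j x \<partial>lborel)
       \<le> ennreal ((L + 1) * ((1 - \<theta> m) * W + \<theta> m) * kk powr (1 - \<theta> m))"
    proof eventually_elim
      case (elim m)
      have "trunc j h x \<le> kk" for x using trunc_bounds(2)[of j h x] by (simp add: kk_def)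
      then show ?case
        using \<theta>(1)[of m] L(2)
        by (intro maximal_dual_bounded[OF _ _ Y[of m] elim _ _ _ W d _ _ _ X1]) (auto simp: trunc_bounds kk_def)
    qed
    moreover have "(\<lambda>m. ennreal ((L + 1) * ((1 - \<theta> m) * W + \<theta> m) * kk powr (1 - \<theta> m))) \<longlonglongrightarrow> ennreal ((L + 1) * ((1 - 1) * W + 1) * kk powr (1 - 1))"
      by (intro tendsto_ennrealI tendsto_intros \<theta>(2)) (simp add: kk_def)
    ultimately have "(\<integral>\<^sup>+ x. Mx (?u k) x * ?h j x \<partial>lborel) \<le> ennreal ((L + 1) * ((1 - 1) * W + 1) * kk powr (1 - 1))"
      by (intro tendsto_lowerbound[of _ _ sequentially]) auto
    then show ?thesis by (simp add: kk_def)
  qed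
  have h_sup: "(\<integral>\<^sup>+ x. Mx (?u k) x * h x \<partial>lborel) \<le> ennreal (L + 1)" for k
  proof -
    have "(\<integral>\<^sup>+ x. Mx (?u k) x * h x \<partial>lborel) = (\<integral>\<^sup>+ x. (SUP j. Mx (?u k) x * ?h j x) \<partial>lborel)"
      by (simp add: trunc_SUP flip: SUP_mult_left_ennreal)
    also have "\<dots> = (SUP j. \<integral>\<^sup>+ x. Mx (?u k) x * ?h j x \<partial>lborel)"
      using trunc_incseq[of h]
      by (intro nn_integral_monotone_convergence_SUP) (auto simp: incseq_def le_fun_def intro!: mult_left_mono)
    also have "\<dots> \<le> ennreal (L + 1)" by (intro SUP_least bound)
    finally show ?thesis .
  qed
  have "Mx u x = (SUP k. Mx (?u k) x)" for x
    using Mx_SUP[of ?u x] trunc_incseq[of u] by (simp add: trunc_SUP)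
  then have "(\<integral>\<^sup>+ x. Mx u x * h x \<partial>lborel) = (\<integral>\<^sup>+ x. (SUP k. Mx (?u k) x * h x) \<partial>lborel)"
    by (simp add: SUP_mult_right_ennreal)
  also have "\<dots> = (SUP k. \<integral>\<^sup>+ x. Mx (?u k) x * h x \<partial>lborel)"
    using trunc_incseq[of u]
    by (intro nn_integral_monotone_convergence_SUP) (auto simp: incseq_def le_fun_def intro!: mult_right_mono Mx_mono)
  also have "\<dots> \<le> ennreal (L + 1)" by (intro SUP_least h_sup)
  finally show "(\<integral>\<^sup>+ x. Mx u x * h x \<partial>lborel) \<le> ennreal (L + 1)" .
qed

end

section \<open>Interpolation\<close>

lemma BBM_quant_level_int:
  "BBM_quant X \<gamma> p \<sigma> f = (SUP lam\<in>{0<..}. ennreal lam * enn_powr (Xext X (level_int lam (\<gamma> / p) \<sigma> \<gamma> f)) (1 / p))"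
  by (simp add: BBM_quant_def level_int_def[abs_def] nn_integral_completion)

lemma enn_powr_ennreal: "0 \<le> a \<Longrightarrow> enn_powr (ennreal a) p = ennreal (a powr p)"
  by (simp add: enn_powr_def)

lemma enn_powr_top: "enn_powr top p = top"
  by (simp add: enn_powr_def)

lemma level_int_cong_AE:
  assumes "AE y in lborel. f y = f' y"
  shows "AE x in lborel. level_int lam \<beta> \<sigma> \<gamma> f x = level_int lam \<beta> \<sigma> \<gamma> f' x"
  using assms
proof eventually_elim
  case (elim x)
  have "AE y in lborel. indicator (Dset lam \<beta> \<sigma> f) (x, y) * ennreal (dist x y powr (\<gamma> - real DIM('a)))
      = indicator (Dset lam \<beta> \<sigma> f') (x, y) * ennreal (dist x y powr (\<gamma> - real DIM('a)))"
    using assms by eventually_elim (simp add: Dset_def indicator_def elim)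
  then show ?case unfolding level_int_def by (rule nn_integral_cong_AE)
qed

lemma Dset_interpolate:
  assumes \<eta>: "0 < \<eta>" "\<eta> < 1" and mu: "0 < \<mu>\<^sub>1" "0 < \<mu>\<^sub>2" "\<mu>\<^sub>1 powr (1 - \<eta>) * \<mu>\<^sub>2 powr \<eta> \<le> lam"
    and e: "\<sigma> + \<beta> = (1 - \<eta>) * (\<sigma>\<^sub>1 + \<beta>\<^sub>1) + \<eta> * (\<sigma>\<^sub>2 + \<beta>\<^sub>2)"
  shows "Dset lam \<beta> \<sigma> f \<subseteq> Dset \<mu>\<^sub>1 \<beta>\<^sub>1 \<sigma>\<^sub>1 f \<union> Dset \<mu>\<^sub>2 \<beta>\<^sub>2 \<sigma>\<^sub>2 f"
proof (rule subsetI, rule ccontr)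
  fix p assume p: "p \<in> Dset lam \<beta> \<sigma> f" "p \<notin> Dset \<mu>\<^sub>1 \<beta>\<^sub>1 \<sigma>\<^sub>1 f \<union> Dset \<mu>\<^sub>2 \<beta>\<^sub>2 \<sigma>\<^sub>2 f"
  obtain x y where xy: "p = (x, y)" by (cases p)
  define r where "r = dist x y"
  define d where "d = \<bar>f x - f y\<bar>"
  have r: "0 < r" and gt: "d / r powr (\<sigma> + \<beta>) > lam" using p(1) by (auto simp: xy Dset_def r_def d_def)
  then have le: "d \<le> \<mu>\<^sub>1 * r powr (\<sigma>\<^sub>1 + \<beta>\<^sub>1)" "d \<le> \<mu>\<^sub>2 * r powr (\<sigma>\<^sub>2 + \<beta>\<^sub>2)"
    using p by (auto simp: xy Dset_def r_def d_def not_less field_simps)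
  have d0: "0 \<le> d" by (simp add: d_def)
  have "d = d powr (1 - \<eta>) * d powr \<eta>" using d0 by (simp flip: powr_add)
  also have "\<dots> \<le> (\<mu>\<^sub>1 * r powr (\<sigma>\<^sub>1 + \<beta>\<^sub>1)) powr (1 - \<eta>) * (\<mu>\<^sub>2 * r powr (\<sigma>\<^sub>2 + \<beta>\<^sub>2)) powr \<eta>"
    using \<eta> le d0 by (intro mult_mono powr_mono2) auto
  also have "\<dots> = (\<mu>\<^sub>1 powr (1 - \<eta>) * \<mu>\<^sub>2 powr \<eta>) * r powr (\<sigma> + \<beta>)"
  proof -
    have "r powr (\<sigma> + \<beta>) = r powr ((1 - \<eta>) * (\<sigma>\<^sub>1 + \<beta>\<^sub>1)) * r powr (\<eta> * (\<sigma>\<^sub>2 + \<beta>\<^sub>2))"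
      unfolding e by (rule powr_add)
    then show ?thesis using mu r by (simp add: powr_mult powr_powr mult_ac)
  qed
  also have "\<dots> \<le> lam * r powr (\<sigma> + \<beta>)" using mu by (intro mult_right_mono) auto
  finally show False using gt r by (simp add: field_simps)
qed

context function_norm
begin

text \<open>Both level functions are made to obey the same bound T. The first has norm at most (a /
  \<mu>1)^q0 and the second at most b / \<mu>2; equating both with T determines \<mu>1 and \<mu>2.
  The relation between q, q0 and \<eta> then turns \<mu>1^(1-\<eta>) \<mu>2^\<eta> into P T^(-1/q),
  which equals lam for T = (P / lam)^q. The final factor 2 is a bound for 2^(1/q).\<close>

lemma level_int_interpolation:
  assumes \<eta>: "0 < \<eta>" "\<eta> < 1" and q: "1 < q" "0 < q\<^sub>0"
    and s: "s = (1 - \<eta>) * s\<^sub>0 + \<eta>" and qq: "1 / q = (1 - \<eta>) / q\<^sub>0 + \<eta>"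
    and [measurable]: "f \<in> borel_measurable borel" and B: "0 \<le> B" and lam: "0 < lam"
    and weak: "\<And>lam. 0 < lam \<Longrightarrow> N (level_int lam \<gamma> 1 \<gamma> f) \<le> ennreal (B / lam)"
    and A: "0 \<le> A" "\<And>lam. 0 < lam \<Longrightarrow> ennreal lam * enn_powr (N (level_int lam (\<gamma> / q\<^sub>0) s\<^sub>0 \<gamma> f)) (1 / q\<^sub>0) \<le> ennreal A"
  shows "ennreal lam * enn_powr (N (level_int lam (\<gamma> / q) s \<gamma> f)) (1 / q) \<le> ennreal (2 * (A powr (1 - \<eta>) * B powr \<eta>))"
proof -
  \<comment> \<open>\<open>A\<close> and \<open>B\<close> may be zero. Adding \<open>e\<close> makes
    P and T positive, and e tends to 0 at the end.\<close>
  have eps: "ennreal lam * enn_powr (N (level_int lam (\<gamma> / q) s \<gamma> f)) (1 / q) \<le> ennreal (2 * ((A + e) powr (1 - \<eta>) * (B + e) powr \<eta>))"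
    if e: "0 < e" for e
  proof -
    define a where "a = A + e"
    define b where "b = B + e"
    have ab: "0 < a" "0 < b" using A B e by (auto simp: a_def b_def)
    define P where "P = a powr (1 - \<eta>) * b powr \<eta>"
    have P: "0 < P" using ab by (simp add: P_def)
    define T where "T = (P / lam) powr q"
    have T: "0 < T" using P lam by (simp add: T_def)
    have T1: "T powr (1 / q) = P / lam" using q P lam by (simp add: T_def powr_powr)
    define \<mu>\<^sub>1 where "\<mu>\<^sub>1 = a * T powr (- (1 / q\<^sub>0))"
    define \<mu>\<^sub>2 where "\<mu>\<^sub>2 = b / T"
    have mu: "0 < \<mu>\<^sub>1" "0 < \<mu>\<^sub>2" using ab T by (auto simp: \<mu>\<^sub>1_def \<mu>\<^sub>2_def)
    have "\<mu>\<^sub>1 powr (1 - \<eta>) * \<mu>\<^sub>2 powr \<eta> = P * (T powr (- (1 / q\<^sub>0) * (1 - \<eta>)) * T powr (- \<eta>))"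
      using ab T unfolding \<mu>\<^sub>1_def \<mu>\<^sub>2_def P_def by (simp add: powr_mult powr_divide powr_powr powr_minus field_simps)
    also have "T powr (- (1 / q\<^sub>0) * (1 - \<eta>)) * T powr (- \<eta>) = T powr (- (1 / q))"
      unfolding powr_add[symmetric] qq by (simp add: algebra_simps)
    also have "\<dots> = lam / P" using T1 P by (simp add: powr_minus)
    finally have mu_eq: "\<mu>\<^sub>1 powr (1 - \<eta>) * \<mu>\<^sub>2 powr \<eta> = lam" using P by simp
    have exps: "s + \<gamma> / q = (1 - \<eta>) * (s\<^sub>0 + \<gamma> / q\<^sub>0) + \<eta> * (1 + \<gamma>)"
    proof -
      have "\<gamma> / q = \<gamma> * (1 / q)" by simp
      also have "\<dots> = (1 - \<eta>) * (\<gamma> / q\<^sub>0) + \<eta> * \<gamma>" unfolding qq by (simp add: algebra_simps)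
      finally show ?thesis unfolding s by (simp add: algebra_simps)
    qed
    let ?l = "level_int lam (\<gamma> / q) s \<gamma> f" and ?l1 = "level_int \<mu>\<^sub>1 (\<gamma> / q\<^sub>0) s\<^sub>0 \<gamma> f" and ?l2 = "level_int \<mu>\<^sub>2 \<gamma> 1 \<gamma> f"
    have "?l x \<le> ?l1 x + ?l2 x" for x
    proof -
      have "Dset lam (\<gamma> / q) s f \<subseteq> Dset \<mu>\<^sub>1 (\<gamma> / q\<^sub>0) s\<^sub>0 f \<union> Dset \<mu>\<^sub>2 \<gamma> 1 f"
        using mu_eq by (intro Dset_interpolate[OF \<eta> mu _ exps]) simp
      then have "?l x \<le> (\<integral>\<^sup>+ y. indicator (Dset \<mu>\<^sub>1 (\<gamma> / q\<^sub>0) s\<^sub>0 f) (x, y) * ennreal (dist x y powr (\<gamma> - real DIM('a)))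
          + indicator (Dset \<mu>\<^sub>2 \<gamma> 1 f) (x, y) * ennreal (dist x y powr (\<gamma> - real DIM('a))) \<partial>lborel)"
        unfolding level_int_def by (intro nn_integral_mono) (auto simp: indicator_def)
      also have "\<dots> = ?l1 x + ?l2 x" unfolding level_int_def by (intro nn_integral_add) measurable
      finally show ?thesis .
    qed
    then have "N ?l \<le> N (\<lambda>x. ?l1 x + ?l2 x)" by (intro N_mono) auto
    also have "\<dots> \<le> N ?l1 + N ?l2" by (intro N_add) measurable
    also have "N ?l1 \<le> ennreal T"
    proof -
      have le: "ennreal \<mu>\<^sub>1 * enn_powr (N ?l1) (1 / q\<^sub>0) \<le> ennreal a"
        by (rule order_trans[OF A(2)[OF mu(1)]]) (use e in \<open>simp add: a_def ennreal_leI\<close>)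
      then have "N ?l1 \<noteq> \<infinity>" using mu by (auto simp: enn_powr_top ennreal_mult_top top_unique)
      then obtain n where n: "N ?l1 = ennreal n" "0 \<le> n" by (cases "N ?l1") auto
      have "\<mu>\<^sub>1 * n powr (1 / q\<^sub>0) \<le> a"
        using le n mu ab by (simp add: enn_powr_ennreal flip: ennreal_mult)
      then have "n powr (1 / q\<^sub>0) \<le> a / \<mu>\<^sub>1" using mu by (simp add: field_simps)
      also have "\<dots> = T powr (1 / q\<^sub>0)" using ab T by (simp add: \<mu>\<^sub>1_def powr_minus field_simps)
      finally have "n powr (1 / q\<^sub>0) \<le> T powr (1 / q\<^sub>0)" .
      then have "(n powr (1 / q\<^sub>0)) powr q\<^sub>0 \<le> (T powr (1 / q\<^sub>0)) powr q\<^sub>0"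
        using q by (intro powr_mono2[of q\<^sub>0 "n powr (1 / q\<^sub>0)"]) auto
      then have "n \<le> T" using q n T by (simp add: powr_powr)
      then show ?thesis by (simp add: n ennreal_leI)
    qed
    also have "N ?l2 \<le> ennreal T"
    proof -
      have "B / \<mu>\<^sub>2 \<le> b / \<mu>\<^sub>2" using mu e by (intro divide_right_mono) (auto simp: b_def)
      also have "\<dots> = T" using ab T by (simp add: \<mu>\<^sub>2_def)
      finally show ?thesis using weak[OF mu(2)] by (auto intro: order_trans ennreal_leI)
    qed
    finally have NT: "N ?l \<le> ennreal (2 * T)" using T by (simp flip: ennreal_plus)
    then obtain n where n: "N ?l = ennreal n" "0 \<le> n" by (cases "N ?l") (auto simp: top_unique)
    have "n \<le> 2 * T" using NT n T by simp
    then have "n powr (1 / q) \<le> (2 * T) powr (1 / q)" using n q by (intro powr_mono2) auto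
    also have "\<dots> = 2 powr (1 / q) * (P / lam)" using T T1 by (simp add: powr_mult)
    also have "\<dots> \<le> 2 powr 1 * (P / lam)" using q P lam by (intro mult_right_mono powr_mono) auto
    finally have "lam * n powr (1 / q) \<le> 2 * P" using lam by (simp add: field_simps)
    then show ?thesis using n lam by (simp add: enn_powr_ennreal ennreal_leI P_def a_def b_def flip: ennreal_mult)
  qed
  have "((\<lambda>e. ennreal (2 * ((A + e) powr (1 - \<eta>) * (B + e) powr \<eta>))) \<longlongrightarrow> ennreal (2 * ((A + 0) powr (1 - \<eta>) * (B + 0) powr \<eta>))) (at_right 0)"
  proof (intro tendsto_ennrealI tendsto_mult tendsto_const)
    have ev: "\<forall>\<^sub>F e in at_right 0. 0 \<le> c + e" if "0 \<le> c" for c :: real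
      using that by (intro eventually_at_rightI[of 0 1]) auto
    show "((\<lambda>e. (A + e) powr (1 - \<eta>)) \<longlongrightarrow> (A + 0) powr (1 - \<eta>)) (at_right 0)"
      using \<eta> ev[OF A(1)] by (intro tendsto_powr' tendsto_intros) auto
    show "((\<lambda>e. (B + e) powr \<eta>) \<longlongrightarrow> (B + 0) powr \<eta>) (at_right 0)"
      using \<eta> ev[OF B] by (intro tendsto_powr' tendsto_intros) auto
  qed
  moreover have "\<forall>\<^sub>F e in at_right 0. ennreal lam * enn_powr (N (level_int lam (\<gamma> / q) s \<gamma> f)) (1 / q)
      \<le> ennreal (2 * ((A + e) powr (1 - \<eta>) * (B + e) powr \<eta>))"
    using eps by (intro eventually_at_rightI[of 0 1]) auto
  ultimately show ?thesis
    using tendsto_lowerbound[of _ _ "at_right (0::real)"] by fastforce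
qed

text \<open>Whatever the exponents, a level set for positive lam consists of pairs with x \<noteq> y
  and f(x) \<noteq> f(y), and the set of these pairs is the union of the endpoint level sets for the
  thresholds 1 / (k + 1).\<close>

lemma level_int_eq_0:
  assumes [measurable]: "f \<in> borel_measurable borel"
    and zero: "\<And>lam. 0 < lam \<Longrightarrow> N (level_int lam \<gamma> 1 \<gamma> f) = 0" and lam: "0 < lam"
  shows "N (level_int lam \<beta> \<sigma> \<gamma> f) = 0"
proof -
  have "AE x in lborel. level_int (1 / real (Suc k)) \<gamma> 1 \<gamma> f x = 0" for k
    using zero[of "1 / real (Suc k)"] by (intro N_zero) auto
  then have "AE x in lborel. \<forall>k. level_int (1 / real (Suc k)) \<gamma> 1 \<gamma> f x = 0"
    by (subst AE_all_countable) blast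
  then have "AE x in lborel. level_int lam \<beta> \<sigma> \<gamma> f x = 0"
  proof eventually_elim
    case (elim x)
    let ?k = "\<lambda>y. ennreal (dist x y powr (\<gamma> - real DIM('a)))"
    have "level_int lam \<beta> \<sigma> \<gamma> f x \<le> (\<integral>\<^sup>+ y. (\<Sum>k. indicator (Dset (1 / real (Suc k)) \<gamma> 1 f) (x, y) * ?k y) \<partial>lborel)"
      unfolding level_int_def
    proof (intro nn_integral_mono)
      fix y
      show "indicator (Dset lam \<beta> \<sigma> f) (x, y) * ?k y \<le> (\<Sum>k. indicator (Dset (1 / real (Suc k)) \<gamma> 1 f) (x, y) * ?k y)"
      proof (cases "(x, y) \<in> Dset lam \<beta> \<sigma> f")
        case True
        then have "x \<noteq> y" "f x \<noteq> f y" using lam by (auto simp: Dset_def)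
        then have "0 < \<bar>f x - f y\<bar> / dist x y powr (1 + \<gamma>)" by simp
        then obtain k :: nat where "inverse (real (Suc k)) < \<bar>f x - f y\<bar> / dist x y powr (1 + \<gamma>)" using reals_Archimedean by blast
        then have "(x, y) \<in> Dset (1 / real (Suc k)) \<gamma> 1 f" using \<open>x \<noteq> y\<close> by (simp add: Dset_def inverse_eq_divide)
        then have "indicator (Dset lam \<beta> \<sigma> f) (x, y) * ?k y = indicator (Dset (1 / real (Suc k)) \<gamma> 1 f) (x, y) * ?k y" using True by simp
        also have "\<dots> \<le> (\<Sum>k. indicator (Dset (1 / real (Suc k)) \<gamma> 1 f) (x, y) * ?k y)"
          by (rule le_suminf_ennreal[of "\<lambda>k. indicator (Dset (1 / real (Suc k)) \<gamma> 1 f) (x, y) * ?k y" k])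
        finally show ?thesis .
      qed simp
    qed
    also have "\<dots> = (\<Sum>k. level_int (1 / real (Suc k)) \<gamma> 1 \<gamma> f x)"
      unfolding level_int_def by (intro nn_integral_suminf) measurable
    also have "\<dots> = 0" using elim by simp
    finally show ?case by simp
  qed
  then have "N (level_int lam \<beta> \<sigma> \<gamma> f) = N (\<lambda>_. 0)" by (intro N_cong_AE) auto
  also have "\<dots> = 0" using N_cmult[of "\<lambda>_. 0" 0] by simp
  finally show ?thesis .
qed

end

text \<open>The case b = 0 is separate because the right-hand side may then be \<infinity> * 0, which is 0.\<close>

lemma (in ball_space) BBM_interpolation:
  assumes \<eta>: "0 < \<eta>" "\<eta> < 1" and q: "1 < q" "0 < q\<^sub>0"
    and s: "s = (1 - \<eta>) * s\<^sub>0 + \<eta>" and qq: "1 / q = (1 - \<eta>) / q\<^sub>0 + \<eta>"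
    and [measurable]: "f \<in> borel_measurable borel" and K: "0 < K" and b: "b < \<infinity>"
    and weak: "\<And>lam. 0 < lam \<Longrightarrow> Xext X (level_int lam \<gamma> 1 \<gamma> f) \<le> ennreal (K / lam) * b"
  shows "BBM_quant X \<gamma> q s f \<le> ennreal (2 * K powr \<eta>) * enn_powr (BBM_quant X \<gamma> q\<^sub>0 s\<^sub>0 f) (1 - \<eta>) * enn_powr b \<eta>"
  unfolding BBM_quant_level_int[of X \<gamma> q s f]
proof (intro SUP_least)
  fix lam :: real assume "lam \<in> {0<..}"
  then have lam: "0 < lam" by simp
  obtain \<beta> where \<beta>: "b = ennreal \<beta>" "0 \<le> \<beta>" using b by (cases b) auto
  let ?A = "BBM_quant X \<gamma> q\<^sub>0 s\<^sub>0 f"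
  show "ennreal lam * enn_powr (Xext X (level_int lam (\<gamma> / q) s \<gamma> f)) (1 / q)
     \<le> ennreal (2 * K powr \<eta>) * enn_powr ?A (1 - \<eta>) * enn_powr b \<eta>"
  proof (cases "\<beta> = 0")
    case True
    have "Xext X (level_int lam (\<gamma> / q) s \<gamma> f) = 0"
      by (rule level_int_eq_0[OF _ _ lam]) (use weak True \<beta> in auto)
    then show ?thesis by (simp add: enn_powr_def)
  next
    case False
    then have pos: "0 < ennreal (2 * K powr \<eta>)" "0 < enn_powr b \<eta>"
      using \<beta> K by (auto simp: enn_powr_ennreal)
    show ?thesis
    proof (cases "?A = \<infinity>")
      case True
      then have "ennreal (2 * K powr \<eta>) * enn_powr ?A (1 - \<eta>) * enn_powr b \<eta> = \<infinity>"
        using pos by (simp add: enn_powr_top ennreal_mult_eq_top_iff)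
      then show ?thesis by simp
    next
      case fin: False
      then obtain A where A: "?A = ennreal A" "0 \<le> A" by (cases ?A) auto
      have "ennreal lam * enn_powr (Xext X (level_int lam (\<gamma> / q) s \<gamma> f)) (1 / q) \<le> ennreal (2 * (A powr (1 - \<eta>) * (K * \<beta>) powr \<eta>))"
      proof (rule level_int_interpolation[OF \<eta> q s qq _ _ lam _ A(2)])
        show "Xext X (level_int lam \<gamma> 1 \<gamma> f) \<le> ennreal (K * \<beta> / lam)" if "0 < lam" for lam
          using weak[OF that] K \<beta> that by (simp flip: ennreal_mult)
        show "ennreal lam * enn_powr (Xext X (level_int lam (\<gamma> / q\<^sub>0) s\<^sub>0 \<gamma> f)) (1 / q\<^sub>0) \<le> ennreal A" if "0 < lam" for lam
          unfolding A(1)[symmetric] BBM_quant_level_int using that by (intro SUP_upper2[of lam]) auto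
      qed (use K \<beta> in auto)
      also have "2 * (A powr (1 - \<eta>) * (K * \<beta>) powr \<eta>) = 2 * K powr \<eta> * A powr (1 - \<eta>) * \<beta> powr \<eta>"
        using K \<beta> by (simp add: powr_mult)
      also have "ennreal \<dots> = ennreal (2 * K powr \<eta>) * enn_powr ?A (1 - \<eta>) * enn_powr b \<eta>"
        using A \<beta> by (simp add: enn_powr_ennreal flip: ennreal_mult)
      finally show ?thesis .
    qed
  qed
qed

lemma (in ball_space) BBM_quant_cong_AE:
  assumes [measurable]: "f' \<in> borel_measurable borel" and eq: "AE x in lborel. f x = f' x"
  shows "BBM_quant X \<gamma> p \<sigma> f = BBM_quant X \<gamma> p \<sigma> f'"
proof -
  have "Xext X (level_int lam (\<gamma> / p) \<sigma> \<gamma> f) = Xext X (level_int lam (\<gamma> / p) \<sigma> \<gamma> f')" for lam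
    by (intro Xext_cong_AE level_int_cong_AE eq) measurable
  then show ?thesis by (simp add: BBM_quant_level_int)
qed

section \<open>Borel representatives of Sobolev functions\<close>

text \<open>The gradient hidden in \<open>smooth_fn\<close> has differentiable components, and by
  uniqueness of the derivative it is the given one.\<close>

lemma smooth_fn_gradient_continuous:
  assumes "smooth_fn \<phi>" and G: "\<And>x. (\<phi> has_derivative (\<lambda>h. G x \<bullet> h)) (at x)"
  shows "continuous_on UNIV G"
  using assms(1)
proof cases
  case (1 G')
  have cont: "continuous_on UNIV u" if "smooth_fn u" for u :: "'a \<Rightarrow> real"
    using that by cases (meson continuous_at_imp_continuous_on has_derivative_continuous)
  have "G' x = G x" for x
  proof (rule euclidean_eqI)
    fix i :: 'a
    have "(\<lambda>h. G' x \<bullet> h) = (\<lambda>h. G x \<bullet> h)" using 1(1) G by (intro has_derivative_unique[of \<phi>]) auto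
    then show "G' x \<bullet> i = G x \<bullet> i" by (rule fun_cong)
  qed
  moreover have "continuous_on UNIV G'"
    by (rule continuous_on_componentwise[THEN iffD2]) (use 1(2) cont in blast)
  ultimately show ?thesis by (simp add: ext[of G' G])
qed

lemma locally_integrable_borel:
  fixes f :: "'a::euclidean_space \<Rightarrow> 'b::euclidean_space"
  assumes f: "locally_integrable f"
  obtains f' where "f' \<in> borel_measurable borel" "AE x in lborel. f x = f' x" "f \<in> borel_measurable lebesgue"
    "\<And>R. integrable lborel (\<lambda>y. indicator (ball 0 R) y *\<^sub>R f' y)"
proof -
  have int: "integrable lebesgue (\<lambda>x. indicator (cball 0 R) x *\<^sub>R f x)" for R
    using f by (auto simp: locally_integrable_def set_integrable_def)
  have fm [measurable]: "f \<in> borel_measurable lebesgue"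
  proof (rule borel_measurable_LIMSEQ_metric)
    show "(\<lambda>x. indicator (cball 0 (real n)) x *\<^sub>R f x) \<in> borel_measurable lebesgue" for n
      using int[of "real n"] by auto
    show "(\<lambda>n. indicator (cball 0 (real n)) x *\<^sub>R f x) \<longlonglongrightarrow> f x" for x
    proof (rule tendsto_eventually)
      obtain m :: nat where "norm x \<le> real m" using real_arch_simple by blast
      then show "\<forall>\<^sub>F n in sequentially. indicator (cball 0 (real n)) x *\<^sub>R f x = f x"
        unfolding eventually_sequentially by (intro exI[of _ m]) auto
    qed
  qed
  have "\<exists>g. g \<in> borel_measurable borel \<and> (AE x in lborel. f x \<bullet> b = g x)" for b
    using completion_ex_borel_measurable_real[of "\<lambda>x. f x \<bullet> b" lborel] by auto
  then obtain g where g: "\<And>b. g b \<in> borel_measurable borel" "\<And>b. AE x in lborel. f x \<bullet> b = g b x" by metis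
  define f' where "f' x = (\<Sum>b\<in>Basis. g b x *\<^sub>R b)" for x
  note [measurable] = g(1)
  have f'm [measurable]: "f' \<in> borel_measurable borel" unfolding f'_def by measurable
  have "AE x in lborel. \<forall>b\<in>Basis. f x \<bullet> b = g b x" by (rule AE_finite_allI) (auto simp: g)
  then have eq: "AE x in lborel. f x = f' x"
  proof eventually_elim
    case (elim x)
    have "f x = (\<Sum>b\<in>Basis. (f x \<bullet> b) *\<^sub>R b)" by (simp add: euclidean_representation)
    then show ?case using elim by (simp add: f'_def)
  qed
  have "integrable lborel (\<lambda>y. indicator (ball 0 R) y *\<^sub>R f' y)" for R
  proof -
    have "AE x in lebesgue. f x = f' x" using eq by (simp only: AE_lebesgue_iff)
    then have "AE x in lebesgue. indicator (cball 0 R) x *\<^sub>R f x = indicator (cball 0 R) x *\<^sub>R f' x" by eventually_elim simp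
    moreover have m: "(\<lambda>x. indicator (cball 0 R) x *\<^sub>R f' x) \<in> borel_measurable lborel" by measurable
    ultimately have "integrable lebesgue (\<lambda>x. indicator (cball 0 R) x *\<^sub>R f' x)"
      using int[of R] borel_measurable_integrable[OF int[of R]] measurable_completion[OF m]
      by (subst (asm) integrable_cong_AE) auto
    then have "integrable lborel (\<lambda>x. indicator (cball 0 R) x *\<^sub>R f' x)" using m by (simp only: integrable_completion)
    then show ?thesis by (rule Bochner_Integration.integrable_bound) (auto simp: indicator_def)
  qed
  with f'm eq fm show ?thesis by (rule that)
qed

text \<open>The exchanges of integrals are carried out for \<open>lborel\<close>, so
  \<open>f\<close> and \<open>G\<close> are replaced by Borel functions that agree with them almost
  everywhere; the identity for test functions involves only integrals and is inherited.\<close>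

lemma weak_gradient_borel:
  fixes f :: "'a::euclidean_space \<Rightarrow> real"
  assumes "weak_gradient f G"
  obtains f' G' where "f' \<in> borel_measurable borel" "G' \<in> borel_measurable borel"
    "AE x in lborel. f x = f' x" "AE x in lborel. G x = G' x"
    "\<And>R. integrable lborel (\<lambda>y. indicator (ball 0 R) y *\<^sub>R f' y)"
    "\<And>R. integrable lborel (\<lambda>y. indicator (ball 0 R) y *\<^sub>R G' y)"
    "\<And>\<phi> G\<phi>. test_fn \<phi> \<Longrightarrow> (\<And>x. (\<phi> has_derivative (\<lambda>h. G\<phi> x \<bullet> h)) (at x)) \<Longrightarrow>
        (\<integral>x. f' x *\<^sub>R G\<phi> x \<partial>lborel) = - (\<integral>x. \<phi> x *\<^sub>R G' x \<partial>lborel)"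
proof -
  have lf: "locally_integrable f" and lG: "locally_integrable G"
    and weak: "\<And>\<phi> G\<phi>. test_fn \<phi> \<Longrightarrow> (\<And>x. (\<phi> has_derivative (\<lambda>h. G\<phi> x \<bullet> h)) (at x)) \<Longrightarrow>
        (\<integral>x. f x *\<^sub>R G\<phi> x \<partial>lebesgue) = - (\<integral>x. \<phi> x *\<^sub>R G x \<partial>lebesgue)"
    using assms unfolding weak_gradient_def by blast+
  obtain f' where f': "f' \<in> borel_measurable borel" "AE x in lborel. f x = f' x" "f \<in> borel_measurable lebesgue"
    "\<And>R. integrable lborel (\<lambda>y. indicator (ball 0 R) y *\<^sub>R f' y)"
    using locally_integrable_borel[OF lf] by blast
  obtain G' where G': "G' \<in> borel_measurable borel" "AE x in lborel. G x = G' x" "G \<in> borel_measurable lebesgue"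
    "\<And>R. integrable lborel (\<lambda>y. indicator (ball 0 R) y *\<^sub>R G' y)"
    using locally_integrable_borel[OF lG] by blast
  note [measurable] = f'(1) G'(1) f'(3) G'(3)
  have "(\<integral>x. f' x *\<^sub>R G\<phi> x \<partial>lborel) = - (\<integral>x. \<phi> x *\<^sub>R G' x \<partial>lborel)"
    if \<phi>: "test_fn \<phi>" and d: "\<And>x. (\<phi> has_derivative (\<lambda>h. G\<phi> x \<bullet> h)) (at x)" for \<phi> :: "'a \<Rightarrow> real" and G\<phi>
  proof -
    have sm: "smooth_fn \<phi>" using \<phi> by (simp add: test_fn_def)
    have [measurable]: "G\<phi> \<in> borel_measurable borel"
      by (rule borel_measurable_continuous_onI, rule smooth_fn_gradient_continuous[OF sm d])
    have "continuous_on UNIV \<phi>" using d by (meson continuous_at_imp_continuous_on has_derivative_continuous)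
    then have [measurable]: "\<phi> \<in> borel_measurable borel" by (rule borel_measurable_continuous_onI)
    have leb: "G\<phi> \<in> borel_measurable lebesgue" "\<phi> \<in> borel_measurable lebesgue" "f' \<in> borel_measurable lebesgue" "G' \<in> borel_measurable lebesgue"
      by (rule measurable_completion, simp)+
    have "(\<integral>x. f' x *\<^sub>R G\<phi> x \<partial>lborel) = (\<integral>x. f' x *\<^sub>R G\<phi> x \<partial>lebesgue)"
      by (rule integral_completion[symmetric]) measurable
    also have "\<dots> = (\<integral>x. f x *\<^sub>R G\<phi> x \<partial>lebesgue)"
    proof (rule integral_cong_AE)
      have "AE x in lebesgue. f x = f' x" using f'(2) by (simp only: AE_lebesgue_iff)
      then show "AE x in lebesgue. f' x *\<^sub>R G\<phi> x = f x *\<^sub>R G\<phi> x" by eventually_elim simp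
    qed (use leb f'(3) in \<open>auto intro!: borel_measurable_scaleR\<close>)
    also have "\<dots> = - (\<integral>x. \<phi> x *\<^sub>R G x \<partial>lebesgue)" by (rule weak[OF \<phi> d])
    also have "(\<integral>x. \<phi> x *\<^sub>R G x \<partial>lebesgue) = (\<integral>x. \<phi> x *\<^sub>R G' x \<partial>lebesgue)"
    proof (rule integral_cong_AE)
      have "AE x in lebesgue. G x = G' x" using G'(2) by (simp only: AE_lebesgue_iff)
      then show "AE x in lebesgue. \<phi> x *\<^sub>R G x = \<phi> x *\<^sub>R G' x" by eventually_elim simp
    qed (use leb G'(3) in \<open>auto intro!: borel_measurable_scaleR\<close>)
    also have "\<dots> = (\<integral>x. \<phi> x *\<^sub>R G' x \<partial>lborel)" by (rule integral_completion) measurable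
    finally show ?thesis .
  qed
  with f'(1,2,4) G'(1,2,4) show ?thesis by (intro that) auto
qed

theorem theorem4p4:
  fixes X :: "('a::euclidean_space \<Rightarrow> real) \<Rightarrow> ennreal"
    and \<gamma> \<eta> s0 s q q0 :: real and \<theta> :: "nat \<Rightarrow> real"
  assumes "\<gamma> \<noteq> 0" and "0 < \<eta>" and "\<eta> < 1"
    and "0 \<le> s0" and "s0 < s" and "s < 1" and "1 < q" and "q < q0"
    and "s = (1 - \<eta>) * s0 + \<eta>" and "1 / q = (1 - \<eta>) / q0 + \<eta>"
    and "ball_Banach_fs X"
    and "\<forall>m. 0 < \<theta> m \<and> \<theta> m < 1" and "\<theta> \<longlonglongrightarrow> 1"
    and "\<forall>m. ball_Banach_fs (Xpow X (1 / \<theta> m))"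
    and "\<forall>m. M_bounded (assoc (Xpow X (1 / \<theta> m)))"
    and "\<exists>L<\<infinity>. (\<lambda>m. M_opnorm (assoc (Xpow X (1 / \<theta> m)))) \<longlonglongrightarrow> L"
    and "\<gamma> < 0 \<longrightarrow> M_bounded X \<or> (DIM('a) = 1 \<and> \<gamma> < -1)"
  shows "\<exists>C>0.
    (\<forall>f G. (\<forall>x. (f has_derivative (\<lambda>h. G x \<bullet> h)) (at x)) \<longrightarrow> continuous_on UNIV G
        \<longrightarrow> bounded {x. G x \<noteq> 0} \<longrightarrow>
        BBM_quant X \<gamma> q s f \<le> ennreal C * enn_powr (BBM_quant X \<gamma> q0 s0 f) (1 - \<eta>)
                                 * enn_powr (X (\<lambda>x. norm (G x))) \<eta>) \<and>
    (abs_cont_norm X \<and> ball_avg_unif_bounded X \<longrightarrow>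
      (\<forall>f G. in_hom_Sobolev X f G \<longrightarrow>
        BBM_quant X \<gamma> q s f \<le> ennreal C * enn_powr (BBM_quant X \<gamma> q0 s0 f) (1 - \<eta>)
                                 * enn_powr (X (\<lambda>x. norm (G x))) \<eta>))"
proof -
  interpret ball_space X by unfold_locales (rule assms)
  obtain L where "L < \<infinity>" "(\<lambda>m. M_opnorm (assoc (Xpow X (1 / \<theta> m)))) \<longlonglongrightarrow> L" using assms by blast
  then obtain l where l: "0 \<le> l" "(\<lambda>m. M_opnorm (assoc (Xpow X (1 / \<theta> m)))) \<longlonglongrightarrow> ennreal l"
    by (cases L) auto
  interpret maximal_norm "Xext X" "l + 1"
  proof
    show "0 < l + 1" using l by simp
    fix u :: "'a \<Rightarrow> ennreal" assume "u \<in> borel_measurable borel" "dual_le u 1"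
    then show "dual_le (Mx u) (ennreal (l + 1))"
      using assms(12-14) l by (intro dual_maximal_operator[of \<theta> l u]) auto
  qed
  have "\<exists>C>0. \<forall>lam>0. \<forall>f g u. f \<in> borel_measurable borel \<longrightarrow> g \<in> borel_measurable borel \<longrightarrow> u \<in> borel_measurable borel
     \<longrightarrow> seg_bound f g \<longrightarrow> Xext X g < \<infinity> \<longrightarrow> dual_le u 1 \<longrightarrow>
     (\<integral>\<^sup>+ x. u x * level_int lam \<gamma> 1 \<gamma> f x \<partial>lborel) \<le> ennreal (C / lam) * Xext X g"
    using Mx_bounded assms(1,17) by (intro level_int_dual_bound) auto
  then obtain C0 where C0: "0 < C0" and dual: "\<And>lam f g u. 0 < lam \<Longrightarrow> f \<in> borel_measurable borel \<Longrightarrow> g \<in> borel_measurable borel \<Longrightarrow> u \<in> borel_measurable borel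
     \<Longrightarrow> seg_bound f g \<Longrightarrow> Xext X g < \<infinity> \<Longrightarrow> dual_le u 1 \<Longrightarrow>
     (\<integral>\<^sup>+ x. u x * level_int lam \<gamma> 1 \<gamma> f x \<partial>lborel) \<le> ennreal (C0 / lam) * Xext X g" by blast
  \<comment> \<open>One constant serves both classes of functions: the summand 1 is for C^1
    functions, whose segment bound holds directly, and \<open>sobolev_const\<close> accounts for the
    loss under mollification.\<close>
  define K where "K = C0 * (1 + sobolev_const)"
  have sc: "0 \<le> sobolev_const" using l by (simp add: sobolev_const_def)
  have K: "0 < K" using C0 sc by (simp add: K_def add_pos_nonneg)
  have K1: "ennreal (C0 / lam) \<le> ennreal (K / lam)" "ennreal (C0 / lam * sobolev_const) \<le> ennreal (K / lam)" if "0 < lam" for lam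
    using that C0 sc by (auto intro!: ennreal_leI simp: K_def field_simps)
  note interp = BBM_interpolation[OF assms(2,3,7) _ assms(9,10) _ K]
  have q0: "0 < q0" using assms(7,8) by simp
  show ?thesis
  proof (intro exI[of _ "2 * K powr \<eta>"] conjI allI impI)
    show "0 < 2 * K powr \<eta>" using K by simp
  next
    fix f :: "'a \<Rightarrow> real" and G :: "'a \<Rightarrow> 'a"
    assume d: "\<forall>x. (f has_derivative (\<lambda>h. G x \<bullet> h)) (at x)" and G: "continuous_on UNIV G" and bd: "bounded {x. G x \<noteq> 0}"
    have "continuous_on UNIV f" using d by (meson continuous_at_imp_continuous_on has_derivative_continuous)
    then have fm [measurable]: "f \<in> borel_measurable borel" by (rule borel_measurable_continuous_onI)
    have Gm [measurable]: "G \<in> borel_measurable borel" using G by (rule borel_measurable_continuous_onI)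
    have XG: "Xext X (\<lambda>x. ennreal (norm (G x))) = X (\<lambda>x. norm (G x))"
      using Xext_real[of "\<lambda>x. norm (G x)"] by simp
    have fin: "X (\<lambda>x. norm (G x)) < \<infinity>"
    proof -
      obtain R where R: "{x. G x \<noteq> 0} \<subseteq> ball 0 R" using bounded_subset_ballD[OF bd, of 0] by blast
      have "compact (G ` cball 0 R)" using G by (intro compact_continuous_image continuous_on_subset[OF G]) auto
      then obtain M where M: "\<And>x. x \<in> cball 0 R \<Longrightarrow> norm (G x) \<le> M" using compact_imp_bounded bounded_iff by (metis imageI)
      have le: "norm (G x) \<le> \<bar>M\<bar> * indicator (ball 0 R) x" for x
        using R M[of x] by (cases "x \<in> ball 0 R") auto
      have "X (\<lambda>x. norm (G x)) \<le> X (\<lambda>x. \<bar>M\<bar> * indicator (ball 0 R) x)"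
        using le by (intro X_mono borel_imp_meas AE_I2) (auto intro: order_trans[OF _ abs_ge_self])
      also have "\<dots> = ennreal \<bar>M\<bar> * X (indicator (ball 0 R))"
        using X_cmult[of "indicator (ball 0 R)" "\<bar>M\<bar>"] by (simp add: borel_imp_meas)
      also have "\<dots> < \<infinity>" using X_ball[of 0 R] by (simp add: ennreal_mult_less_top)
      finally show ?thesis .
    qed
    have sb: "seg_bound f (\<lambda>x. ennreal (norm (G x)))" using d G by (intro seg_bound_gradient) auto
    show "BBM_quant X \<gamma> q s f \<le> ennreal (2 * K powr \<eta>) * enn_powr (BBM_quant X \<gamma> q0 s0 f) (1 - \<eta>) * enn_powr (X (\<lambda>x. norm (G x))) \<eta>"
    proof (rule interp[OF q0 fm fin])
      fix lam :: real assume lam: "0 < lam"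
      have "Xext X (level_int lam \<gamma> 1 \<gamma> f) \<le> ennreal (C0 / lam) * Xext X (\<lambda>x. ennreal (norm (G x)))"
        by (intro Lorentz_Luxemburg dual lam sb) (use fin XG in auto)
      also have "\<dots> \<le> ennreal (K / lam) * X (\<lambda>x. norm (G x))" unfolding XG by (intro mult_right_mono K1 lam) simp
      finally show "Xext X (level_int lam \<gamma> 1 \<gamma> f) \<le> ennreal (K / lam) * X (\<lambda>x. norm (G x))" .
    qed
  next
    fix f :: "'a \<Rightarrow> real" and G :: "'a \<Rightarrow> 'a"
    assume "in_hom_Sobolev X f G"
    then have weak: "weak_gradient f G" and finG: "X (\<lambda>x. norm (G x)) < \<infinity>" by (auto simp: in_hom_Sobolev_def)
    obtain f' G' where fG: "f' \<in> borel_measurable borel" "G' \<in> borel_measurable borel"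
      "AE x in lborel. f x = f' x" "AE x in lborel. G x = G' x"
      "\<And>R. integrable lborel (\<lambda>y. indicator (ball 0 R) y *\<^sub>R f' y)"
      "\<And>R. integrable lborel (\<lambda>y. indicator (ball 0 R) y *\<^sub>R G' y)"
      "\<And>\<phi> G\<phi>. test_fn \<phi> \<Longrightarrow> (\<And>x. (\<phi> has_derivative (\<lambda>h. G\<phi> x \<bullet> h)) (at x)) \<Longrightarrow>
          (\<integral>x. f' x *\<^sub>R G\<phi> x \<partial>lborel) = - (\<integral>x. \<phi> x *\<^sub>R G' x \<partial>lborel)"
      using weak_gradient_borel[OF weak] by blast
    note [measurable] = fG(1,2)
    have XG: "Xext X (\<lambda>x. ennreal (norm (G' x))) = X (\<lambda>x. norm (G x))"
    proof -
      have "X (\<lambda>x. norm (G' x)) = X (\<lambda>x. norm (G x))"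
        using fG(4) by (intro X_cong_AE borel_imp_meas) (measurable, auto)
      then show ?thesis using Xext_real[of "\<lambda>x. norm (G' x)"] by simp
    qed
    have "BBM_quant X \<gamma> q s f' \<le> ennreal (2 * K powr \<eta>) * enn_powr (BBM_quant X \<gamma> q0 s0 f') (1 - \<eta>) * enn_powr (X (\<lambda>x. norm (G x))) \<eta>"
    proof (rule interp[OF q0 fG(1) finG])
      fix lam :: real assume lam: "0 < lam"
      have "Xext X (level_int lam \<gamma> 1 \<gamma> f') \<le> ennreal (C0 / lam * sobolev_const) * Xext X (\<lambda>x. ennreal (norm (G' x)))"
        by (rule level_int_sobolev[OF fG(1,2,5,7,6) _ dual[OF lam]]) (use finG XG C0 lam in auto)
      also have "\<dots> \<le> ennreal (K / lam) * X (\<lambda>x. norm (G x))" unfolding XG by (intro mult_right_mono K1 lam) simp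
      finally show "Xext X (level_int lam \<gamma> 1 \<gamma> f') \<le> ennreal (K / lam) * X (\<lambda>x. norm (G x))" .
    qed
    then show "BBM_quant X \<gamma> q s f \<le> ennreal (2 * K powr \<eta>) * enn_powr (BBM_quant X \<gamma> q0 s0 f) (1 - \<eta>) * enn_powr (X (\<lambda>x. norm (G x))) \<eta>"
      by (simp only: BBM_quant_cong_AE[OF fG(1,3)])
  qed
qed


end
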